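(* Let $R$ be a Noetherian super-ring with $\mathrm{Kdim}(R_0)<\infty$, let $I=I_R=RR_1$ be the superideal generated by $R_1$, and let $M$ be a nonzero finitely generated $R$-supermodule. Then $$\mathrm{sdim}(M)=\mathrm{sdim}(\mathsf{gr}_I(M)),$$ i.e. $\mathrm{sdim}_0(M)=\mathrm{sdim}_0(\mathsf{gr}_I(M))$ and $\mathrm{sdim}_1(M)=\mathrm{sdim}_1(\mathsf{gr}_I(M))$, where $\mathsf{gr}_I(M)$ is regarded as a supermodule over $\mathsf{gr}_I(R)$.
   Context: A super-ring is a unital associative $\mathbb{Z}_2$-graded ring $R=R_0\oplus R_1$; all super-rings are super-commutative ($ab=(-1)^{|a||b|}ba$ for homogeneous $a,b$, and $a^2=0$ for odd $a$). Superideals are $\mathbb{Z}_2$-graded ideals; supermodules are $\mathbb{Z}_2$-graded modules. Noetherian means the ascending chain condition on superideals. For a Noetherian super-ring $S$ with $\mathrm{Kdim}(S_0)<\infty$ and a nonzero $S$-supermodule $N$: $\dim(N)=\mathrm{Kdim}(S_0/\mathrm{Ann}_{S_0}(N))$ (with $\dim(0)=-\infty$); $\mathrm{sdim}_0(N)=\dim(N)$; a collection $y_1,\dots,y_l\in S_1$ ($l\ge1$) is a system of odd parameters of $N$ if $\dim(y_1\cdots y_l N)=\dim(N)$; $\mathrm{sdim}_1(N)$ is the largest length $l$ of a system of odd parameters of $N$, or $0$ if there is none; $\mathrm{sdim}(N)=\mathrm{sdim}_0(N)\mid\mathrm{sdim}_1(N)$. $\mathsf{gr}_I(R)=\bigoplus_{n\ge0}I^n/I^{n+1}$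 is a super-ring (again Noetherian with even part of finite Krull dimension) and $\mathsf{gr}_I(M)=\bigoplus_{n\ge0}I^nM/I^{n+1}M$ is a $\mathsf{gr}_I(R)$-supermodule. *)

theory Defs
  imports
    "HOL-Algebra.QuotRing"
    "HOL-Algebra.Ideal_Product"
    "HOL-Algebra.Module"
    "HOL-Library.Z2"
    "HOL-Library.Extended_Real"
begin

section \<open>Super-rings\<close>

text \<open>The grading group \<open>\<int>\<^sub>2\<close> is the type \<^typ>\<open>bit\<close>; \<open>rpart R i\<close> is the homogeneous
  component \<open>R\<^sub>i\<close>.\<close>

record 'a superring = "'a ring" +
  rpart :: "bit \<Rightarrow> 'a set"

locale superring = ring R for R :: "('a, 'c) superring_scheme" (structure) +
  assumes part_subgroup: "\<And>i. subgroup (rpart R i) (add_monoid R)"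
    and part_sum: "carrier R = rpart R 0 <+>\<^bsub>R\<^esub> rpart R 1"
    and part_disjoint: "rpart R 0 \<inter> rpart R 1 = {\<zero>}"
    and part_mult: "\<And>i j a b. \<lbrakk>a \<in> rpart R i; b \<in> rpart R j\<rbrakk> \<Longrightarrow> a \<otimes> b \<in> rpart R (i + j)"
    and supercomm: "\<And>i j a b. \<lbrakk>a \<in> rpart R i; b \<in> rpart R j\<rbrakk> \<Longrightarrow>
      a \<otimes> b = (if i * j = 1 then \<ominus> (b \<otimes> a) else b \<otimes> a)"
    and odd_square: "\<And>a. a \<in> rpart R 1 \<Longrightarrow> a \<otimes> a = \<zero>"

definition superideal :: "'a set \<Rightarrow> ('a, 'c) superring_scheme \<Rightarrow> bool" where
  "superideal J R \<longleftrightarrow> ideal J R \<and> J = (J \<inter> rpart R 0) <+>\<^bsub>R\<^esub> (J \<inter> rpart R 1)"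

locale noetherian_superring = superring R for R :: "('a, 'c) superring_scheme" (structure) +
  assumes acc: "\<And>J :: nat \<Rightarrow> 'a set. \<lbrakk>\<And>n. superideal (J n) R; \<And>n. J n \<subseteq> J (Suc n)\<rbrakk> \<Longrightarrow>
    \<exists>N. \<forall>n\<ge>N. J n = J N"

definition even_ring :: "('a, 'c) superring_scheme \<Rightarrow> ('a, 'c) superring_scheme" where
  "even_ring R = R\<lparr>carrier := rpart R 0\<rparr>"

text \<open>The ideal \<open>I\<^sub>R = R R\<^sub>1\<close>, the set of finite sums of products \<open>a \<otimes> b\<close> with \<open>b\<close> odd.\<close>

definition odd_ideal :: "('a, 'c) superring_scheme \<Rightarrow> 'a set" where
  "odd_ideal R = ideal_prod R (carrier R) (rpart R 1)"


section \<open>Supermodules\<close>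

text \<open>As for \<^locale>\<open>module\<close>, the fields \<open>mult\<close> and \<open>one\<close> of a supermodule carry no meaning.
  The locale \<^locale>\<open>module\<close> itself requires a commutative ring of scalars.\<close>

record ('a, 'b) supermodule = "('a, 'b) module" +
  mpart :: "bit \<Rightarrow> 'b set"

locale supermodule = R?: superring R + M?: abelian_group M
  for R :: "('a, 'c) superring_scheme" and M :: "('a, 'b, 'd) supermodule_scheme" (structure) +
  assumes smult_closed: "\<And>a x. \<lbrakk>a \<in> carrier R; x \<in> carrier M\<rbrakk> \<Longrightarrow> a \<odot> x \<in> carrier M"
    and smult_l_distr: "\<And>a b x. \<lbrakk>a \<in> carrier R; b \<in> carrier R; x \<in> carrier M\<rbrakk> \<Longrightarrow>
      (a \<oplus>\<^bsub>R\<^esub> b) \<odot> x = a \<odot> x \<oplus> b \<odot> x"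
    and smult_r_distr: "\<And>a x y. \<lbrakk>a \<in> carrier R; x \<in> carrier M; y \<in> carrier M\<rbrakk> \<Longrightarrow>
      a \<odot> (x \<oplus> y) = a \<odot> x \<oplus> a \<odot> y"
    and smult_assoc: "\<And>a b x. \<lbrakk>a \<in> carrier R; b \<in> carrier R; x \<in> carrier M\<rbrakk> \<Longrightarrow>
      (a \<otimes>\<^bsub>R\<^esub> b) \<odot> x = a \<odot> (b \<odot> x)"
    and smult_one: "\<And>x. x \<in> carrier M \<Longrightarrow> \<one>\<^bsub>R\<^esub> \<odot> x = x"
    and mpart_subgroup: "\<And>i. subgroup (mpart M i) (add_monoid M)"
    and mpart_sum: "carrier M = mpart M 0 <+>\<^bsub>M\<^esub> mpart M 1"
    and mpart_disjoint: "mpart M 0 \<inter> mpart M 1 = {\<zero>}"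
    and mpart_smult: "\<And>i j a x. \<lbrakk>a \<in> rpart R i; x \<in> mpart M j\<rbrakk> \<Longrightarrow> a \<odot> x \<in> mpart M (i + j)"

definition fin_generated ::
    "('a, 'c) superring_scheme \<Rightarrow> ('a, 'b, 'd) supermodule_scheme \<Rightarrow> bool" where
  "fin_generated R M \<longleftrightarrow> (\<exists>A. finite A \<and> A \<subseteq> carrier M \<and>
     carrier M = {\<Oplus>\<^bsub>M\<^esub>x\<in>A. c x \<odot>\<^bsub>M\<^esub> x | c. c \<in> A \<rightarrow> carrier R})"

definition subsupermodule ::
    "('a, 'b, 'd) supermodule_scheme \<Rightarrow> 'b set \<Rightarrow> ('a, 'b, 'd) supermodule_scheme" where
  "subsupermodule M X = M\<lparr>carrier := X, mpart := \<lambda>i. mpart M i \<inter> X\<rparr>"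


section \<open>Super-dimension\<close>

text \<open>The supremum of an empty set is \<open>-\<infinity>\<close> in \<^typ>\<open>ereal\<close>, so the zero ring has Krull
  dimension \<open>-\<infinity>\<close> and the zero supermodule has dimension \<open>-\<infinity>\<close>.\<close>

definition krull_dim :: "('a, 'c) ring_scheme \<Rightarrow> ereal" where
  "krull_dim A = (SUP n \<in> {n. \<exists>P :: nat \<Rightarrow> 'a set.
      (\<forall>i\<le>n. primeideal (P i) A) \<and> (\<forall>i<n. P i \<subset> P (Suc i))}. ereal (real n))"

definition even_annihilator ::
    "('a, 'c) superring_scheme \<Rightarrow> ('a, 'b, 'd) supermodule_scheme \<Rightarrow> 'a set" where
  "even_annihilator S N = {a \<in> rpart S 0. \<forall>x\<in>carrier N. a \<odot>\<^bsub>N\<^esub> x = \<zero>\<^bsub>N\<^esub>}"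

definition mdim ::
    "('a, 'c) superring_scheme \<Rightarrow> ('a, 'b, 'd) supermodule_scheme \<Rightarrow> ereal" where
  "mdim S N = krull_dim (even_ring S Quot even_annihilator S N)"

definition sdim0 ::
    "('a, 'c) superring_scheme \<Rightarrow> ('a, 'b, 'd) supermodule_scheme \<Rightarrow> ereal" where
  "sdim0 S N = mdim S N"

definition odd_parameters ::
    "('a, 'c) superring_scheme \<Rightarrow> ('a, 'b, 'd) supermodule_scheme \<Rightarrow> 'a list \<Rightarrow> bool" where
  "odd_parameters S N ys \<longleftrightarrow> ys \<noteq> [] \<and> set ys \<subseteq> rpart S 1 \<and>
     mdim S (subsupermodule N ((\<lambda>x. foldr (\<otimes>\<^bsub>S\<^esub>) ys \<one>\<^bsub>S\<^esub> \<odot>\<^bsub>N\<^esub> x) ` carrier N)) = mdim S N"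

text \<open>The supremum of an empty set is \<open>0\<close> in \<^typ>\<open>enat\<close>.\<close>

definition sdim1 ::
    "('a, 'c) superring_scheme \<Rightarrow> ('a, 'b, 'd) supermodule_scheme \<Rightarrow> enat" where
  "sdim1 S N = (SUP ys \<in> {ys. odd_parameters S N ys}. enat (length ys))"

definition sdim ::
    "('a, 'c) superring_scheme \<Rightarrow> ('a, 'b, 'd) supermodule_scheme \<Rightarrow> ereal \<times> enat" where
  "sdim S N = (sdim0 S N, sdim1 S N)"


section \<open>Associated graded super-rings and supermodules\<close>

primrec ideal_pow :: "('a, 'c) ring_scheme \<Rightarrow> 'a set \<Rightarrow> nat \<Rightarrow> 'a set" where
  "ideal_pow R J 0 = carrier R"
| "ideal_pow R J (Suc n) = ideal_prod R J (ideal_pow R J n)"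

text \<open>\<open>JM\<close>, for an ideal \<open>J\<close> of the ring of scalars.\<close>

inductive_set ideal_smult :: "('a, 'b, 'd) module_scheme \<Rightarrow> 'a set \<Rightarrow> 'b set"
  for M and J where
    smult: "\<lbrakk>a \<in> J; x \<in> carrier M\<rbrakk> \<Longrightarrow> a \<odot>\<^bsub>M\<^esub> x \<in> ideal_smult M J"
  | sum: "\<lbrakk>x \<in> ideal_smult M J; y \<in> ideal_smult M J\<rbrakk> \<Longrightarrow> x \<oplus>\<^bsub>M\<^esub> y \<in> ideal_smult M J"

text \<open>For a descending filtration \<open>F\<close> of an abelian group \<open>G\<close>, an element of
  \<open>\<Oplus>n. F n / F (n + 1)\<close> is a function taking each \<open>n\<close> to a coset of \<open>F (n + 1)\<close> in \<open>F n\<close>,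
  with only finitely many nonzero values. \<open>gr_part G F X\<close> is the set of those elements all of
  whose components have a representative in \<open>X\<close>.\<close>

definition gr_part :: "('a, 'c) ring_scheme \<Rightarrow> (nat \<Rightarrow> 'a set) \<Rightarrow> 'a set \<Rightarrow> (nat \<Rightarrow> 'a set) set" where
  "gr_part G F X = {f. (\<forall>n. f n \<in> (\<lambda>x. F (Suc n) +>\<^bsub>G\<^esub> x) ` (F n \<inter> X)) \<and>
     finite {n. f n \<noteq> F (Suc n)}}"

text \<open>The product induced by a map \<open>p\<close> with \<open>p (I\<^sup>i) (F j) \<subseteq> F (i + j)\<close>. For \<open>a\<close> in
  \<open>I\<^sup>i / I\<^sup>i\<^sup>+\<^sup>1\<close> and \<open>x\<close> in \<open>F j / F (j + 1)\<close> with \<open>i + j = n\<close>, the union below is a single coset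
  of \<open>F (n + 1)\<close>; the sum over \<open>i + j = n\<close> is taken in the additive group \<open>G / F (n + 1)\<close>, whose
  operation \<^const>\<open>A_FactGroup\<close> writes multiplicatively.\<close>

definition gr_mult :: "('b, 'c) ring_scheme \<Rightarrow> (nat \<Rightarrow> 'b set) \<Rightarrow> ('a \<Rightarrow> 'b \<Rightarrow> 'b) \<Rightarrow>
    (nat \<Rightarrow> 'a set) \<Rightarrow> (nat \<Rightarrow> 'b set) \<Rightarrow> nat \<Rightarrow> 'b set" where
  "gr_mult G F p f g = (\<lambda>n. \<Otimes>\<^bsub>G A_Mod F (Suc n)\<^esub>i\<in>{..n}.
     \<Union>a\<in>f i. \<Union>x\<in>g (n - i). F (Suc n) +>\<^bsub>G\<^esub> p a x)"

definition gr_ring :: "('a, 'c) superring_scheme \<Rightarrow> 'a set \<Rightarrow> (nat \<Rightarrow> 'a set) superring" where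
  "gr_ring R I = (let F = ideal_pow R I in
     \<lparr>carrier = gr_part R F (carrier R),
      mult = gr_mult R F (\<otimes>\<^bsub>R\<^esub>),
      one = (\<lambda>n. if n = 0 then F 1 +>\<^bsub>R\<^esub> \<one>\<^bsub>R\<^esub> else F (Suc n)),
      zero = (\<lambda>n. F (Suc n)),
      add = (\<lambda>f g n. f n <+>\<^bsub>R\<^esub> g n),
      rpart = (\<lambda>i. gr_part R F (rpart R i))\<rparr>)"

definition gr_module :: "('a, 'c) superring_scheme \<Rightarrow> 'a set \<Rightarrow> ('a, 'b, 'd) supermodule_scheme \<Rightarrow>
    (nat \<Rightarrow> 'a set, nat \<Rightarrow> 'b set) supermodule" where
  "gr_module R I M = (let F = (\<lambda>n. ideal_smult M (ideal_pow R I n)) in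
     \<lparr>carrier = gr_part M F (carrier M),
      mult = undefined,
      one = undefined,
      zero = (\<lambda>n. F (Suc n)),
      add = (\<lambda>f g n. f n <+>\<^bsub>M\<^esub> g n),
      smult = gr_mult M F (\<odot>\<^bsub>M\<^esub>),
      mpart = (\<lambda>i. gr_part M F (mpart M i))\<rparr>)"

end

theory Submission
  imports Defs "HOL-Algebra.Ring_Divisibility" "HOL-Algebra.Subrings"
begin

text \<open>
  Write \<open>A = R\<^sub>0\<close> and \<open>B\<close> for the even part of \<open>gr R\<close>. Since \<open>I\<close> is nilpotent, the even elements of
  positive degree form a nil ideal of \<open>B\<close>, so contraction along \<open>A \<rightarrow> B\<close>, which sends \<open>a\<close> to its
  class in degree \<open>0\<close>, is an inclusion-preserving bijection from the primes of \<open>B\<close> above an ideal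
  \<open>K\<close> to the primes of \<open>A\<close> above the preimage of \<open>K\<close>. All dimensions can thus be computed in \<open>A\<close>.
  An element \<open>a\<close> of the preimage of the annihilator of \<open>gr M\<close> satisfies
  \<open>a I\<^sup>n M \<subseteq> I\<^bsup>n+1\<^esup> M\<close> for all \<open>n\<close>, so a power of \<open>a\<close> kills \<open>M\<close>, which gives the equality of the
  even dimensions.

  For the odd dimensions let \<open>p\<close> be a prime of \<open>A\<close> starting a chain of length \<open>dim M\<close>. If every
  product of \<open>k\<close> odd elements is killed on \<open>M\<close> by an element outside \<open>p\<close>, then by the chain
  condition one \<open>a \<notin> p\<close> kills all of \<open>I\<^sup>k M\<close>. If \<open>M\<close> has a system of odd parameters of maximal
  length \<open>l\<close>, with product \<open>y\<close>, this applies to \<open>k = l + 1\<close>: \<open>b y M \<subseteq> I\<^bsup>l+1\<^esup> M\<close> implies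
  \<open>a b y M = 0\<close>, so the classes of the parameters in degree \<open>1\<close> are parameters of \<open>gr M\<close>.
  Conversely, a product of \<open>l\<close> odd elements of \<open>gr R\<close> lies in degrees \<open>\<ge> l\<close>; if \<open>M\<close> had no
  parameters of length \<open>l\<close>, some \<open>a \<notin> p\<close> would kill \<open>I\<^sup>l M\<close> and hence the image of that product.
\<close>

section \<open>Chains of primes above an ideal\<close>

definition prime_chain :: "('a, 'c) ring_scheme \<Rightarrow> nat \<Rightarrow> (nat \<Rightarrow> 'a set) \<Rightarrow> bool" where
  "prime_chain A n P \<longleftrightarrow> (\<forall>i\<le>n. primeideal (P i) A) \<and> (\<forall>i<n. P i \<subset> P (Suc i))"

text \<open>By \<open>krull_dim_quot\<close> this is the Krull dimension of \<open>A/J\<close> when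
  \<open>A\<close> is commutative and \<open>J\<close> an ideal. Counting primes of \<open>A\<close>
  itself lets dimensions attached to different ideals, and to rings related by a homomorphism, be
  compared in one ring.\<close>

definition dim_above :: "('a, 'c) ring_scheme \<Rightarrow> 'a set \<Rightarrow> ereal" where
  "dim_above A J = (SUP n \<in> {n. \<exists>P. prime_chain A n P \<and> J \<subseteq> P 0}. ereal (real n))"

lemma prime_chain_primeideal: "prime_chain A n P \<Longrightarrow> i \<le> n \<Longrightarrow> primeideal (P i) A"
  by (simp add: prime_chain_def)

lemma prime_chain_mono:
  assumes "prime_chain A n P" "i \<le> n"
  shows "P 0 \<subseteq> P i"
  using assms(2)
proof (induction i)
  case (Suc i)
  then have "P i \<subset> P (Suc i)"
    using assms(1) by (simp add: prime_chain_def)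
  with Suc show ?case by auto
qed simp

lemma dim_above_antimono: "J \<subseteq> J' \<Longrightarrow> dim_above A J' \<le> dim_above A J"
  unfolding dim_above_def by (rule SUP_subset_mono) auto

lemma dim_above_le_krull_dim: "dim_above A J \<le> krull_dim A"
  unfolding dim_above_def krull_dim_def prime_chain_def by (rule SUP_subset_mono) auto

lemma dim_above_ge: "prime_chain A n P \<Longrightarrow> J \<subseteq> P 0 \<Longrightarrow> ereal (real n) \<le> dim_above A J"
  unfolding dim_above_def by (rule SUP_upper) auto

text \<open>A nonempty bounded set of naturals has a maximum. The chain obtained here is the source
  of the prime \<open>P 0\<close> outside which annihilating elements are sought later.\<close>

lemma dim_above_attained:
  assumes "dim_above A J \<noteq> -\<infinity>" "dim_above A J < \<infinity>"
  obtains n P where "dim_above A J = ereal (real n)" "prime_chain A n P" "J \<subseteq> P 0"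
proof -
  define S where "S = {n. \<exists>P. prime_chain A n P \<and> J \<subseteq> P 0}"
  have d: "dim_above A J = (SUP n\<in>S. ereal (real n))"
    by (simp add: dim_above_def S_def)
  \<comment> \<open>The supremum of the empty set is \<open>-\<infinity>\<close>.\<close>
  have "S \<noteq> {}"
    using assms(1) by (auto simp: d bot_ereal_def)
  obtain r where r: "dim_above A J < ereal r"
    using ereal_dense2[OF assms(2)] by blast
  have "n \<le> nat \<lceil>r\<rceil>" if "n \<in> S" for n
  proof -
    have "ereal (real n) \<le> dim_above A J"
      unfolding d using that by (rule SUP_upper)
    then have "ereal (real n) < ereal r"
      using r by (rule le_less_trans)
    then show ?thesis by simp linarith
  qed
  then have "finite S"
    by (meson finite_nat_set_iff_bounded_le)
  have "Max S \<in> S"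
    using \<open>finite S\<close> \<open>S \<noteq> {}\<close> by (rule Max_in)
  moreover have "dim_above A J = ereal (real (Max S))"
    unfolding d
  proof (rule antisym)
    show "(SUP n\<in>S. ereal (real n)) \<le> ereal (real (Max S))"
      using \<open>finite S\<close> by (intro SUP_least) auto
    show "ereal (real (Max S)) \<le> (SUP n\<in>S. ereal (real n))"
      using \<open>Max S \<in> S\<close> by (rule SUP_upper)
  qed
  ultimately show ?thesis
    using that unfolding S_def by blast
qed

text \<open>No prime contains the whole ring. This serves for a vanishing product of odd elements,
  whose image is annihilated by all of \<open>R_0\<close>.\<close>

lemma dim_above_carrier: "dim_above A (carrier A) = -\<infinity>"
proof -
  have "\<not> (\<exists>P. prime_chain A n P \<and> carrier A \<subseteq> P 0)" for n
    using primeideal.I_notcarr ideal.axioms(1) additive_subgroup.a_subset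
    by (metis prime_chain_primeideal le0 primeideal.axioms(1) subset_antisym)
  then have "{n. \<exists>P. prime_chain A n P \<and> carrier A \<subseteq> P 0} = {}"
    by blast
  then show ?thesis
    by (simp only: dim_above_def) (simp add: bot_ereal_def)
qed

lemma (in primeideal) pow_mem:
  assumes "a \<in> carrier R" "a [^] (k :: nat) \<in> I"
  shows "a \<in> I"
  using assms(2)
proof (induction k)
  case 0
  then have "\<one> \<in> I" by simp
  then show ?case
    using I_notcarr one_imp_carrier by metis
next
  case (Suc k)
  then show ?case
    using I_prime[of "a [^] k" a] assms(1) by (auto simp: nat_pow_closed)
qed

text \<open>A prime that contains a power of \<open>a\<close> contains \<open>a\<close>, so both
  sets lie in the same primes.\<close>

lemma dim_above_radical:
  assumes "J \<subseteq> J'" "J' \<subseteq> carrier A"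
    and pow: "\<And>a. a \<in> J' \<Longrightarrow> \<exists>k::nat. a [^]\<^bsub>A\<^esub> k \<in> J"
  shows "dim_above A J = dim_above A J'"
proof -
  have "J \<subseteq> P 0 \<longleftrightarrow> J' \<subseteq> P 0" if "prime_chain A n P" for n P
  proof
    assume "J \<subseteq> P 0"
    show "J' \<subseteq> P 0"
    proof
      fix a assume "a \<in> J'"
      then show "a \<in> P 0"
        using pow[of a] \<open>J \<subseteq> P 0\<close> assms(2) primeideal.pow_mem[OF prime_chain_primeideal[OF that, of 0]]
        by blast
    qed
  qed (use assms in auto)
  then have "{n. \<exists>P. prime_chain A n P \<and> J \<subseteq> P 0} = {n. \<exists>P. prime_chain A n P \<and> J' \<subseteq> P 0}"
    by blast
  then show ?thesis
    by (simp only: dim_above_def)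
qed

section \<open>Primes along ring homomorphisms\<close>

context ring_hom_cring
begin

text \<open>Since the kernel lies in \<open>P\<close>, the prime \<open>P\<close> is a union of
  fibres of \<open>h\<close>; this saturation transfers properness and primality to the
  image.\<close>

lemma image_primeideal:
  assumes surj: "h ` carrier R = carrier S" and P: "primeideal P R"
    and ker: "a_kernel R S h \<subseteq> P"
  shows "primeideal (h ` P) S" and "{a \<in> carrier R. h a \<in> h ` P} = P"
proof -
  interpret P: primeideal P R by fact
  have mem: "a \<in> P" if a: "a \<in> carrier R" "h a \<in> h ` P" for a
  proof -
    obtain b where b: "b \<in> P" "h a = h b" using a by blast
    then have "h (a \<ominus> b) = \<zero>\<^bsub>S\<^esub>"
      using a by (simp add: R.minus_eq S.r_neg)
    then have "a \<ominus> b \<in> P"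
      using a(1) b(1) P.a_Hcarr ker unfolding a_kernel_def' by blast
    then have "(a \<ominus> b) \<oplus> b \<in> P"
      using b by simp
    moreover have "(a \<ominus> b) \<oplus> b = a"
      using a b P.a_subset by (simp add: R.minus_eq R.a_assoc R.l_neg subsetD)
    ultimately show ?thesis by simp
  qed
  then show "{a \<in> carrier R. h a \<in> h ` P} = P"
    using P.a_subset by auto
  show "primeideal (h ` P) S"
  proof (rule primeidealI)
    show "ideal (h ` P) S"
    proof (rule idealI)
      show "subgroup (h ` P) (add_monoid S)"
        by (rule ring.img_is_add_subgroup) (rule P.a_subgroup)
    next
      fix a x assume "a \<in> h ` P" "x \<in> carrier S"
      then obtain b y where *: "b \<in> P" "y \<in> carrier R" "a = h b" "x = h y"
        using surj by blast
      have "b \<in> carrier R" using * by simp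
      have "h (y \<otimes> b) \<in> h ` P" "h (b \<otimes> y) \<in> h ` P"
        using * P.I_l_closed P.I_r_closed by blast+
      then show "x \<otimes>\<^bsub>S\<^esub> a \<in> h ` P" "a \<otimes>\<^bsub>S\<^esub> x \<in> h ` P"
        using * \<open>b \<in> carrier R\<close> by simp_all
    qed (rule S.ring_axioms)
    show "cring S" by (rule S.is_cring)
    show "carrier S \<noteq> h ` P"
    proof
      assume "carrier S = h ` P"
      then have "\<one> \<in> P" by (intro mem) auto
      then show False
        using P.I_notcarr P.one_imp_carrier by metis
    qed
  next
    fix a b assume "a \<in> carrier S" "b \<in> carrier S" and ab: "a \<otimes>\<^bsub>S\<^esub> b \<in> h ` P"
    then obtain x y where *: "x \<in> carrier R" "y \<in> carrier R" "a = h x" "b = h y"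
      using surj by (metis imageE)
    with ab have "x \<otimes> y \<in> P" by (intro mem) auto
    then show "a \<in> h ` P \<or> b \<in> h ` P"
      using P.I_prime * by blast
  qed
qed

text \<open>Strict chains go to strict chains in both directions: surjectivity recovers a prime of
  \<open>S\<close> from its preimage, and containment of the kernel recovers a prime of
  \<open>R\<close> from its image.\<close>

lemma krull_dim_surj:
  assumes surj: "h ` carrier R = carrier S"
  shows "krull_dim S = dim_above R (a_kernel R S h)"
proof -
  let ?v = "\<lambda>Q. {a \<in> carrier R. h a \<in> Q}"
  have "(\<exists>Q. prime_chain S n Q) \<longleftrightarrow> (\<exists>P. prime_chain R n P \<and> a_kernel R S h \<subseteq> P 0)" for n
  proof
    assume "\<exists>Q. prime_chain S n Q"
    then obtain Q where Q: "prime_chain S n Q" ..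
    have img: "h ` ?v (Q i) = Q i" if "i \<le> n" for i
    proof -
      have "Q i \<subseteq> carrier S"
        using prime_chain_primeideal[OF Q that]
        by (meson additive_subgroup.a_subset ideal.axioms(1) primeideal.axioms(1))
      then show ?thesis
        using surj by (auto 4 3 simp: image_iff)
    qed
    have "prime_chain R n (\<lambda>i. ?v (Q i))"
      unfolding prime_chain_def
    proof (intro conjI allI impI)
      fix i assume "i \<le> n"
      then show "primeideal (?v (Q i)) R"
        using ring.primeideal_vimage R.is_cring prime_chain_primeideal[OF Q] by blast
    next
      fix i assume "i < n"
      then have "Q i \<subset> Q (Suc i)"
        using Q by (simp add: prime_chain_def)
      moreover have "?v (Q i) \<noteq> ?v (Q (Suc i))"
        using img[of i] img[of "Suc i"] \<open>i < n\<close> \<open>Q i \<subset> Q (Suc i)\<close>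
        by (metis Suc_leI less_imp_le order_less_irrefl)
      ultimately show "?v (Q i) \<subset> ?v (Q (Suc i))" by blast
    qed
    moreover have "a_kernel R S h \<subseteq> ?v (Q 0)"
    proof -
      have "\<zero>\<^bsub>S\<^esub> \<in> Q 0"
        using prime_chain_primeideal[OF Q, of 0]
        by (meson additive_subgroup.zero_closed ideal.axioms(1) primeideal.axioms(1) le0)
      then show ?thesis unfolding a_kernel_def' by auto
    qed
    ultimately show "\<exists>P. prime_chain R n P \<and> a_kernel R S h \<subseteq> P 0" by blast
  next
    assume "\<exists>P. prime_chain R n P \<and> a_kernel R S h \<subseteq> P 0"
    then obtain P where P: "prime_chain R n P" "a_kernel R S h \<subseteq> P 0" by blast
    have sub: "a_kernel R S h \<subseteq> P i" if "i \<le> n" for i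
      using P prime_chain_mono[OF P(1) that] by blast
    have "prime_chain S n (\<lambda>i. h ` P i)"
      unfolding prime_chain_def
    proof (intro conjI allI impI)
      fix i assume "i \<le> n"
      then show "primeideal (h ` P i) S"
        using image_primeideal(1)[OF surj] prime_chain_primeideal[OF P(1)] sub by blast
    next
      fix i assume i: "i < n"
      then have *: "P i \<subset> P (Suc i)"
        using P by (simp add: prime_chain_def)
      have "?v (h ` P i) = P i" "?v (h ` P (Suc i)) = P (Suc i)"
        using i image_primeideal(2)[OF surj] prime_chain_primeideal[OF P(1)] sub by simp_all
      then have "h ` P i \<noteq> h ` P (Suc i)"
        using * by (metis psubsetE)
      then show "h ` P i \<subset> h ` P (Suc i)"
        using image_mono[OF psubset_imp_subset[OF *]] by (rule psubsetI[rotated])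
    qed
    then show "\<exists>Q. prime_chain S n Q" by blast
  qed
  then show ?thesis
    by (simp add: krull_dim_def dim_above_def flip: prime_chain_def)
qed

end

lemma zero_FactRing: "\<zero>\<^bsub>R Quot J\<^esub> = J"
  by (simp add: FactRing_def)

lemma carrier_FactRing: "carrier (R Quot J) = (+>\<^bsub>R\<^esub>) J ` carrier R"
  by (auto simp: FactRing_simps)

lemma (in cring) krull_dim_quot:
  assumes "ideal J R"
  shows "krull_dim (R Quot J) = dim_above R J"
proof -
  interpret J: ideal J R by fact
  interpret h: ring_hom_cring R "R Quot J" "(+>) J"
    by (rule J.rcos_ring_hom_cring) (rule is_cring)
  have "a_kernel R (R Quot J) ((+>) J) = J"
  proof (intro equalityI subsetI)
    fix a assume "a \<in> a_kernel R (R Quot J) ((+>) J)"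
    then have "a \<in> carrier R" "J +> a = J"
      unfolding a_kernel_def' zero_FactRing by blast+
    then show "a \<in> J"
      using a_coset_join1 J.a_subgroup by blast
  next
    fix a assume "a \<in> J"
    then show "a \<in> a_kernel R (R Quot J) ((+>) J)"
      unfolding a_kernel_def' zero_FactRing using J.a_rcos_const J.a_Hcarr by blast
  qed
  then show ?thesis
    using h.krull_dim_surj carrier_FactRing by metis
qed

text \<open>\<open>R\<close> surjects onto \<open>S / (K + N)\<close>, and neither enlarging \<open>K\<close> by the nil ideal \<open>N\<close> nor
  shrinking the preimage of \<open>K + N\<close> to that of \<open>K\<close> changes the primes above.\<close>

lemma (in ring_hom_cring) krull_dim_quot_nil:
  assumes N: "ideal N S" and nil: "\<And>b. b \<in> N \<Longrightarrow> \<exists>k::nat. b [^]\<^bsub>S\<^esub> k = \<zero>\<^bsub>S\<^esub>"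
    and onto: "\<And>b. b \<in> carrier S \<Longrightarrow> \<exists>a\<in>carrier R. \<exists>c\<in>N. b = c \<oplus>\<^bsub>S\<^esub> h a"
    and K: "ideal K S"
  shows "krull_dim (S Quot K) = dim_above R {a \<in> carrier R. h a \<in> K}"
proof -
  interpret N: ideal N S by fact
  interpret K: ideal K S by fact
  let ?L = "K <+>\<^bsub>S\<^esub> N"
  interpret L: ideal ?L S
    using S.add_ideals[OF K N] .
  have sub: "K \<subseteq> ?L" "N \<subseteq> ?L"
  proof -
    show "K \<subseteq> ?L"
    proof
      fix x assume "x \<in> K"
      then have "x = x \<oplus>\<^bsub>S\<^esub> \<zero>\<^bsub>S\<^esub>" by simp
      then show "x \<in> ?L"
        unfolding set_add_def' using \<open>x \<in> K\<close> N.zero_closed by blast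
    qed
    show "N \<subseteq> ?L"
    proof
      fix x assume "x \<in> N"
      then have "x = \<zero>\<^bsub>S\<^esub> \<oplus>\<^bsub>S\<^esub> x" by simp
      then show "x \<in> ?L"
        unfolding set_add_def' using \<open>x \<in> N\<close> K.zero_closed by blast
    qed
  qed
  \<comment> \<open>With \<open>x\<close> in \<open>K\<close>, the powers of \<open>x + y\<close>
    agree with those of \<open>y\<close> modulo \<open>K\<close>, and some power of \<open>y\<close>
    is zero.\<close>
  have pow: "\<exists>k::nat. b [^]\<^bsub>S\<^esub> k \<in> K" if "b \<in> ?L" for b
  proof -
    have "\<exists>x\<in>K. \<exists>y\<in>N. b = x \<oplus>\<^bsub>S\<^esub> y"
      using that unfolding set_add_def' by simp
    then obtain x y where xy: "x \<in> K" "y \<in> N" "b = x \<oplus>\<^bsub>S\<^esub> y" by auto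
    have c: "x \<in> carrier S" "y \<in> carrier S" "b \<in> carrier S"
      using xy by auto
    obtain k :: nat where k: "y [^]\<^bsub>S\<^esub> k = \<zero>\<^bsub>S\<^esub>"
      using nil xy by blast
    have "\<exists>z\<in>K. b [^]\<^bsub>S\<^esub> n = z \<oplus>\<^bsub>S\<^esub> y [^]\<^bsub>S\<^esub> n" for n :: nat
    proof (induction n)
      case 0
      show ?case using K.zero_closed by (intro bexI[of _ "\<zero>\<^bsub>S\<^esub>"]) auto
    next
      case (Suc n)
      then obtain z where z: "z \<in> K" "b [^]\<^bsub>S\<^esub> n = z \<oplus>\<^bsub>S\<^esub> y [^]\<^bsub>S\<^esub> n" by blast
      have "b [^]\<^bsub>S\<^esub> Suc n = (z \<otimes>\<^bsub>S\<^esub> b \<oplus>\<^bsub>S\<^esub> y [^]\<^bsub>S\<^esub> n \<otimes>\<^bsub>S\<^esub> x) \<oplus>\<^bsub>S\<^esub> y [^]\<^bsub>S\<^esub> Suc n"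
        using c z K.a_Hcarr[OF z(1)]
        by (simp add: S.l_distr S.r_distr xy(3) S.a_assoc S.a_lcomm)
      moreover have "z \<otimes>\<^bsub>S\<^esub> b \<oplus>\<^bsub>S\<^esub> y [^]\<^bsub>S\<^esub> n \<otimes>\<^bsub>S\<^esub> x \<in> K"
        using c z xy by (intro K.a_closed K.I_l_closed K.I_r_closed) auto
      ultimately show ?case by blast
    qed
    from this[of k] k show ?thesis
      by (metis K.a_Hcarr S.r_zero)
  qed
  interpret q: ring_hom_cring S "S Quot ?L" "(+>\<^bsub>S\<^esub>) ?L"
    by (rule L.rcos_ring_hom_cring) (rule S.is_cring)
  let ?g = "\<lambda>a. ?L +>\<^bsub>S\<^esub> h a"
  have "(+>\<^bsub>S\<^esub>) ?L \<circ> h \<in> ring_hom R (S Quot ?L)"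
    using ring_hom_trans[OF homh q.homh] .
  then interpret g: ring_hom_cring R "S Quot ?L" ?g
    by unfold_locales (simp add: o_def)
  \<comment> \<open>By \<open>onto\<close>, \<open>b\<close> and \<open>h a\<close> differ by an
    element of \<open>N\<close>, so they have the same coset modulo \<open>?L\<close>.\<close>
  have surj: "?g ` carrier R = carrier (S Quot ?L)"
  proof (intro equalityI subsetI)
    fix X assume "X \<in> carrier (S Quot ?L)"
    then obtain b where b: "b \<in> carrier S" "X = ?L +>\<^bsub>S\<^esub> b"
      unfolding carrier_FactRing by blast
    obtain a c where ac: "a \<in> carrier R" "c \<in> N" "b = c \<oplus>\<^bsub>S\<^esub> h a"
      using onto[OF b(1)] by blast
    have "b \<in> ?L +>\<^bsub>S\<^esub> h a"
      using ac sub by (auto simp: a_r_coset_def')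
    then have "X = ?g a"
      using b ac L.a_repr_independence' by simp
    then show "X \<in> ?g ` carrier R" using ac by blast
  qed auto
  have ker: "a_kernel R (S Quot ?L) ?g = {a \<in> carrier R. h a \<in> ?L}"
  proof (intro equalityI subsetI)
    fix a assume "a \<in> a_kernel R (S Quot ?L) ?g"
    then have "a \<in> carrier R" "?L +>\<^bsub>S\<^esub> h a = ?L"
      unfolding a_kernel_def' zero_FactRing by blast+
    then show "a \<in> {a \<in> carrier R. h a \<in> ?L}"
      using S.a_coset_join1[OF _ _ L.a_subgroup] hom_closed by blast
  next
    fix a assume "a \<in> {a \<in> carrier R. h a \<in> ?L}"
    then show "a \<in> a_kernel R (S Quot ?L) ?g"
      unfolding a_kernel_def' zero_FactRing using L.a_rcos_const by blast
  qed
  have "krull_dim (S Quot K) = dim_above S K"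
    using K by (rule S.krull_dim_quot)
  also have "\<dots> = dim_above S ?L"
    using sub pow L.a_subset by (intro dim_above_radical) auto
  also have "\<dots> = krull_dim (S Quot ?L)"
    using S.krull_dim_quot[OF L.is_ideal] by simp
  also have "\<dots> = dim_above R {a \<in> carrier R. h a \<in> ?L}"
    using g.krull_dim_surj[OF surj] ker by simp
  also have "\<dots> = dim_above R {a \<in> carrier R. h a \<in> K}"
  proof (rule dim_above_radical[symmetric])
    fix a assume a: "a \<in> {a \<in> carrier R. h a \<in> ?L}"
    then obtain k :: nat where "h a [^]\<^bsub>S\<^esub> k \<in> K"
      using pow by blast
    then show "\<exists>k::nat. a [^] k \<in> {a \<in> carrier R. h a \<in> K}"
      using a by (intro exI[of _ k]) (simp add: ring.hom_nat_pow)
  qed (use sub in auto)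
  finally show ?thesis .
qed

text \<open>Zorn's lemma on the ideals above \<open>J\<close> that avoid 1: a maximal one is a
  maximal ideal, hence prime.\<close>

lemma (in cring) primeideal_above:
  assumes J: "ideal J R" and proper: "\<one> \<notin> J"
  obtains P where "primeideal P R" "J \<subseteq> P"
proof -
  let ?S = "{I. ideal I R \<and> J \<subseteq> I \<and> \<one> \<notin> I}"
  have "\<exists>M\<in>?S. \<forall>X\<in>?S. M \<subseteq> X \<longrightarrow> X = M"
  proof (rule subset_Zorn_nonempty)
    show "?S \<noteq> {}" using assms by blast
  next
    fix C assume C: "C \<noteq> {}" "subset.chain ?S C"
    then have "subset.chain {I. ideal I R} C"
      by (auto simp: pred_on.chain_def)
    from chain_Union_is_ideal[OF this] C(1) have "ideal (\<Union>C) R" by simp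
    moreover have "C \<subseteq> ?S"
      using C(2) by (simp add: pred_on.chain_def)
    ultimately show "\<Union>C \<in> ?S"
      using C(1) by blast
  qed
  then obtain P where P: "P \<in> ?S" and max: "\<forall>X\<in>?S. P \<subseteq> X \<longrightarrow> X = P" ..
  have "maximalideal P R"
  proof (rule maximalidealI)
    show "ideal P R" "carrier R \<noteq> P" using P by auto
    fix X assume X: "ideal X R" "P \<subseteq> X" "X \<subseteq> carrier R"
    show "X = P \<or> X = carrier R"
    proof (cases "\<one> \<in> X")
      case False
      then have "X \<in> ?S" using X P by blast
      then show ?thesis using max X by blast
    qed (use ideal.one_imp_carrier[OF X(1)] in simp)
  qed
  then show ?thesis
    using maximalideal_prime P that by blast
qed

text \<open>By commutativity of the scalars the annihilator of an arbitrary subset is an ideal, so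
  images such as \<open>y M\<close> can be treated as plain sets.\<close>

lemma (in Module.module) annihilator_is_ideal:
  assumes "X \<subseteq> carrier M"
  shows "ideal {a \<in> carrier R. \<forall>x\<in>X. a \<odot>\<^bsub>M\<^esub> x = \<zero>\<^bsub>M\<^esub>} R"
proof (rule idealI)
  show "subgroup {a \<in> carrier R. \<forall>x\<in>X. a \<odot>\<^bsub>M\<^esub> x = \<zero>\<^bsub>M\<^esub>} (add_monoid R)"
  proof (rule group.subgroupI[OF R.a_group])
    have "\<zero> \<in> {a \<in> carrier R. \<forall>x\<in>X. a \<odot>\<^bsub>M\<^esub> x = \<zero>\<^bsub>M\<^esub>}"
      using assms by auto
    then show "{a \<in> carrier R. \<forall>x\<in>X. a \<odot>\<^bsub>M\<^esub> x = \<zero>\<^bsub>M\<^esub>} \<noteq> {}" by blast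
  qed (use assms in \<open>auto simp: smult_l_distr smult_l_minus subset_iff simp flip: a_inv_def\<close>)
next
  fix a x assume *: "a \<in> {a \<in> carrier R. \<forall>x\<in>X. a \<odot>\<^bsub>M\<^esub> x = \<zero>\<^bsub>M\<^esub>}" "x \<in> carrier R"
  then show l: "x \<otimes> a \<in> {a \<in> carrier R. \<forall>x\<in>X. a \<odot>\<^bsub>M\<^esub> x = \<zero>\<^bsub>M\<^esub>}"
    using assms by (auto simp: smult_assoc1 subset_iff)
  show "a \<otimes> x \<in> {a \<in> carrier R. \<forall>x\<in>X. a \<odot>\<^bsub>M\<^esub> x = \<zero>\<^bsub>M\<^esub>}"
    using l * by (simp add: R.m_comm)
qed (rule R.ring_axioms)

section \<open>Graded actions of filtered rings\<close>

text \<open>Elements of the graded object are handled through sequences of representatives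
  \<open>r n\<close> in \<open>F n\<close>. Finite support is not built in: it follows from
  \<open>F_nil\<close>, since the filtration vanishes in high degrees.\<close>

definition gr_class :: "('a, 'c) ring_scheme \<Rightarrow> (nat \<Rightarrow> 'a set) \<Rightarrow> (nat \<Rightarrow> 'a) \<Rightarrow> nat \<Rightarrow> 'a set" where
  "gr_class G F r = (\<lambda>n. F (Suc n) +>\<^bsub>G\<^esub> r n)"

text \<open>Representatives of a homogeneous element of degree \<open>k\<close>.\<close>

definition delta :: "('a, 'c) ring_scheme \<Rightarrow> nat \<Rightarrow> 'a \<Rightarrow> nat \<Rightarrow> 'a" where
  "delta G k a = (\<lambda>n. if n = k then a else \<zero>\<^bsub>G\<^esub>)"

text \<open>The Cauchy product of representatives, a lift of \<open>gr_mult\<close>.\<close>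

definition conv :: "('b, 'c) ring_scheme \<Rightarrow> ('a \<Rightarrow> 'b \<Rightarrow> 'b) \<Rightarrow> (nat \<Rightarrow> 'a) \<Rightarrow> (nat \<Rightarrow> 'b) \<Rightarrow> nat \<Rightarrow> 'b" where
  "conv G p r s = (\<lambda>n. \<Oplus>\<^bsub>G\<^esub>i\<in>{..n}. p (r i) (s (n - i)))"

lemma (in abelian_group) finsum_mem_additive_subgroup:
  assumes "additive_subgroup H G" "\<And>i. i \<in> A \<Longrightarrow> f i \<in> H"
  shows "finsum G f A \<in> H"
proof -
  interpret H: additive_subgroup H G by fact
  show ?thesis
    using assms(2)
  proof (induct A rule: infinite_finite_induct)
    case (insert x A)
    then have "finsum G f (insert x A) = f x \<oplus> finsum G f A"
      by (intro finsum_insert) auto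
    then show ?case
      using insert by simp
  qed (simp_all add: finsum_infinite)
qed

text \<open>Both sides run over all triples of naturals with sum \<open>n\<close>. The induction
  splits off the triples with first entry 0 and applies the hypothesis to \<open>f\<close> shifted
  in its first argument. This is the reordering behind associativity of the Cauchy product.\<close>

lemma (in abelian_monoid) finsum_triangle:
  fixes n :: nat
  assumes "\<And>i j k. f i j k \<in> carrier G"
  shows "(\<Oplus>i\<in>{..n}. \<Oplus>j\<in>{..i}. f j (i - j) (n - i)) =
    (\<Oplus>i\<in>{..n}. \<Oplus>j\<in>{..n - i}. f i j (n - i - j))"
  using assms
proof (induction n arbitrary: f)
  case 0
  then show ?case by simp
next
  case (Suc n)
  have f: "f i j k \<in> carrier G" for i j k
    by (rule Suc.prems)
  have split: "(\<Oplus>i\<in>{..Suc m}. g i) = (\<Oplus>i\<in>{..m}. g (Suc i)) \<oplus> g 0"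
    if "\<And>i. g i \<in> carrier G" for g :: "nat \<Rightarrow> 'a" and m
    using that by (intro finsum_Suc2) auto
  have c: "(\<Oplus>j\<in>A. f (u j) (v j) (w j)) \<in> carrier G" for u v w and A :: "nat set"
    using f by (intro finsum_closed) auto
  have "(\<Oplus>i\<in>{..Suc n}. \<Oplus>j\<in>{..i}. f j (i - j) (Suc n - i)) =
     (\<Oplus>i\<in>{..n}. \<Oplus>j\<in>{..Suc i}. f j (Suc i - j) (n - i)) \<oplus> f 0 0 (Suc n)"
    by (subst split) (use c f in auto)
  also have "(\<Oplus>i\<in>{..n}. \<Oplus>j\<in>{..Suc i}. f j (Suc i - j) (n - i)) =
     (\<Oplus>i\<in>{..n}. (\<Oplus>j\<in>{..i}. f (Suc j) (i - j) (n - i)) \<oplus> f 0 (Suc i) (n - i))"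
    by (subst split) (use f in simp_all)
  also have "\<dots> = (\<Oplus>i\<in>{..n}. \<Oplus>j\<in>{..i}. f (Suc j) (i - j) (n - i)) \<oplus>
      (\<Oplus>i\<in>{..n}. f 0 (Suc i) (n - i))"
    by (rule finsum_addf) (use c f in auto)
  also have "(\<Oplus>i\<in>{..n}. \<Oplus>j\<in>{..i}. f (Suc j) (i - j) (n - i)) =
      (\<Oplus>i\<in>{..n}. \<Oplus>j\<in>{..n - i}. f (Suc i) j (n - i - j))"
    by (rule Suc.IH[of "\<lambda>i. f (Suc i)"]) (rule f)
  also have "\<dots> \<oplus> (\<Oplus>i\<in>{..n}. f 0 (Suc i) (n - i)) \<oplus> f 0 0 (Suc n) =
     \<dots> \<oplus> ((\<Oplus>i\<in>{..n}. f 0 (Suc i) (n - i)) \<oplus> f 0 0 (Suc n))"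
    by (rule a_assoc) (use c f in auto)
  also have "(\<Oplus>i\<in>{..n}. f 0 (Suc i) (n - i)) \<oplus> f 0 0 (Suc n) = (\<Oplus>i\<in>{..Suc n}. f 0 i (Suc n - i))"
    by (subst split) (use f in simp_all)
  also have "(\<Oplus>i\<in>{..n}. \<Oplus>j\<in>{..n - i}. f (Suc i) j (n - i - j)) \<oplus> \<dots> =
     (\<Oplus>i\<in>{..Suc n}. \<Oplus>j\<in>{..Suc n - i}. f i j (Suc n - i - j))"
    by (subst split[of "\<lambda>i. \<Oplus>j\<in>{..Suc n - i}. f i j (Suc n - i - j)"]) (use c f in simp_all)
  finally show ?case .
qed

section \<open>Abelian groups with a finite descending filtration\<close>

locale filtered_group = abelian_group G for G (structure) +
  fixes F :: "nat \<Rightarrow> 'a set"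
  assumes F_subgroup: "\<And>n. additive_subgroup (F n) G"
    and F_dec: "\<And>n. F (Suc n) \<subseteq> F n"
    and F_nil: "\<exists>N. \<forall>n\<ge>N. F n = {\<zero>}"
begin

lemma F_closed: "x \<in> F n \<Longrightarrow> x \<in> carrier G"
  by (rule additive_subgroup.a_Hcarr[OF F_subgroup])

lemma F_abelian_subgroup: "abelian_subgroup (F n) G"
  using F_subgroup by (rule abelian_subgroupI3) unfold_locales

lemma F_zero: "\<zero> \<in> F n"
  by (rule additive_subgroup.zero_closed[OF F_subgroup])

lemma F_add: "x \<in> F n \<Longrightarrow> y \<in> F n \<Longrightarrow> x \<oplus> y \<in> F n"
  by (rule additive_subgroup.a_closed[OF F_subgroup])

lemma F_minus: "x \<in> F n \<Longrightarrow> \<ominus> x \<in> F n"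
  by (rule additive_subgroup.a_inv_closed[OF F_subgroup])

lemma F_antimono: "m \<le> n \<Longrightarrow> F n \<subseteq> F m"
  using F_dec by (rule lift_Suc_antimono_le)

text \<open>Choosing a representative in every degree gives one inclusion. For the other,
  representatives in degrees with \<open>F n\<close> zero are zero themselves, so only finitely many
  components are nonzero.\<close>

lemma gr_part_eq: "gr_part G F X = gr_class G F ` {r. \<forall>n. r n \<in> F n \<inter> X}"
proof (intro equalityI subsetI)
  fix f assume "f \<in> gr_part G F X"
  then have "\<forall>n. \<exists>x. x \<in> F n \<inter> X \<and> f n = F (Suc n) +> x"
    by (auto simp: gr_part_def)
  then obtain r where "\<forall>n. r n \<in> F n \<inter> X \<and> f n = F (Suc n) +> r n"
    by metis
  then show "f \<in> gr_class G F ` {r. \<forall>n. r n \<in> F n \<inter> X}"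
    by (auto simp: gr_class_def)
next
  fix f assume "f \<in> gr_class G F ` {r. \<forall>n. r n \<in> F n \<inter> X}"
  then obtain r where r: "\<forall>n. r n \<in> F n \<inter> X" "f = gr_class G F r" by auto
  obtain N where N: "\<forall>n\<ge>N. F n = {\<zero>}" using F_nil by blast
  have "f n = F (Suc n)" if "n \<ge> N" for n
  proof -
    have "r n = \<zero>" "F (Suc n) = {\<zero>}" using r N that by auto
    then show ?thesis
      using a_coset_add_zero[of "F (Suc n)"] by (simp add: r gr_class_def)
  qed
  then have "{n. f n \<noteq> F (Suc n)} \<subseteq> {..<N}" by (auto simp: not_less[symmetric])
  then have "finite {n. f n \<noteq> F (Suc n)}" by (rule finite_subset) simp
  then show "f \<in> gr_part G F X"
    using r by (auto simp: gr_part_def gr_class_def)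
qed

lemma coset_zero_iff: "x \<in> carrier G \<Longrightarrow> F n +> x = F n \<longleftrightarrow> x \<in> F n"
  using a_coset_join1[of "F n" x] a_coset_join2[of x "F n"]
    additive_subgroup.a_subgroup[OF F_subgroup] by (intro iffI) simp_all

lemma gr_class_zero_iff:
  assumes "\<forall>n. r n \<in> F n"
  shows "gr_class G F r n = F (Suc n) \<longleftrightarrow> r n \<in> F (Suc n)"
  unfolding gr_class_def by (rule coset_zero_iff[OF F_closed]) (use assms in blast)

lemma gr_class_zero: "gr_class G F (\<lambda>n. \<zero>) = (\<lambda>n. F (Suc n))"
  unfolding gr_class_def by (intro ext a_coset_add_zero subsetI) (rule F_closed)

lemma gr_class_add:
  assumes "\<forall>n. r n \<in> F n" "\<forall>n. s n \<in> F n"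
  shows "(\<lambda>n. gr_class G F r n <+> gr_class G F s n) = gr_class G F (\<lambda>n. r n \<oplus> s n)"
  unfolding gr_class_def
  using F_closed[OF spec[OF assms(1)]] F_closed[OF spec[OF assms(2)]]
  by (intro ext abelian_subgroup.a_rcos_sum[OF F_abelian_subgroup])

text \<open>Stated for any record with these three fields, so that it covers both the even part of
  \<open>gr R\<close> and the whole of \<open>gr M\<close>.\<close>

lemma gr_abelian_group:
  fixes S :: "(nat \<Rightarrow> 'a set, 'z) ring_scheme"
  assumes X: "subgroup X (add_monoid G)"
    and S: "carrier S = gr_part G F X" "\<zero>\<^bsub>S\<^esub> = (\<lambda>n. F (Suc n))"
      "\<And>f g. f \<oplus>\<^bsub>S\<^esub> g = (\<lambda>n. f n <+> g n)"
  shows "abelian_group S"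
proof -
  interpret X: additive_subgroup X G using X by (rule additive_subgroupI)
  let ?Q = "{r. \<forall>n. r n \<in> F n \<inter> X}"
  have car: "carrier S = gr_class G F ` ?Q"
    using S(1) gr_part_eq by simp
  have add: "gr_class G F r \<oplus>\<^bsub>S\<^esub> gr_class G F s = gr_class G F (\<lambda>n. r n \<oplus> s n)"
    if "r \<in> ?Q" "s \<in> ?Q" for r s
    using that by (simp add: S(3) gr_class_add)
  have addQ: "(\<lambda>n. r n \<oplus> s n) \<in> ?Q" if "r \<in> ?Q" "s \<in> ?Q" for r s
    using that F_add by simp
  have zero: "\<zero>\<^bsub>S\<^esub> = gr_class G F (\<lambda>n. \<zero>)"
    by (simp add: S(2) gr_class_zero)
  have zeroQ: "(\<lambda>n. \<zero>) \<in> ?Q"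
    using F_zero by simp
  show ?thesis
  proof (rule abelian_groupI)
    fix x y assume "x \<in> carrier S" "y \<in> carrier S"
    then obtain r s where rs: "r \<in> ?Q" "s \<in> ?Q" "x = gr_class G F r" "y = gr_class G F s"
      unfolding car by (elim imageE)
    show "x \<oplus>\<^bsub>S\<^esub> y \<in> carrier S"
      unfolding car using rs add addQ by (metis (no_types, lifting) image_eqI)
    show "x \<oplus>\<^bsub>S\<^esub> y = y \<oplus>\<^bsub>S\<^esub> x"
      using rs F_closed by (simp add: add a_comm)
    fix z assume "z \<in> carrier S"
    then obtain t where t: "t \<in> ?Q" "z = gr_class G F t"
      unfolding car by (elim imageE)
    have "x \<oplus>\<^bsub>S\<^esub> y \<oplus>\<^bsub>S\<^esub> z = gr_class G F (\<lambda>n. r n \<oplus> s n \<oplus> t n)"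
      unfolding rs(3,4) t(2) add[OF rs(1,2)] by (rule add[OF addQ[OF rs(1,2)] t(1)])
    also have "\<dots> = gr_class G F (\<lambda>n. r n \<oplus> (s n \<oplus> t n))"
      using rs t F_closed by (simp add: a_assoc)
    also have "\<dots> = x \<oplus>\<^bsub>S\<^esub> (y \<oplus>\<^bsub>S\<^esub> z)"
      unfolding rs(3,4) t(2) add[OF rs(2) t(1)] by (rule add[OF rs(1) addQ[OF rs(2) t(1)], symmetric])
    finally show "x \<oplus>\<^bsub>S\<^esub> y \<oplus>\<^bsub>S\<^esub> z = x \<oplus>\<^bsub>S\<^esub> (y \<oplus>\<^bsub>S\<^esub> z)" .
  next
    show "\<zero>\<^bsub>S\<^esub> \<in> carrier S"
      unfolding car zero using zeroQ by (rule imageI)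
  next
    fix x assume "x \<in> carrier S"
    then obtain r where r: "r \<in> ?Q" "x = gr_class G F r"
      unfolding car by (elim imageE)
    show "\<zero>\<^bsub>S\<^esub> \<oplus>\<^bsub>S\<^esub> x = x"
      unfolding r(2) zero add[OF zeroQ r(1)] using r F_closed by simp
    have inv: "(\<lambda>n. \<ominus> r n) \<in> ?Q"
      using r F_minus by simp
    have "gr_class G F (\<lambda>n. \<ominus> r n) \<oplus>\<^bsub>S\<^esub> x = \<zero>\<^bsub>S\<^esub>"
      unfolding r(2) zero add[OF inv r(1)] using r F_closed by (simp add: l_neg)
    then show "\<exists>y\<in>carrier S. y \<oplus>\<^bsub>S\<^esub> x = \<zero>\<^bsub>S\<^esub>"
      unfolding car using inv by blast
  qed
qed

text \<open>The factor group is written multiplicatively, so its finite products are cosets of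
  finite sums; this evaluates the product in \<open>gr_mult\<close>.\<close>

lemma finprod_cosets:
  assumes "finite A" "\<And>i. i \<in> A \<Longrightarrow> f i \<in> carrier G"
  shows "(\<Otimes>\<^bsub>G A_Mod F n\<^esub>i\<in>A. F n +> f i) = F n +> finsum G f A"
proof -
  interpret H: abelian_subgroup "F n" G by (rule F_abelian_subgroup)
  interpret Q: comm_group "G A_Mod F n" by (rule H.a_factorgroup_is_comm_group)
  have c: "F n +> x \<in> carrier (G A_Mod F n)" if "x \<in> carrier G" for x
    using that H.a_r_coset_hom_A_Mod by (auto simp: hom_def)
  show ?thesis using assms
  proof (induction A rule: finite_induct)
    case empty
    have "\<one>\<^bsub>G A_Mod F n\<^esub> = F n +> \<zero>"
      using coset_zero_iff[OF zero_closed] F_zero by (simp add: A_FactGroup_def FactGroup_def)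
    then show ?case by simp
  next
    case (insert x A)
    then have "(\<Otimes>\<^bsub>G A_Mod F n\<^esub>i\<in>insert x A. F n +> f i) = (F n +> f x) <+> (F n +> finsum G f A)"
      using c by (subst Q.finprod_insert) auto
    also have "\<dots> = F n +> (f x \<oplus> finsum G f A)"
      using insert.prems by (intro H.a_rcos_sum finsum_closed) auto
    also have "f x \<oplus> finsum G f A = finsum G f (insert x A)"
      using insert by (intro finsum_insert[symmetric]) auto
    finally show ?case .
  qed
qed

lemma delta_closed: "a \<in> F k \<Longrightarrow> \<forall>n. delta G k a n \<in> F n"
  using F_zero by (simp add: delta_def)

end

text \<open>Multiplication of \<open>R\<close> on itself and the action of \<open>R\<close> on
  \<open>M\<close> are the two instances, so products in \<open>gr R\<close> and scalar multiples in
  \<open>gr M\<close> share their proofs.\<close>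

locale filtered_action = R?: ring R + E: filtered_group R E + G?: filtered_group G F
  for R :: "('a, 'c) ring_scheme" (structure) and E and G :: "('b, 'd) ring_scheme" (structure) and F +
  fixes p :: "'a \<Rightarrow> 'b \<Rightarrow> 'b"
  assumes p_filtered: "\<And>a x i j. \<lbrakk>a \<in> E i; x \<in> F j\<rbrakk> \<Longrightarrow> p a x \<in> F (i + j)"
    and p_closed: "\<And>a x. \<lbrakk>a \<in> carrier R; x \<in> carrier G\<rbrakk> \<Longrightarrow> p a x \<in> carrier G"
    and p_l_distr: "\<And>a b x. \<lbrakk>a \<in> carrier R; b \<in> carrier R; x \<in> carrier G\<rbrakk> \<Longrightarrow>
      p (a \<oplus> b) x = p a x \<oplus>\<^bsub>G\<^esub> p b x"
    and p_r_distr: "\<And>a x y. \<lbrakk>a \<in> carrier R; x \<in> carrier G; y \<in> carrier G\<rbrakk> \<Longrightarrow>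
      p a (x \<oplus>\<^bsub>G\<^esub> y) = p a x \<oplus>\<^bsub>G\<^esub> p a y"
    and p_assoc: "\<And>a b x. \<lbrakk>a \<in> carrier R; b \<in> carrier R; x \<in> carrier G\<rbrakk> \<Longrightarrow>
      p (a \<otimes> b) x = p a (p b x)"
begin

lemma p_l_zero: "x \<in> carrier G \<Longrightarrow> p \<zero> x = \<zero>\<^bsub>G\<^esub>"
proof -
  assume x: "x \<in> carrier G"
  have "p \<zero> x \<oplus>\<^bsub>G\<^esub> p \<zero> x = p \<zero> x \<oplus>\<^bsub>G\<^esub> \<zero>\<^bsub>G\<^esub>"
    using x p_l_distr[of \<zero> \<zero> x] p_closed by simp
  then show ?thesis using x p_closed by (metis G.add.l_cancel G.zero_closed R.zero_closed)
qed

lemma p_r_zero: "a \<in> carrier R \<Longrightarrow> p a \<zero>\<^bsub>G\<^esub> = \<zero>\<^bsub>G\<^esub>"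
proof -
  assume a: "a \<in> carrier R"
  have "p a \<zero>\<^bsub>G\<^esub> \<oplus>\<^bsub>G\<^esub> p a \<zero>\<^bsub>G\<^esub> = p a \<zero>\<^bsub>G\<^esub> \<oplus>\<^bsub>G\<^esub> \<zero>\<^bsub>G\<^esub>"
    using a p_r_distr[of a "\<zero>\<^bsub>G\<^esub>" "\<zero>\<^bsub>G\<^esub>"] p_closed by simp
  then show ?thesis using a p_closed by (metis G.add.l_cancel G.zero_closed)
qed

lemma p_finsum_left:
  assumes "finite A" "\<And>i. i \<in> A \<Longrightarrow> f i \<in> carrier R" "x \<in> carrier G"
  shows "p (finsum R f A) x = (\<Oplus>\<^bsub>G\<^esub>i\<in>A. p (f i) x)"
  using assms(1,2)
proof (induction A rule: finite_induct)
  case empty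
  then show ?case using assms(3) by (simp add: p_l_zero)
next
  case (insert i A)
  have "finsum R f (insert i A) = f i \<oplus> finsum R f A"
    using insert by (intro R.finsum_insert) auto
  moreover have "(\<Oplus>\<^bsub>G\<^esub>i\<in>insert i A. p (f i) x) = p (f i) x \<oplus>\<^bsub>G\<^esub> (\<Oplus>\<^bsub>G\<^esub>i\<in>A. p (f i) x)"
    using insert assms(3) p_closed by (intro G.finsum_insert) auto
  moreover have "finsum R f A \<in> carrier R"
    using insert by (intro R.finsum_closed) auto
  ultimately show ?case
    using insert assms(3) by (simp add: p_l_distr)
qed

lemma p_finsum_right:
  assumes "finite A" "\<And>i. i \<in> A \<Longrightarrow> f i \<in> carrier G" "a \<in> carrier R"
  shows "p a (finsum G f A) = (\<Oplus>\<^bsub>G\<^esub>i\<in>A. p a (f i))"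
  using assms(1,2)
proof (induction A rule: finite_induct)
  case empty
  then show ?case using assms(3) by (simp add: p_r_zero)
next
  case (insert i A)
  have "finsum G f (insert i A) = f i \<oplus>\<^bsub>G\<^esub> finsum G f A"
    using insert by (intro G.finsum_insert) auto
  moreover have "(\<Oplus>\<^bsub>G\<^esub>i\<in>insert i A. p a (f i)) = p a (f i) \<oplus>\<^bsub>G\<^esub> (\<Oplus>\<^bsub>G\<^esub>i\<in>A. p a (f i))"
    using insert assms(3) p_closed by (intro G.finsum_insert) auto
  moreover have "finsum G f A \<in> carrier G"
    using insert by (intro G.finsum_closed) auto
  ultimately show ?case
    using insert assms(3) by (simp add: p_r_distr)
qed

text \<open>Well-definedness: changing representatives by \<open>e\<close> and \<open>u\<close> adds
  the products \<open>e u\<close>, \<open>e x\<close> and \<open>a u\<close>, each with a factor one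
  step deeper in its filtration, so all lie in \<open>F (Suc (i + j))\<close>.\<close>

lemma coset_action:
  assumes a: "a \<in> E i" and x: "x \<in> F j"
  shows "(\<Union>b\<in>E (Suc i) +> a. \<Union>y\<in>F (Suc j) +>\<^bsub>G\<^esub> x. F (Suc (i + j)) +>\<^bsub>G\<^esub> p b y) =
    F (Suc (i + j)) +>\<^bsub>G\<^esub> p a x"
proof -
  interpret H: abelian_subgroup "F (Suc (i + j))" G by (rule G.F_abelian_subgroup)
  have eq: "F (Suc (i + j)) +>\<^bsub>G\<^esub> p b y = F (Suc (i + j)) +>\<^bsub>G\<^esub> p a x"
    if b: "b \<in> E (Suc i) +> a" and y: "y \<in> F (Suc j) +>\<^bsub>G\<^esub> x" for b y
  proof -
    obtain e where e: "e \<in> E (Suc i)" "b = e \<oplus> a"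
      using b by (auto simp: a_r_coset_def')
    obtain u where u: "u \<in> F (Suc j)" "y = u \<oplus>\<^bsub>G\<^esub> x"
      using y by (auto simp: a_r_coset_def')
    have c: "a \<in> carrier R" "x \<in> carrier G" "e \<in> carrier R" "u \<in> carrier G"
      using a x e u E.F_closed G.F_closed by auto
    have "p b y = (p e u \<oplus>\<^bsub>G\<^esub> p e x \<oplus>\<^bsub>G\<^esub> p a u) \<oplus>\<^bsub>G\<^esub> p a x"
      using c p_closed by (simp add: e u p_l_distr p_r_distr G.a_assoc G.a_lcomm)
    moreover have "p e u \<oplus>\<^bsub>G\<^esub> p e x \<oplus>\<^bsub>G\<^esub> p a u \<in> F (Suc (i + j))"
    proof (intro H.a_closed)
      show "p e u \<in> F (Suc (i + j))"
        using p_filtered[OF e(1) u(1)] G.F_antimono[of "Suc (i + j)" "Suc i + Suc j"] by auto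
      show "p e x \<in> F (Suc (i + j))" "p a u \<in> F (Suc (i + j))"
        using p_filtered[OF e(1) x] p_filtered[OF a u(1)] by simp_all
    qed
    ultimately have "p b y \<in> F (Suc (i + j)) +>\<^bsub>G\<^esub> p a x"
      by (auto simp: a_r_coset_def')
    then show ?thesis
      using c p_closed H.a_repr_independence' by simp
  qed
  have "a \<in> E (Suc i) +> a" "x \<in> F (Suc j) +>\<^bsub>G\<^esub> x"
    using a x E.F_closed G.F_closed abelian_subgroup.a_rcos_self E.F_abelian_subgroup G.F_abelian_subgroup
    by metis+
  with eq show ?thesis by blast
qed

text \<open>By \<open>coset_action\<close> each union in \<open>gr_mult\<close> is a single coset.
  From here on, identities in the graded objects are checked on representatives.\<close>

lemma gr_mult_class:
  assumes r: "\<forall>n. r n \<in> E n" and s: "\<forall>n. s n \<in> F n"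
  shows "gr_mult G F p (gr_class R E r) (gr_class G F s) = gr_class G F (conv G p r s)"
proof
  fix n
  interpret Q: comm_group "G A_Mod F (Suc n)"
    by (rule abelian_subgroup.a_factorgroup_is_comm_group[OF G.F_abelian_subgroup])
  have "(\<Union>a\<in>gr_class R E r i. \<Union>x\<in>gr_class G F s (n - i). F (Suc n) +>\<^bsub>G\<^esub> p a x) =
      F (Suc n) +>\<^bsub>G\<^esub> p (r i) (s (n - i))" if "i \<le> n" for i
    using coset_action[of "r i" i "s (n - i)" "n - i"] r s that by (simp add: gr_class_def)
  then have "gr_mult G F p (gr_class R E r) (gr_class G F s) n =
    (\<Otimes>\<^bsub>G A_Mod F (Suc n)\<^esub>i\<in>{..n}. F (Suc n) +>\<^bsub>G\<^esub> p (r i) (s (n - i)))"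
    unfolding gr_mult_def
    using E.F_closed[OF spec[OF r]] G.F_closed[OF spec[OF s]] p_closed
    by (intro Q.finprod_cong') (auto simp: A_FactGroup_def FactGroup_def A_RCOSETS_def[symmetric] intro!: G.a_rcosetsI intro: G.F_closed)
  also have "\<dots> = gr_class G F (conv G p r s) n"
    using E.F_closed[OF spec[OF r]] G.F_closed[OF spec[OF s]] p_closed by (subst finprod_cosets) (auto simp: gr_class_def conv_def)
  finally show "gr_mult G F p (gr_class R E r) (gr_class G F s) n = gr_class G F (conv G p r s) n" .
qed

lemma conv_closed:
  assumes "\<forall>n. r n \<in> E n" "\<forall>n. s n \<in> F n"
  shows "\<forall>n. conv G p r s n \<in> F n"
proof
  fix n
  have "p (r i) (s (n - i)) \<in> F n" if "i \<le> n" for i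
    using p_filtered[of "r i" i "s (n - i)" "n - i"] assms that by simp
  then show "conv G p r s n \<in> F n"
    unfolding conv_def by (intro G.finsum_mem_additive_subgroup[OF G.F_subgroup]) auto
qed

lemma conv_l_distr:
  assumes "\<forall>n. r n \<in> E n" "\<forall>n. r' n \<in> E n" "\<forall>n. s n \<in> F n"
  shows "conv G p (\<lambda>n. r n \<oplus> r' n) s = (\<lambda>n. conv G p r s n \<oplus>\<^bsub>G\<^esub> conv G p r' s n)"
proof -
  have c: "r n \<in> carrier R" "r' n \<in> carrier R" "s n \<in> carrier G" for n
    using E.F_closed[OF spec[OF assms(1)]] E.F_closed[OF spec[OF assms(2)]] G.F_closed[OF spec[OF assms(3)]] by auto
  then show ?thesis
    by (simp add: conv_def p_l_distr p_closed G.finsum_addf Pi_def)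
qed

lemma conv_r_distr:
  assumes "\<forall>n. r n \<in> E n" "\<forall>n. s n \<in> F n" "\<forall>n. t n \<in> F n"
  shows "conv G p r (\<lambda>n. s n \<oplus>\<^bsub>G\<^esub> t n) = (\<lambda>n. conv G p r s n \<oplus>\<^bsub>G\<^esub> conv G p r t n)"
proof -
  have c: "r n \<in> carrier R" "s n \<in> carrier G" "t n \<in> carrier G" for n
    using E.F_closed[OF spec[OF assms(1)]] G.F_closed[OF spec[OF assms(2)]] G.F_closed[OF spec[OF assms(3)]] by auto
  then show ?thesis
    by (simp add: conv_def p_r_distr p_closed G.finsum_addf Pi_def)
qed

lemma conv_assoc:
  assumes "\<forall>n. r n \<in> E n" "\<forall>n. r' n \<in> E n" "\<forall>n. s n \<in> F n"
  shows "conv G p (conv R (\<otimes>) r r') s = conv G p r (conv G p r' s)"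
proof
  fix n
  have c: "r n \<in> carrier R" "r' n \<in> carrier R" "s n \<in> carrier G" for n
    using E.F_closed[OF spec[OF assms(1)]] E.F_closed[OF spec[OF assms(2)]] G.F_closed[OF spec[OF assms(3)]] by auto
  have "conv G p (conv R (\<otimes>) r r') s n = (\<Oplus>\<^bsub>G\<^esub>i\<in>{..n}. \<Oplus>\<^bsub>G\<^esub>j\<in>{..i}. p (r j) (p (r' (i - j)) (s (n - i))))"
    using c by (simp add: conv_def p_finsum_left p_assoc)
  also have "\<dots> = (\<Oplus>\<^bsub>G\<^esub>i\<in>{..n}. \<Oplus>\<^bsub>G\<^esub>j\<in>{..n - i}. p (r i) (p (r' j) (s (n - i - j))))"
    using c p_closed by (intro G.finsum_triangle[of "\<lambda>i j k. p (r i) (p (r' j) (s k))"]) auto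
  also have "\<dots> = conv G p r (conv G p r' s) n"
    using c p_closed by (simp add: conv_def p_finsum_right)
  finally show "conv G p (conv R (\<otimes>) r r') s n = conv G p r (conv G p r' s) n" .
qed

text \<open>Only the summand \<open>i = k\<close> survives, so a homogeneous factor of degree
  \<open>k\<close> acts and shifts degrees by \<open>k\<close>.\<close>

lemma conv_delta:
  assumes "a \<in> E k" "\<forall>n. s n \<in> F n"
  shows "conv G p (delta R k a) s = (\<lambda>n. if k \<le> n then p a (s (n - k)) else \<zero>\<^bsub>G\<^esub>)"
proof
  fix n
  have c: "a \<in> carrier R" "s n \<in> carrier G" for n
    using E.F_closed[OF assms(1)] G.F_closed[OF spec[OF assms(2)]] by auto
  have "conv G p (delta R k a) s n = (\<Oplus>\<^bsub>G\<^esub>i\<in>{..n}. if k = i then p a (s (n - i)) else \<zero>\<^bsub>G\<^esub>)"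
    unfolding conv_def using c p_closed
    by (intro G.finsum_cong') (auto simp: delta_def p_l_zero)
  also have "\<dots> = (if k \<le> n then p a (s (n - k)) else \<zero>\<^bsub>G\<^esub>)"
  proof (cases "k \<le> n")
    case True
    then show ?thesis
      using c p_closed G.finsum_singleton[of k "{..n}" "\<lambda>i. p a (s (n - i))"] by simp
  next
    case False
    then have "(\<Oplus>\<^bsub>G\<^esub>i\<in>{..n}. if k = i then p a (s (n - i)) else \<zero>\<^bsub>G\<^esub>) = (\<Oplus>\<^bsub>G\<^esub>i\<in>{..n}. \<zero>\<^bsub>G\<^esub>)"
      by (intro G.finsum_cong') auto
    then show ?thesis using False by simp
  qed
  finally show "conv G p (delta R k a) s n = (if k \<le> n then p a (s (n - k)) else \<zero>\<^bsub>G\<^esub>)" .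
qed

text \<open>Membership of \<open>r n\<close> in \<open>E (Suc n)\<close> says that the class
  vanishes in degree \<open>n\<close>. The lemma is additivity of orders of vanishing: if
  \<open>n < j + k\<close>, then each summand has \<open>i < j\<close> or
  \<open>n - i < k\<close>.\<close>

lemma conv_order:
  assumes r: "\<forall>n. r n \<in> E n" and s: "\<forall>n. s n \<in> F n"
    and j: "\<And>n. n < j \<Longrightarrow> r n \<in> E (Suc n)" and k: "\<And>n. n < k \<Longrightarrow> s n \<in> F (Suc n)"
    and n: "n < j + k"
  shows "conv G p r s n \<in> F (Suc n)"
proof -
  have "p (r i) (s (n - i)) \<in> F (Suc n)" if "i \<le> n" for i
  proof (cases "i < j")
    case True
    then show ?thesis
      using p_filtered[of "r i" "Suc i" "s (n - i)" "n - i"] s j that by simp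
  next
    case False
    then have "n - i < k" using n that by linarith
    then show ?thesis
      using p_filtered[of "r i" i "s (n - i)" "Suc (n - i)"] r k that by simp
  qed
  then show ?thesis
    unfolding conv_def by (intro G.finsum_mem_additive_subgroup[OF G.F_subgroup]) auto
qed

end

section \<open>Super-rings and the odd filtration\<close>

lemma (in ring) ideal_prod_carrier:
  assumes "A \<subseteq> carrier R" "B \<subseteq> carrier R"
  shows "ideal_prod R A B \<subseteq> carrier R"
proof
  fix x assume "x \<in> ideal_prod R A B"
  then show "x \<in> carrier R"
    by (induction rule: ideal_prod.induct) (use assms in auto)
qed

text \<open>Negatives come from \<open>A\<close>, since \<open>-(a b) = (-a) b\<close>. Hence
  \<open>B\<close> may be a set like \<open>rpart R 1\<close>, as in the definition of the odd
  ideal.\<close>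

lemma (in ring) ideal_prod_additive_subgroup:
  assumes "additive_subgroup A R" "B \<subseteq> carrier R" "B \<noteq> {}"
  shows "additive_subgroup (ideal_prod R A B) R"
proof (rule additive_subgroupI)
  interpret A: additive_subgroup A R by fact
  have sub: "ideal_prod R A B \<subseteq> carrier R"
    using A.a_subset assms(2) by (rule ideal_prod_carrier)
  show "subgroup (ideal_prod R A B) (add_monoid R)"
  proof (rule group.subgroupI[OF a_group])
    show "ideal_prod R A B \<subseteq> carrier (add_monoid R)" using sub by simp
    obtain b where "b \<in> B" using assms(3) by blast
    then have "\<zero> \<otimes> b \<in> ideal_prod R A B" by (intro ideal_prod.prod A.zero_closed)
    then show "ideal_prod R A B \<noteq> {}" by blast
  next
    fix x assume "x \<in> ideal_prod R A B"
    then have "\<ominus> x \<in> ideal_prod R A B"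
    proof (induction rule: ideal_prod.induct)
      case (prod i j)
      then have "\<ominus> i \<otimes> j \<in> ideal_prod R A B" by (intro ideal_prod.prod A.a_inv_closed)
      moreover have "\<ominus> (i \<otimes> j) = \<ominus> i \<otimes> j"
        using prod assms(2) A.a_Hcarr by (intro l_minus[symmetric]) auto
      ultimately show ?case by simp
    next
      case (sum s t)
      then have "\<ominus> (s \<oplus> t) = \<ominus> s \<oplus> \<ominus> t"
        using sub by (intro minus_add) auto
      then show ?case
        using sum by (auto intro: ideal_prod.sum)
    qed
    then show "inv\<^bsub>add_monoid R\<^esub> x \<in> ideal_prod R A B" by (simp add: a_inv_def)
  qed (simp add: ideal_prod.sum)
qed

text \<open>Without a maximal member, dependent choice would build a strictly increasing sequence of
  superideals.\<close>

lemma (in noetherian_superring) superideal_maximal: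
  assumes "T \<noteq> {}" "\<And>J. J \<in> T \<Longrightarrow> superideal J R"
  shows "\<exists>J\<in>T. \<forall>J'\<in>T. J \<subseteq> J' \<longrightarrow> J' = J"
proof (rule ccontr)
  assume "\<not> ?thesis"
  then have step: "\<And>J. J \<in> T \<Longrightarrow> \<exists>J'. J' \<in> T \<and> J \<subset> J'" by blast
  obtain f where f: "\<And>n::nat. f n \<in> T" "\<And>n. f n \<subset> f (Suc n)"
    using dependent_nat_choice[of "\<lambda>_ J. J \<in> T" "\<lambda>_ J J'. J \<subset> J'"] assms(1) step by (metis ex_in_conv)
  have "\<exists>N. \<forall>n\<ge>N. f n = f N"
  proof (rule acc[of f])
    show "superideal (f n) R" for n using f(1) by (rule assms(2))
    show "f n \<subseteq> f (Suc n)" for n using f(2)[of n] by simp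
  qed
  then obtain N where "\<forall>n\<ge>N. f n = f N" ..
  then have "f (Suc N) = f N" by (rule allE[of _ "Suc N"]) (metis lessI less_imp_le)
  then show False
    using f(2)[of N] by simp
qed

section \<open>Elementary algebra of super-rings\<close>

context superring
begin

definition homogeneous :: "'a set" where
  "homogeneous = rpart R 0 \<union> rpart R 1"

definition odd_prod :: "'a list \<Rightarrow> 'a" where
  "odd_prod zs = foldr (\<otimes>) zs \<one>"

lemma part_additive_subgroup: "additive_subgroup (rpart R i) R"
  using part_subgroup by (rule additive_subgroupI)

lemma part_closed: "a \<in> rpart R i \<Longrightarrow> a \<in> carrier R"
  by (rule additive_subgroup.a_Hcarr[OF part_additive_subgroup])

lemma homogeneous_iff: "a \<in> homogeneous \<longleftrightarrow> (\<exists>i. a \<in> rpart R i)"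
proof
  assume "\<exists>i. a \<in> rpart R i"
  then obtain i where "a \<in> rpart R i" ..
  then show "a \<in> homogeneous"
    by (cases i) (auto simp: homogeneous_def)
qed (auto simp: homogeneous_def)

lemma homogeneous_closed: "a \<in> homogeneous \<Longrightarrow> a \<in> carrier R"
  using homogeneous_iff part_closed by auto

lemma part_decompose:
  assumes "a \<in> carrier R"
  obtains b c where "b \<in> rpart R 0" "c \<in> rpart R 1" "a = b \<oplus> c"
proof -
  have "\<exists>b\<in>rpart R 0. \<exists>c\<in>rpart R 1. a = b \<oplus> c"
    using assms unfolding part_sum set_add_def' by simp
  then show ?thesis using that by auto
qed

lemma homogeneous_mult: "a \<in> homogeneous \<Longrightarrow> b \<in> homogeneous \<Longrightarrow> a \<otimes> b \<in> homogeneous"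
  using part_mult unfolding homogeneous_iff by blast

lemma homogeneous_commute:
  assumes "a \<in> homogeneous" "b \<in> homogeneous"
  shows "a \<otimes> b = b \<otimes> a \<or> a \<otimes> b = \<ominus> (b \<otimes> a)"
proof -
  obtain i j where "a \<in> rpart R i" "b \<in> rpart R j"
    using assms homogeneous_iff by auto
  from supercomm[OF this] show ?thesis by (auto split: if_splits)
qed

text \<open>Write \<open>1 = e + f\<close> with \<open>e\<close> even and \<open>f\<close> odd.
  Multiplying by \<open>f\<close> gives \<open>f = f e\<close>, as \<open>f\<close> has square zero.
  Multiplying by \<open>e\<close> gives \<open>e - e e = e f\<close>, an element both even and odd,
  hence zero. As \<open>e\<close> and \<open>f\<close> commute, \<open>f = 0\<close>.\<close>

lemma one_even: "\<one> \<in> rpart R 0"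
proof -
  obtain e f where ef: "e \<in> rpart R 0" "f \<in> rpart R 1" "\<one> = e \<oplus> f"
    using part_decompose[OF one_closed] .
  have c: "e \<in> carrier R" "f \<in> carrier R" using ef part_closed by auto
  interpret P0: additive_subgroup "rpart R 0" R by (rule part_additive_subgroup)
  interpret P1: additive_subgroup "rpart R 1" R by (rule part_additive_subgroup)
  have ff: "f = f \<otimes> e"
  proof -
    have "f = f \<otimes> (e \<oplus> f)" using c ef by (metis r_one)
    also have "\<dots> = f \<otimes> e" using c odd_square[OF ef(2)] by (simp add: r_distr)
    finally show ?thesis .
  qed
  have "e = e \<otimes> (e \<oplus> f)" using c ef by (metis r_one)
  then have "e \<ominus> e \<otimes> e = e \<otimes> f"
    using c by (simp add: r_distr minus_eq a_ac r_neg2) (metis a_assoc a_comm a_inv_closed c m_closed r_neg1)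
  moreover have "e \<ominus> e \<otimes> e \<in> rpart R 0"
    using ef part_mult[OF ef(1,1)] unfolding minus_eq by (intro P0.a_closed P0.a_inv_closed) auto
  moreover have "e \<otimes> f \<in> rpart R 1"
    using part_mult[OF ef(1,2)] by simp
  ultimately have "e \<otimes> f = \<zero>" using part_disjoint by auto
  moreover have "f \<otimes> e = e \<otimes> f" using supercomm[OF ef(2,1)] by simp
  ultimately have "f = \<zero>" using ff by simp
  then show ?thesis using ef c by simp
qed

lemma even_central:
  assumes "a \<in> rpart R 0" "b \<in> carrier R"
  shows "a \<otimes> b = b \<otimes> a"
proof -
  obtain u v where uv: "u \<in> rpart R 0" "v \<in> rpart R 1" "b = u \<oplus> v"
    using part_decompose[OF assms(2)] .
  have "a \<otimes> u = u \<otimes> a" "a \<otimes> v = v \<otimes> a"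
    using supercomm[OF assms(1) uv(1)] supercomm[OF assms(1) uv(2)] by auto
  then show ?thesis
    using uv assms part_closed by (simp add: l_distr r_distr)
qed

lemma even_subring: "subring (rpart R 0) R"
proof (rule subringI)
  interpret P0: additive_subgroup "rpart R 0" R by (rule part_additive_subgroup)
  show "rpart R 0 \<subseteq> carrier R" by (rule P0.a_subset)
  show "\<one> \<in> rpart R 0" by (rule one_even)
  show "\<And>h. h \<in> rpart R 0 \<Longrightarrow> \<ominus> h \<in> rpart R 0"
    by (rule P0.a_inv_closed)
  show "\<And>a b. \<lbrakk>a \<in> rpart R 0; b \<in> rpart R 0\<rbrakk> \<Longrightarrow> a \<oplus> b \<in> rpart R 0"
    by (rule P0.a_closed)
  show "\<And>a b. \<lbrakk>a \<in> rpart R 0; b \<in> rpart R 0\<rbrakk> \<Longrightarrow> a \<otimes> b \<in> rpart R 0"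
    using part_mult[of _ 0 _ 0] by simp
qed

lemma even_ring_cring: "cring (even_ring R)"
proof -
  have "subcring (rpart R 0) R"
    using even_subring by (rule subcringI) (use even_central part_closed in blast)
  then show ?thesis
    unfolding even_ring_def using subcring_iff[of "rpart R 0"] subcringE(1) by blast
qed

lemma even_ring_simps [simp]:
  "carrier (even_ring R) = rpart R 0" "monoid.mult (even_ring R) = monoid.mult R" "add (even_ring R) = add R"
  "\<one>\<^bsub>even_ring R\<^esub> = \<one>" "\<zero>\<^bsub>even_ring R\<^esub> = \<zero>"
  by (simp_all add: even_ring_def)

text \<open>With \<open>r = u + v\<close> split by parity, \<open>b r = (u - v) b\<close>. This
  moves coefficients to the left of odd factors.\<close>

lemma odd_shift:
  assumes "b \<in> rpart R 1" "r \<in> carrier R"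
  obtains s where "s \<in> carrier R" "b \<otimes> r = s \<otimes> b"
proof -
  obtain u v where uv: "u \<in> rpart R 0" "v \<in> rpart R 1" "r = u \<oplus> v"
    using part_decompose[OF assms(2)] .
  have c: "u \<in> carrier R" "v \<in> carrier R" "b \<in> carrier R"
    using uv assms part_closed by auto
  have "b \<otimes> u = u \<otimes> b" "b \<otimes> v = \<ominus> (v \<otimes> b)"
    using supercomm[OF assms(1) uv(1)] supercomm[OF assms(1) uv(2)] by auto
  then have "b \<otimes> r = (u \<ominus> v) \<otimes> b"
    using c by (simp add: uv(3) r_distr l_distr minus_eq l_minus)
  then show ?thesis using that[of "u \<ominus> v"] c by simp
qed

lemma odd_prod_simps [simp]: "odd_prod [] = \<one>" "odd_prod (z # zs) = z \<otimes> odd_prod zs"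
  by (simp_all add: odd_prod_def)

lemma odd_prod_homogeneous: "set zs \<subseteq> rpart R 1 \<Longrightarrow> odd_prod zs \<in> homogeneous"
proof (induction zs)
  case Nil
  then show ?case using one_even by (auto simp: homogeneous_def)
next
  case (Cons z zs)
  then have "z \<in> homogeneous" by (simp add: homogeneous_def)
  with Cons show ?case by (simp add: homogeneous_mult)
qed

lemma odd_prod_closed: "set zs \<subseteq> rpart R 1 \<Longrightarrow> odd_prod zs \<in> carrier R"
  using odd_prod_homogeneous homogeneous_closed by blast

section \<open>Powers of the ideal generated by the odd elements\<close>

abbreviation odd_pow :: "nat \<Rightarrow> 'a set" where
  "odd_pow \<equiv> ideal_pow R (odd_ideal R)"

lemma odd_ideal_additive_subgroup: "additive_subgroup (odd_ideal R) R"
  unfolding odd_ideal_def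
proof (rule ideal_prod_additive_subgroup)
  show "additive_subgroup (carrier R) R"
    by (intro additive_subgroupI add.group_incl_imp_subgroup) (auto simp: a_group)
  show "rpart R 1 \<subseteq> carrier R" using part_closed by blast
  show "rpart R 1 \<noteq> {}" using part_disjoint by blast
qed

lemma odd_ideal_closed: "a \<in> odd_ideal R \<Longrightarrow> a \<in> carrier R"
  by (rule additive_subgroup.a_Hcarr[OF odd_ideal_additive_subgroup])

lemma odd_ideal_l_closed:
  assumes "a \<in> odd_ideal R" "r \<in> carrier R"
  shows "r \<otimes> a \<in> odd_ideal R"
  using assms(1) unfolding odd_ideal_def
proof (induction rule: ideal_prod.induct)
  case (prod i j)
  then have "(r \<otimes> i) \<otimes> j \<in> ideal_prod R (carrier R) (rpart R 1)"
    using assms(2) by (intro ideal_prod.prod) auto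
  then show ?case using prod assms(2) part_closed by (simp add: m_assoc)
next
  case (sum s t)
  then have "s \<in> carrier R" "t \<in> carrier R"
    using odd_ideal_closed by (auto simp: odd_ideal_def)
  then show ?case
    using sum assms(2) by (simp add: r_distr ideal_prod.sum)
qed

lemma odd_pow_additive_subgroup: "additive_subgroup (odd_pow n) R"
proof (induction n)
  case 0
  show ?case
    by (intro additive_subgroupI add.group_incl_imp_subgroup) (auto simp: a_group)
next
  case (Suc n)
  show ?case
    unfolding ideal_pow.simps
    using odd_ideal_additive_subgroup additive_subgroup.a_subset[OF Suc]
      additive_subgroup.zero_closed[OF Suc]
    by (intro ideal_prod_additive_subgroup) auto
qed

lemma odd_pow_closed: "a \<in> odd_pow n \<Longrightarrow> a \<in> carrier R"
  by (rule additive_subgroup.a_Hcarr[OF odd_pow_additive_subgroup])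

lemma odd_pow_l_closed:
  assumes "r \<in> carrier R" "a \<in> odd_pow n"
  shows "r \<otimes> a \<in> odd_pow n"
proof (cases n)
  case 0
  then show ?thesis using assms by simp
next
  case (Suc m)
  have "a \<in> ideal_prod R (odd_ideal R) (odd_pow m)"
    using assms Suc by simp
  then have "r \<otimes> a \<in> ideal_prod R (odd_ideal R) (odd_pow m)"
  proof (induction rule: ideal_prod.induct)
    case (prod i j)
    then have "(r \<otimes> i) \<otimes> j \<in> ideal_prod R (odd_ideal R) (odd_pow m)"
      using assms(1) by (intro ideal_prod.prod odd_ideal_l_closed) auto
    then show ?case
      using prod assms(1) odd_ideal_closed odd_pow_closed by (simp add: m_assoc)
  next
    case (sum s t)
    then have "s \<in> carrier R" "t \<in> carrier R"
      using odd_pow_closed[of _ "Suc m"] by auto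
    then show ?case
      using sum assms(1) by (simp add: r_distr ideal_prod.sum)
  qed
  then show ?thesis using Suc by simp
qed

lemma odd_pow_mult:
  assumes "a \<in> odd_pow i" "b \<in> odd_pow j"
  shows "a \<otimes> b \<in> odd_pow (i + j)"
  using assms(1)
proof (induction i arbitrary: a)
  case 0
  then show ?case using assms odd_pow_l_closed by simp
next
  case (Suc i)
  have "a \<in> ideal_prod R (odd_ideal R) (odd_pow i)"
    using Suc.prems by simp
  then have "a \<otimes> b \<in> ideal_prod R (odd_ideal R) (odd_pow (i + j))"
  proof (induction rule: ideal_prod.induct)
    case (prod u v)
    then have "u \<otimes> (v \<otimes> b) \<in> ideal_prod R (odd_ideal R) (odd_pow (i + j))"
      by (intro ideal_prod.prod Suc.IH)
    then show ?case
      using prod assms(2) odd_ideal_closed odd_pow_closed by (simp add: m_assoc)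
  next
    case (sum s t)
    then have "s \<in> carrier R" "t \<in> carrier R"
      using odd_pow_closed[of _ "Suc i"] by auto
    then show ?case
      using sum assms(2) odd_pow_closed by (simp add: l_distr ideal_prod.sum)
  qed
  then show ?case by simp
qed

lemma odd_pow_dec: "odd_pow (Suc n) \<subseteq> odd_pow n"
proof
  fix a assume "a \<in> odd_pow (Suc n)"
  then have "a \<in> ideal_prod R (odd_ideal R) (odd_pow n)" by simp
  then show "a \<in> odd_pow n"
  proof (induction rule: ideal_prod.induct)
    case (prod u v)
    then show ?case using odd_pow_l_closed odd_ideal_closed by blast
  next
    case (sum s t)
    then show ?case
      using additive_subgroup.a_closed[OF odd_pow_additive_subgroup] by blast
  qed
qed

lemma odd_in_odd_ideal: "z \<in> rpart R 1 \<Longrightarrow> z \<in> odd_ideal R"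
  using ideal_prod.prod[of \<one> "carrier R" z "rpart R 1" R] part_closed
  by (simp add: odd_ideal_def)

lemma odd_prod_in_odd_pow: "set zs \<subseteq> rpart R 1 \<Longrightarrow> odd_prod zs \<in> odd_pow (length zs)"
  by (induction zs) (auto intro: ideal_prod.prod odd_in_odd_ideal)

lemma odd_in_odd_pow: "z \<in> rpart R 1 \<Longrightarrow> z \<in> odd_pow 1"
  using odd_prod_in_odd_pow[of "[z]"] part_closed by simp

text \<open>The power \<open>I^l\<close> is additively spanned by the elements \<open>r\<close>
  times a product of \<open>l\<close> odd elements, because \<open>odd_shift\<close> collects all
  coefficients in front.\<close>

lemma odd_pow_induct [consumes 1, case_names prod sum]:
  assumes "e \<in> odd_pow l"
    and "\<And>r zs. \<lbrakk>r \<in> carrier R; set zs \<subseteq> rpart R 1; length zs = l\<rbrakk> \<Longrightarrow> Q (r \<otimes> odd_prod zs)"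
    and "\<And>x y. \<lbrakk>x \<in> carrier R; y \<in> carrier R; Q x; Q y\<rbrakk> \<Longrightarrow> Q (x \<oplus> y)"
  shows "Q e"
  using assms
proof (induction l arbitrary: e Q)
  case 0
  then show ?case using "0.prems"(2)[of e "[]"] by simp
next
  case (Suc l)
  \<comment> \<open>The induction hypothesis is used for the predicate sending \<open>e\<close> to
    \<open>Q ((r \<otimes> b) \<otimes> e)\<close>, which is why \<open>Q\<close> is
    generalised.\<close>
  have base: "Q ((r \<otimes> b) \<otimes> e)" if rb: "r \<in> carrier R" "b \<in> rpart R 1" and e: "e \<in> odd_pow l" for r b e
    using e
  proof (rule Suc.IH)
    fix r' zs assume *: "r' \<in> carrier R" "set zs \<subseteq> rpart R 1" "length zs = l"
    obtain s where s: "s \<in> carrier R" "b \<otimes> r' = s \<otimes> b"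
      using odd_shift[OF rb(2) *(1)] .
    have c: "b \<in> carrier R" "odd_prod zs \<in> carrier R"
      using rb * part_closed odd_prod_closed by auto
    have "(r \<otimes> b) \<otimes> (r' \<otimes> odd_prod zs) = r \<otimes> (b \<otimes> r') \<otimes> odd_prod zs"
      using rb * c by (simp add: m_assoc)
    also have "\<dots> = (r \<otimes> s) \<otimes> odd_prod (b # zs)"
      using rb c s by (simp add: m_assoc)
    finally show "Q ((r \<otimes> b) \<otimes> (r' \<otimes> odd_prod zs))"
      using Suc.prems(2)[of "r \<otimes> s" "b # zs"] rb * s by simp
  next
    fix x y assume "x \<in> carrier R" "y \<in> carrier R" "Q ((r \<otimes> b) \<otimes> x)" "Q ((r \<otimes> b) \<otimes> y)"
    then show "Q ((r \<otimes> b) \<otimes> (x \<oplus> y))"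
      using rb part_closed Suc.prems(3) by (simp add: r_distr)
  qed
  have step: "Q (a \<otimes> e)" if a: "a \<in> odd_ideal R" and e: "e \<in> odd_pow l" for a e
    using a unfolding odd_ideal_def
  proof (induction rule: ideal_prod.induct)
    case (prod i j)
    then show ?case using base e by blast
  next
    case (sum s t)
    then have "s \<in> carrier R" "t \<in> carrier R"
      using odd_ideal_closed by (auto simp: odd_ideal_def)
    then show ?case
      using sum e odd_pow_closed Suc.prems(3) by (simp add: l_distr)
  qed
  have "e \<in> ideal_prod R (odd_ideal R) (odd_pow l)"
    using Suc.prems(1) by simp
  then show ?case
  proof (induction rule: ideal_prod.induct)
    case (prod i j)
    then show ?case using step by blast
  next
    case (sum s t)
    then have "s \<in> carrier R" "t \<in> carrier R"
      using odd_pow_closed[of _ "Suc l"] by auto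
    then show ?case
      using sum Suc.prems(3) by blast
  qed
qed

end

section \<open>Supermodules and the filtration by \<open>I^n M\<close>\<close>

context supermodule
begin

lemma smult_l_zero: "x \<in> carrier M \<Longrightarrow> \<zero>\<^bsub>R\<^esub> \<odot> x = \<zero>"
proof -
  assume x: "x \<in> carrier M"
  have "\<zero>\<^bsub>R\<^esub> \<odot> x \<oplus> \<zero>\<^bsub>R\<^esub> \<odot> x = \<zero>\<^bsub>R\<^esub> \<odot> x \<oplus> \<zero>"
    using x smult_l_distr[of "\<zero>\<^bsub>R\<^esub>" "\<zero>\<^bsub>R\<^esub>" x] smult_closed by simp
  then show ?thesis using x smult_closed by (metis M.add.l_cancel M.zero_closed R.zero_closed)
qed

lemma smult_r_zero: "a \<in> carrier R \<Longrightarrow> a \<odot> \<zero> = \<zero>"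
proof -
  assume a: "a \<in> carrier R"
  have "a \<odot> \<zero> \<oplus> a \<odot> \<zero> = a \<odot> \<zero> \<oplus> \<zero>"
    using a smult_r_distr[of a \<zero> \<zero>] smult_closed by simp
  then show ?thesis using a smult_closed by (metis M.add.l_cancel M.zero_closed)
qed

lemma smult_l_minus: "a \<in> carrier R \<Longrightarrow> x \<in> carrier M \<Longrightarrow> (\<ominus>\<^bsub>R\<^esub> a) \<odot> x = \<ominus> (a \<odot> x)"
proof -
  assume a: "a \<in> carrier R" and x: "x \<in> carrier M"
  have "(\<ominus>\<^bsub>R\<^esub> a) \<odot> x \<oplus> a \<odot> x = \<zero>"
    using smult_l_distr[of "\<ominus>\<^bsub>R\<^esub> a" a x] a x smult_l_zero by (simp add: R.l_neg)
  then show ?thesis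
    using a x smult_closed by (metis M.minus_equality R.a_inv_closed)
qed

lemma mpart_closed: "x \<in> mpart M i \<Longrightarrow> x \<in> carrier M"
  by (rule additive_subgroup.a_Hcarr[OF additive_subgroupI[OF mpart_subgroup]])

lemma mpart_decompose:
  assumes "x \<in> carrier M"
  obtains y z where "y \<in> mpart M 0" "z \<in> mpart M 1" "x = y \<oplus> z"
proof -
  have "\<exists>y\<in>mpart M 0. \<exists>z\<in>mpart M 1. x = y \<oplus> z"
    using assms unfolding mpart_sum set_add_def' by simp
  then show ?thesis using that by auto
qed

lemma mpart_zero_sum:
  assumes "x \<in> mpart M i" "y \<in> mpart M (i + 1)" "x \<oplus> y = \<zero>"
  shows "x = \<zero>" "y = \<zero>"
proof -
  have c: "x \<in> carrier M" "y \<in> carrier M" using assms mpart_closed by auto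
  have a: "x = \<ominus> y" using assms(3) c M.minus_equality by auto
  then have "x \<in> mpart M (i + 1)"
    using assms(2) additive_subgroup.a_inv_closed[OF additive_subgroupI[OF mpart_subgroup]] by simp
  with assms(1) have "x \<in> mpart M 0 \<inter> mpart M 1"
    by (cases i) auto
  then show "x = \<zero>" by (simp add: mpart_disjoint)
  then show "y = \<zero>" using assms(3) c by simp
qed

text \<open>Restricting scalars to the commutative ring \<open>R_0\<close> makes the supermodule an
  ordinary module, to which \<open>annihilator_is_ideal\<close> applies.\<close>

lemma even_module: "Module.module (even_ring R) M"
proof (rule moduleI)
  show "cring (even_ring R)" by (rule R.even_ring_cring)
  show "abelian_group M" by (rule M.abelian_group_axioms)
qed (use R.part_closed smult_closed smult_l_distr smult_r_distr smult_assoc smult_one in auto)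

text \<open>Homogeneity of the elements of \<open>H\<close> makes the annihilator graded, and
  stability of \<open>H\<close> under homogeneous scalars makes it a right ideal. This form produces
  the superideals to which the chain condition is applied.\<close>

lemma annihilator_superideal:
  assumes H: "H \<subseteq> mpart M 0 \<union> mpart M 1"
    and closed: "\<And>r x. \<lbrakk>r \<in> R.homogeneous; x \<in> H\<rbrakk> \<Longrightarrow> r \<odot> x \<in> H"
  shows "superideal {w \<in> carrier R. \<forall>x\<in>H. w \<odot> x = \<zero>} R"
proof -
  let ?J = "{w \<in> carrier R. \<forall>x\<in>H. w \<odot> x = \<zero>}"
  have Hc: "x \<in> carrier M" if "x \<in> H" for x
    using H that mpart_closed by blast
  \<comment> \<open>For homogeneous \<open>x\<close> the terms \<open>u x\<close> and
    \<open>v x\<close> have different parities, so if their sum vanishes, both do.\<close>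
  have parts: "u \<in> ?J" "v \<in> ?J"
    if w: "u \<oplus>\<^bsub>R\<^esub> v \<in> ?J" "u \<in> rpart R 0" "v \<in> rpart R 1" for u v
  proof -
    have c: "u \<in> carrier R" "v \<in> carrier R" using w R.part_closed by auto
    have "u \<odot> x = \<zero> \<and> v \<odot> x = \<zero>" if x: "x \<in> H" for x
    proof -
      obtain i where i: "x \<in> mpart M i" using x H by blast
      have "u \<odot> x \<in> mpart M i"
        using mpart_smult[OF w(2) i] by (metis add_0)
      moreover have "v \<odot> x \<in> mpart M (i + 1)"
        using mpart_smult[OF w(3) i] by (metis add.commute)
      moreover have "u \<odot> x \<oplus> v \<odot> x = \<zero>"
        using w(1) x c smult_l_distr Hc by auto
      ultimately show ?thesis using mpart_zero_sum by blast
    qed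
    then show "u \<in> ?J" "v \<in> ?J" using c by auto
  qed
  have "ideal ?J R"
  proof (rule idealI)
    show "subgroup ?J (add_monoid R)"
    proof (rule group.subgroupI[OF R.a_group])
      have "\<zero>\<^bsub>R\<^esub> \<in> ?J" using Hc smult_l_zero by simp
      then show "?J \<noteq> {}" by blast
    qed (use Hc smult_l_minus smult_l_distr in \<open>auto simp flip: a_inv_def\<close>)
    fix a r assume a: "a \<in> ?J" and r: "r \<in> carrier R"
    show "r \<otimes>\<^bsub>R\<^esub> a \<in> ?J"
      using a r Hc smult_r_zero by (simp add: smult_assoc)
    obtain u v where uv: "u \<in> rpart R 0" "v \<in> rpart R 1" "r = u \<oplus>\<^bsub>R\<^esub> v"
      using R.part_decompose[OF r] .
    have uv': "u \<in> R.homogeneous" "v \<in> R.homogeneous"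
      using uv by (auto simp: R.homogeneous_def)
    have "(a \<otimes>\<^bsub>R\<^esub> r) \<odot> x = \<zero>" if x: "x \<in> H" for x
    proof -
      have "(a \<otimes>\<^bsub>R\<^esub> r) \<odot> x = a \<odot> (u \<odot> x) \<oplus> a \<odot> (v \<odot> x)"
        using a r uv R.part_closed Hc[OF x]
        by (simp add: smult_assoc smult_l_distr smult_r_distr smult_closed)
      also have "\<dots> = \<zero>"
        using a closed[OF uv'(1) x] closed[OF uv'(2) x] by simp
      finally show ?thesis .
    qed
    then show "a \<otimes>\<^bsub>R\<^esub> r \<in> ?J" using a r by simp
  qed (rule R.ring_axioms)
  moreover have "?J = (?J \<inter> rpart R 0) <+>\<^bsub>R\<^esub> (?J \<inter> rpart R 1)" (is "_ = ?K")
  proof (intro equalityI subsetI)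
    fix w assume w: "w \<in> ?J"
    then have "w \<in> carrier R" by simp
    then obtain u v where uv: "u \<in> rpart R 0" "v \<in> rpart R 1" "w = u \<oplus>\<^bsub>R\<^esub> v"
      by (rule R.part_decompose)
    have "u \<in> ?J \<inter> rpart R 0" "v \<in> ?J \<inter> rpart R 1"
      using parts[of u v] w uv by simp_all
    then show "w \<in> ?K"
      unfolding set_add_def' uv(3) by blast
  next
    fix w assume "w \<in> ?K"
    then have "\<exists>u\<in>?J \<inter> rpart R 0. \<exists>v\<in>?J \<inter> rpart R 1. w = u \<oplus>\<^bsub>R\<^esub> v"
      unfolding set_add_def' by simp
    then obtain u v where uv: "u \<in> ?J" "v \<in> ?J" and w: "w = u \<oplus>\<^bsub>R\<^esub> v"
      by (elim bexE IntE)
    show "w \<in> ?J"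
      unfolding w using \<open>ideal ?J R\<close>[THEN ideal.axioms(1)] uv by (rule additive_subgroup.a_closed)
  qed
  ultimately show ?thesis by (simp add: superideal_def)
qed

abbreviation odd_filtration :: "nat \<Rightarrow> 'b set" where
  "odd_filtration n \<equiv> ideal_smult M (R.odd_pow n)"

lemma odd_filtration_closed: "x \<in> odd_filtration n \<Longrightarrow> x \<in> carrier M"
  by (induction rule: ideal_smult.induct) (auto intro: smult_closed R.odd_pow_closed)

lemma odd_filtration_zero: "odd_filtration 0 = carrier M"
proof (intro equalityI subsetI)
  fix x assume "x \<in> carrier M"
  then show "x \<in> odd_filtration 0"
    using ideal_smult.smult[of "\<one>\<^bsub>R\<^esub>" "R.odd_pow 0" x M] smult_one by simp
qed (rule odd_filtration_closed)

lemma odd_filtration_additive_subgroup: "additive_subgroup (odd_filtration n) M"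
proof (rule additive_subgroupI, rule group.subgroupI[OF M.a_group])
  show "odd_filtration n \<subseteq> carrier (add_monoid M)"
    using odd_filtration_closed by auto
  have "\<zero>\<^bsub>R\<^esub> \<odot> \<zero> \<in> odd_filtration n"
    using additive_subgroup.zero_closed[OF R.odd_pow_additive_subgroup]
    by (intro ideal_smult.smult) auto
  then show "odd_filtration n \<noteq> {}" by blast
next
  fix x assume "x \<in> odd_filtration n"
  then have "\<ominus> x \<in> odd_filtration n"
  proof (induction rule: ideal_smult.induct)
    case (smult a x)
    then have "(\<ominus>\<^bsub>R\<^esub> a) \<odot> x \<in> odd_filtration n"
      using additive_subgroup.a_inv_closed[OF R.odd_pow_additive_subgroup]
      by (intro ideal_smult.smult) auto
    then show ?case using smult smult_l_minus R.odd_pow_closed by simp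
  next
    case (sum x y)
    then have "\<ominus> (x \<oplus> y) = \<ominus> x \<oplus> \<ominus> y"
      using odd_filtration_closed by (intro M.minus_add) auto
    then show ?case using sum by (auto intro: ideal_smult.sum)
  qed
  then show "inv\<^bsub>add_monoid M\<^esub> x \<in> odd_filtration n" by (simp add: a_inv_def)
qed (simp add: ideal_smult.sum)

lemma odd_filtration_dec: "odd_filtration (Suc n) \<subseteq> odd_filtration n"
proof
  fix x assume "x \<in> odd_filtration (Suc n)"
  then show "x \<in> odd_filtration n"
  proof (induction rule: ideal_smult.induct)
    case (smult a x)
    then show ?case using R.odd_pow_dec by (intro ideal_smult.smult) auto
  qed (rule ideal_smult.sum)
qed

lemma odd_filtration_smult:
  assumes a: "a \<in> R.odd_pow i" and x: "x \<in> odd_filtration j"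
  shows "a \<odot> x \<in> odd_filtration (i + j)"
  using x
proof (induction rule: ideal_smult.induct)
  case (smult b x)
  then have "(a \<otimes>\<^bsub>R\<^esub> b) \<odot> x \<in> odd_filtration (i + j)"
    using a by (intro ideal_smult.smult R.odd_pow_mult)
  then show ?case using smult a R.odd_pow_closed smult_assoc by simp
next
  case (sum x y)
  then show ?case
    using a R.odd_pow_closed smult_r_distr odd_filtration_closed by (simp add: ideal_smult.sum)
qed

text \<open>An even \<open>a\<close> is central, so it passes the coefficient \<open>r\<close> in
  the generators of \<open>I^l\<close> and acts directly on the product of odd elements.\<close>

lemma even_kills_odd_filtration:
  assumes a: "a \<in> rpart R 0"
    and kill: "\<And>zs x. \<lbrakk>set zs \<subseteq> rpart R 1; length zs = l; x \<in> carrier M\<rbrakk> \<Longrightarrow> a \<odot> (R.odd_prod zs \<odot> x) = \<zero>"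
    and u: "u \<in> odd_filtration l"
  shows "a \<odot> u = \<zero>"
proof -
  have ac: "a \<in> carrier R" using a R.part_closed by blast
  have "\<forall>x\<in>carrier M. a \<odot> (e \<odot> x) = \<zero>" if e: "e \<in> R.odd_pow l" for e
    using e
  proof (induction rule: R.odd_pow_induct)
    case (prod r zs)
    have oc: "R.odd_prod zs \<in> carrier R" using prod R.odd_prod_closed by blast
    show ?case
    proof
      fix x assume x: "x \<in> carrier M"
      have "a \<odot> ((r \<otimes>\<^bsub>R\<^esub> R.odd_prod zs) \<odot> x) = (a \<otimes>\<^bsub>R\<^esub> r) \<odot> (R.odd_prod zs \<odot> x)"
        using ac oc prod(1) x by (simp add: smult_assoc smult_closed)
      also have "a \<otimes>\<^bsub>R\<^esub> r = r \<otimes>\<^bsub>R\<^esub> a"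
        using R.even_central[OF a prod(1)] .
      also have "(r \<otimes>\<^bsub>R\<^esub> a) \<odot> (R.odd_prod zs \<odot> x) = \<zero>"
        using ac oc prod x kill smult_r_zero by (simp add: smult_assoc smult_closed)
      finally show "a \<odot> ((r \<otimes>\<^bsub>R\<^esub> R.odd_prod zs) \<odot> x) = \<zero>" .
    qed
  next
    case (sum x y)
    then show ?case
      using ac by (simp add: smult_l_distr smult_r_distr smult_closed)
  qed
  note * = this
  show ?thesis using u
  proof (induction rule: ideal_smult.induct)
    case (smult b x)
    then show ?case using * by blast
  next
    case (sum x y)
    then show ?case using ac odd_filtration_closed by (simp add: smult_r_distr)
  qed
qed

end

text \<open>\<open>R\<close> as a supermodule over itself, so that
  \<open>annihilator_superideal\<close> also yields annihilators inside \<open>R\<close>.\<close>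

definition regular_module :: "('a, 'c) superring_scheme \<Rightarrow> ('a, 'a) supermodule" where
  "regular_module R = \<lparr>carrier = carrier R, monoid.mult = monoid.mult R, one = one R, zero = zero R, add = add R,
     smult = monoid.mult R, mpart = rpart R\<rparr>"

lemma (in superring) regular_supermodule: "supermodule R (regular_module R)"
proof -
  have sub: "subgroup X (add_monoid (regular_module R)) \<longleftrightarrow> subgroup X (add_monoid R)" for X
    by (simp add: subgroup_def m_inv_def regular_module_def)
  have sum: "X <+>\<^bsub>regular_module R\<^esub> Y = X <+> Y" for X Y
    by (simp add: set_add_def' regular_module_def)
  have "abelian_group (regular_module R)"
    by (rule abelian_groupI) (auto simp: regular_module_def a_ac intro: l_neg)
  then show ?thesis
    using part_subgroup part_disjoint part_mult
    by (intro supermodule.intro supermodule_axioms.intro superring_axioms; (simp only: sub sum)?)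
      (simp_all add: regular_module_def l_distr r_distr m_assoc part_sum[symmetric])
qed

section \<open>Nilpotence of the odd ideal and uniform annihilators\<close>

context noetherian_superring
begin

text \<open>The annihilators of \<open>R\<^sub>1\<^sup>n\<close> stabilise at some \<open>J\<close>. If \<open>J\<close> were proper, choose a homogeneous
  \<open>x \<notin> J\<close> for which the ideal \<open>(J : Rx)\<close> is maximal. Stability gives an odd \<open>y\<close> with \<open>yx \<notin> J\<close>;
  by maximality \<open>(J : Ryx) = (J : Rx)\<close>, and this ideal contains \<open>y\<close> since \<open>y\<^sup>2 = 0\<close>, so \<open>yx \<in> J\<close>.\<close>

lemma odd_prod_nilpotent:
  "\<exists>N. \<forall>zs. set zs \<subseteq> rpart R 1 \<and> length zs = N \<longrightarrow> odd_prod zs = \<zero>"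
proof -
  interpret reg: supermodule R "regular_module R" by (rule regular_supermodule)
  have ann: "superideal {w \<in> carrier R. \<forall>x\<in>H. w \<otimes> x = \<zero>} R"
    if "H \<subseteq> homogeneous" "\<And>r x. \<lbrakk>r \<in> homogeneous; x \<in> H\<rbrakk> \<Longrightarrow> r \<otimes> x \<in> H" for H
    using reg.annihilator_superideal[of H] that by (simp add: regular_module_def homogeneous_def)
  have one_hom: "\<one> \<in> homogeneous" using one_even by (simp add: homogeneous_def)
  have odd_hom: "z \<in> homogeneous" if "z \<in> rpart R 1" for z
    using that by (simp add: homogeneous_def)
  \<comment> \<open>Homogeneous generators of the ideal spanned by products of \<open>n\<close> odd
    elements. The factor \<open>r\<close> makes the set stable under homogeneous scalars, as
    \<open>ann\<close> requires.\<close>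
  define H where "H n = {r \<otimes> odd_prod zs | r zs. r \<in> homogeneous \<and> set zs \<subseteq> rpart R 1 \<and> length zs = n}" for n
  have HI: "r \<otimes> odd_prod zs \<in> H n"
    if "r \<in> homogeneous" "set zs \<subseteq> rpart R 1" "length zs = n" for r zs n
    unfolding H_def using that by blast
  have Hhom: "H n \<subseteq> homogeneous" for n
    using homogeneous_mult odd_prod_homogeneous by (auto simp: H_def)
  have Hmult: "r \<otimes> x \<in> H n" if r: "r \<in> homogeneous" and x: "x \<in> H n" for r x n
  proof -
    obtain s zs where s: "s \<in> homogeneous" "set zs \<subseteq> rpart R 1" "length zs = n" "x = s \<otimes> odd_prod zs"
      using x by (auto simp: H_def)
    have "r \<otimes> x = (r \<otimes> s) \<otimes> odd_prod zs"
      using s r homogeneous_closed odd_prod_closed by (simp add: m_assoc)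
    then show ?thesis using HI[OF homogeneous_mult[OF r s(1)] s(2,3)] by simp
  qed
  have HSuc: "H (Suc n) \<subseteq> H n" for n
  proof
    fix x assume "x \<in> H (Suc n)"
    then obtain s z zs where s: "s \<in> homogeneous" "z \<in> rpart R 1" "set zs \<subseteq> rpart R 1" "length zs = n"
      "x = s \<otimes> (z \<otimes> odd_prod zs)"
      by (auto simp: H_def length_Suc_conv)
    then have "x = (s \<otimes> z) \<otimes> odd_prod zs"
      using homogeneous_closed part_closed odd_prod_closed by (simp add: m_assoc)
    then show "x \<in> H n" using HI[OF homogeneous_mult[OF s(1) odd_hom[OF s(2)]] s(3,4)] by simp
  qed
  define J where "J n = {w \<in> carrier R. \<forall>x\<in>H n. w \<otimes> x = \<zero>}" for n
  have Jsuper: "superideal (J n) R" for n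
    unfolding J_def using Hhom Hmult by (intro ann)
  have "J n \<subseteq> J (Suc n)" for n
    using HSuc[of n] by (auto simp: J_def)
  then obtain N where N: "\<forall>n\<ge>N. J n = J N"
    using acc[of J] Jsuper by blast
  have "\<one> \<in> J N"
  proof (rule ccontr)
    assume one: "\<one> \<notin> J N"
    define X where "X = {x \<in> homogeneous. x \<notin> J N}"
    define K where "K x = {(r \<otimes> x) \<otimes> h | r h. r \<in> homogeneous \<and> h \<in> H N}" for x
    have KI: "(r \<otimes> x) \<otimes> h \<in> K x" if "r \<in> homogeneous" "h \<in> H N" for r h x
      unfolding K_def using that by blast
    \<comment> \<open>Killing all \<open>r x h\<close> with \<open>h\<close> in \<open>H N\<close>
      means that \<open>w R x\<close> lies in \<open>J N\<close>, so this is the ideal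
      \<open>(J : Rx)\<close>.\<close>
    define Q where "Q x = {w \<in> carrier R. \<forall>k\<in>K x. w \<otimes> k = \<zero>}" for x
    have Qsuper: "superideal (Q x) R" if x: "x \<in> X" for x
      unfolding Q_def
    proof (rule ann)
      show "K x \<subseteq> homogeneous"
        using x by (auto simp: K_def X_def intro!: homogeneous_mult intro: subsetD[OF Hhom])
      fix r k assume r: "r \<in> homogeneous" and "k \<in> K x"
      then obtain s h where s: "s \<in> homogeneous" "h \<in> H N" "k = (s \<otimes> x) \<otimes> h"
        by (auto simp: K_def)
      then have "r \<otimes> k = ((r \<otimes> s) \<otimes> x) \<otimes> h"
        using r x Hhom homogeneous_closed by (simp add: m_assoc X_def subset_iff)
      then show "r \<otimes> k \<in> K x"
        using KI[OF homogeneous_mult[OF r s(1)] s(2)] by simp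
    qed
    have "\<exists>A\<in>Q ` X. \<forall>B\<in>Q ` X. A \<subseteq> B \<longrightarrow> B = A"
    proof (rule superideal_maximal)
      show "Q ` X \<noteq> {}" using one one_hom by (auto simp: X_def)
    qed (use Qsuper in auto)
    then obtain x where x: "x \<in> X" and max: "\<And>y. y \<in> X \<Longrightarrow> Q x \<subseteq> Q y \<Longrightarrow> Q y = Q x"
      by auto
    have xh: "x \<in> homogeneous" "x \<in> carrier R"
      using x homogeneous_closed by (auto simp: X_def)
    \<comment> \<open>Otherwise \<open>x\<close> kills \<open>H (Suc N)\<close>: in
      \<open>x s z\<close> the factor \<open>s z\<close> moves to the front up to sign, leaving
      \<open>z x\<close> in \<open>J N\<close> against a product of \<open>N\<close> odd elements.
      Then \<open>x\<close> lies in \<open>J (Suc N) = J N\<close>.\<close>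
    have "\<exists>y\<in>rpart R 1. y \<otimes> x \<notin> J N"
    proof (rule ccontr)
      assume "\<not> ?thesis"
      then have all: "\<And>y. y \<in> rpart R 1 \<Longrightarrow> y \<otimes> x \<in> J N" by blast
      have "x \<otimes> h = \<zero>" if "h \<in> H (Suc N)" for h
      proof -
        obtain s z zs where s: "s \<in> homogeneous" "z \<in> rpart R 1" "set zs \<subseteq> rpart R 1" "length zs = N"
          "h = s \<otimes> (z \<otimes> odd_prod zs)"
          using \<open>h \<in> H (Suc N)\<close> by (auto simp: H_def length_Suc_conv)
        have c: "s \<in> carrier R" "z \<in> carrier R" "odd_prod zs \<in> carrier R"
          using s homogeneous_closed part_closed odd_prod_closed by auto
        have "\<one> \<otimes> odd_prod zs \<in> H N" using HI[OF one_hom s(3,4)] .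
        then have "(z \<otimes> x) \<otimes> (\<one> \<otimes> odd_prod zs) = \<zero>"
          using all[OF s(2)] unfolding J_def by blast
        then have z: "((s \<otimes> z) \<otimes> x) \<otimes> odd_prod zs = \<zero>"
          using c xh by (simp add: m_assoc)
        have "x \<otimes> h = (x \<otimes> (s \<otimes> z)) \<otimes> odd_prod zs"
          using c xh s(5) by (simp add: m_assoc)
        moreover have "x \<otimes> (s \<otimes> z) = (s \<otimes> z) \<otimes> x \<or> x \<otimes> (s \<otimes> z) = \<ominus> ((s \<otimes> z) \<otimes> x)"
          using xh(1) s odd_hom by (intro homogeneous_commute homogeneous_mult)
        ultimately show ?thesis
          using z c xh by (auto simp: l_minus)
      qed
      then have "x \<in> J (Suc N)" using xh by (simp add: J_def)
      moreover have "J (Suc N) = J N" using N[rule_format, of "Suc N"] by linarith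
      ultimately show False using x unfolding X_def by simp
    qed
    then obtain y where y: "y \<in> rpart R 1" "y \<otimes> x \<notin> J N" by (elim bexE)
    have yc: "y \<in> carrier R" "y \<in> homogeneous"
      using y part_closed odd_hom by auto
    have yx: "y \<otimes> x \<in> X"
      using y yc xh homogeneous_mult by (simp add: X_def)
    have "Q x \<subseteq> Q (y \<otimes> x)"
    proof -
      have "K (y \<otimes> x) \<subseteq> K x"
      proof
        fix k assume "k \<in> K (y \<otimes> x)"
        then obtain s h where s: "s \<in> homogeneous" "h \<in> H N" "k = (s \<otimes> (y \<otimes> x)) \<otimes> h"
          by (auto simp: K_def)
        then have "k = ((s \<otimes> y) \<otimes> x) \<otimes> h"
          using xh yc homogeneous_closed by (simp add: m_assoc)
        then show "k \<in> K x"
          using KI[OF homogeneous_mult[OF s(1) yc(2)] s(2)] by simp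
      qed
      then show ?thesis by (auto simp: Q_def)
    qed
    then have "Q (y \<otimes> x) = Q x" using max yx by blast
    \<comment> \<open>In \<open>y s y x h\<close> the homogeneous \<open>s\<close> commutes with
      \<open>y\<close> up to sign, which brings out the factor \<open>y y = 0\<close>.\<close>
    moreover have "y \<in> Q (y \<otimes> x)"
    proof -
      have "y \<otimes> k = \<zero>" if k: "k \<in> K (y \<otimes> x)" for k
      proof -
        obtain s h where s: "s \<in> homogeneous" "h \<in> H N" "k = (s \<otimes> (y \<otimes> x)) \<otimes> h"
          using k by (auto simp: K_def)
        have c: "s \<in> carrier R" "h \<in> carrier R"
          using s Hhom homogeneous_closed by auto
        have "y \<otimes> k = (y \<otimes> s) \<otimes> (y \<otimes> (x \<otimes> h))"
          using c yc xh s(3) by (simp add: m_assoc)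
        moreover have "y \<otimes> s = s \<otimes> y \<or> y \<otimes> s = \<ominus> (s \<otimes> y)"
          using yc(2) s(1) by (rule homogeneous_commute)
        moreover have "(s \<otimes> y) \<otimes> (y \<otimes> (x \<otimes> h)) = s \<otimes> ((y \<otimes> y) \<otimes> (x \<otimes> h))"
          using c yc xh by (simp add: m_assoc)
        ultimately show ?thesis
          using c yc xh odd_square[OF y(1)] by (auto simp: l_minus)
      qed
      then show ?thesis using yc by (simp add: Q_def)
    qed
    ultimately have yQ: "y \<in> Q x" by simp
    have "(y \<otimes> x) \<otimes> h = \<zero>" if h: "h \<in> H N" for h
    proof -
      have hc: "h \<in> carrier R" using h Hhom homogeneous_closed by auto
      have "(\<one> \<otimes> x) \<otimes> h \<in> K x" using KI[OF one_hom h] .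
      then have "y \<otimes> ((\<one> \<otimes> x) \<otimes> h) = \<zero>" using yQ by (simp add: Q_def)
      then show ?thesis using hc xh yc by (simp add: m_assoc)
    qed
    then have "y \<otimes> x \<in> J N" using yc xh by (simp add: J_def)
    then show False using y by simp
  qed
  have "odd_prod zs = \<zero>" if zs: "set zs \<subseteq> rpart R 1" "length zs = N" for zs
  proof -
    have "\<one> \<otimes> odd_prod zs \<in> H N" using HI[OF one_hom zs] .
    then have "\<one> \<otimes> (\<one> \<otimes> odd_prod zs) = \<zero>"
      using \<open>\<one> \<in> J N\<close> by (simp add: J_def)
    then show ?thesis using odd_prod_closed[OF zs(1)] by simp
  qed
  then show ?thesis by blast
qed

text \<open>All spanning elements of \<open>I^N\<close> vanish, and the powers decrease.\<close>

lemma odd_pow_nilpotent: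
  obtains N where "\<And>n. n \<ge> N \<Longrightarrow> odd_pow n = {\<zero>}"
proof -
  obtain N where N: "\<forall>zs. set zs \<subseteq> rpart R 1 \<and> length zs = N \<longrightarrow> odd_prod zs = \<zero>"
    using odd_prod_nilpotent ..
  have "e = \<zero>" if "e \<in> odd_pow N" for e
    using that by (induction rule: odd_pow_induct) (simp_all add: N)
  then have "odd_pow n \<subseteq> {\<zero>}" if "n \<ge> N" for n
    using lift_Suc_antimono_le[of odd_pow, OF odd_pow_dec that] by blast
  then have "odd_pow n = {\<zero>}" if "n \<ge> N" for n
    using that additive_subgroup.zero_closed[OF odd_pow_additive_subgroup] by blast
  then show ?thesis using that by blast
qed

text \<open>For \<open>a \<notin> p\<close> the superideals \<open>{w. w a M = 0}\<close> form a directed family, which by the ascending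
  chain condition has a largest member.\<close>

lemma uniform_annihilator:
  assumes "supermodule R M" and p: "primeideal p (even_ring R)"
    and ex: "\<And>zs. \<lbrakk>set zs \<subseteq> rpart R 1; length zs = l\<rbrakk> \<Longrightarrow>
      \<exists>a\<in>rpart R 0 - p. \<forall>x\<in>carrier M. a \<odot>\<^bsub>M\<^esub> (odd_prod zs \<odot>\<^bsub>M\<^esub> x) = \<zero>\<^bsub>M\<^esub>"
  obtains a where "a \<in> rpart R 0 - p"
    "\<And>u. u \<in> ideal_smult M (odd_pow l) \<Longrightarrow> a \<odot>\<^bsub>M\<^esub> u = \<zero>\<^bsub>M\<^esub>"
proof -
  interpret M: supermodule R M by fact
  interpret p: primeideal p "even_ring R" by fact
  \<comment> \<open>The homogeneous generators of \<open>a M\<close>, so that \<open>J a\<close> is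
    the superideal of all \<open>w\<close> with \<open>w a M = 0\<close>.\<close>
  define H where "H a = (\<lambda>x. a \<odot>\<^bsub>M\<^esub> x) ` (mpart M 0 \<union> mpart M 1)" for a
  define J where "J a = {w \<in> carrier R. \<forall>x\<in>H a. w \<odot>\<^bsub>M\<^esub> x = \<zero>\<^bsub>M\<^esub>}" for a
  have hom: "r \<odot>\<^bsub>M\<^esub> x \<in> mpart M 0 \<union> mpart M 1"
    if r: "r \<in> homogeneous" and x: "x \<in> mpart M 0 \<union> mpart M 1" for r x
  proof -
    obtain i j where "r \<in> rpart R i" "x \<in> mpart M j"
      using r x homogeneous_iff by auto
    then have "r \<odot>\<^bsub>M\<^esub> x \<in> mpart M (i + j)" by (rule M.mpart_smult)
    then show ?thesis by (cases "i + j") auto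
  qed
  have swap: "a \<odot>\<^bsub>M\<^esub> (w \<odot>\<^bsub>M\<^esub> x) = w \<odot>\<^bsub>M\<^esub> (a \<odot>\<^bsub>M\<^esub> x)"
    if "a \<in> rpart R 0" "w \<in> carrier R" "x \<in> carrier M" for a w x
    using that even_central part_closed by (metis M.smult_assoc)
  have super: "superideal (J a) R" if a: "a \<in> rpart R 0" for a
    unfolding J_def
  proof (rule M.annihilator_superideal)
    have ah: "a \<in> homogeneous" using a by (simp add: homogeneous_def)
    show "H a \<subseteq> mpart M 0 \<union> mpart M 1"
      unfolding H_def using hom[OF ah] by blast
    fix r x assume r: "r \<in> homogeneous" and "x \<in> H a"
    then obtain y where y: "y \<in> mpart M 0 \<union> mpart M 1" "x = a \<odot>\<^bsub>M\<^esub> y"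
      by (auto simp: H_def)
    have "r \<odot>\<^bsub>M\<^esub> x = a \<odot>\<^bsub>M\<^esub> (r \<odot>\<^bsub>M\<^esub> y)"
      using y swap[OF a homogeneous_closed[OF r]] M.mpart_closed by auto
    then show "r \<odot>\<^bsub>M\<^esub> x \<in> H a"
      unfolding H_def using hom[OF r y(1)] by blast
  qed
  have "\<exists>A\<in>J ` (rpart R 0 - p). \<forall>B\<in>J ` (rpart R 0 - p). A \<subseteq> B \<longrightarrow> B = A"
  proof (rule superideal_maximal)
    show "J ` (rpart R 0 - p) \<noteq> {}"
      using p.I_notcarr p.a_subset by auto
  qed (use super in auto)
  then obtain a where a: "a \<in> rpart R 0 - p"
    and max: "\<And>b. b \<in> rpart R 0 - p \<Longrightarrow> J a \<subseteq> J b \<Longrightarrow> J b = J a"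
    by auto
  have ac: "a \<in> carrier R" using a part_closed by auto
  have kill: "a \<odot>\<^bsub>M\<^esub> (odd_prod zs \<odot>\<^bsub>M\<^esub> x) = \<zero>\<^bsub>M\<^esub>"
    if zs: "set zs \<subseteq> rpart R 1" "length zs = l" and x: "x \<in> carrier M" for zs x
  proof -
    let ?w = "odd_prod zs"
    have wc: "?w \<in> carrier R" using zs odd_prod_closed by blast
    obtain b where b: "b \<in> rpart R 0 - p"
      and bz: "\<And>x. x \<in> carrier M \<Longrightarrow> b \<odot>\<^bsub>M\<^esub> (?w \<odot>\<^bsub>M\<^esub> x) = \<zero>\<^bsub>M\<^esub>"
      using ex[OF zs] by blast
    have bc: "b \<in> carrier R" "b \<in> homogeneous" using b part_closed by (auto simp: homogeneous_def)
    \<comment> \<open>Primality keeps the product outside \<open>p\<close>, so it competes with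
      \<open>a\<close>; since \<open>J\<close> only grows from \<open>a\<close> to
      \<open>a b\<close>, maximality forces equality.\<close>
    have ab: "a \<otimes> b \<in> rpart R 0 - p"
      using p.I_prime[of a b] a b part_mult[of a 0 b 0] by auto
    have "H (a \<otimes> b) \<subseteq> H a"
    proof
      fix x assume "x \<in> H (a \<otimes> b)"
      then obtain y where y: "y \<in> mpart M 0 \<union> mpart M 1" "x = (a \<otimes> b) \<odot>\<^bsub>M\<^esub> y"
        by (auto simp: H_def)
      then have "x = a \<odot>\<^bsub>M\<^esub> (b \<odot>\<^bsub>M\<^esub> y)"
        using ac bc M.mpart_closed M.smult_assoc by auto
      then show "x \<in> H a"
        unfolding H_def using hom[OF bc(2) y(1)] by blast
    qed
    then have "J a \<subseteq> J (a \<otimes> b)" by (auto simp: J_def)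
    then have "J (a \<otimes> b) = J a" using max ab by blast
    \<comment> \<open>As \<open>a b\<close> is central, \<open>w a b y = a b w y\<close>, which
      vanishes because \<open>b\<close> kills \<open>w M\<close>. Hence \<open>w\<close> already
      lies in \<open>J a\<close>, for the fixed \<open>a\<close>.\<close>
    moreover have "?w \<in> J (a \<otimes> b)"
    proof -
      have "?w \<odot>\<^bsub>M\<^esub> ((a \<otimes> b) \<odot>\<^bsub>M\<^esub> y) = \<zero>\<^bsub>M\<^esub>" if y: "y \<in> mpart M 0 \<union> mpart M 1" for y
      proof -
        have yc: "y \<in> carrier M" using y M.mpart_closed by blast
        have "?w \<odot>\<^bsub>M\<^esub> ((a \<otimes> b) \<odot>\<^bsub>M\<^esub> y) = (a \<otimes> b) \<odot>\<^bsub>M\<^esub> (?w \<odot>\<^bsub>M\<^esub> y)"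
          using swap[of "a \<otimes> b" ?w y] ab wc yc by simp
        also have "\<dots> = \<zero>\<^bsub>M\<^esub>"
          using bz[OF yc] ac bc wc yc by (simp add: M.smult_assoc M.smult_closed M.smult_r_zero)
        finally show ?thesis .
      qed
      then show ?thesis using wc by (auto simp: J_def H_def)
    qed
    ultimately have "?w \<in> J a" by simp
    then have hz: "?w \<odot>\<^bsub>M\<^esub> (a \<odot>\<^bsub>M\<^esub> y) = \<zero>\<^bsub>M\<^esub>" if "y \<in> mpart M 0 \<union> mpart M 1" for y
      using that by (auto simp: J_def H_def)
    obtain y z where yz: "y \<in> mpart M 0" "z \<in> mpart M 1" "x = y \<oplus>\<^bsub>M\<^esub> z"
      using M.mpart_decompose[OF x] .
    have c: "y \<in> carrier M" "z \<in> carrier M" using yz M.mpart_closed by auto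
    have "?w \<odot>\<^bsub>M\<^esub> (a \<odot>\<^bsub>M\<^esub> x) = \<zero>\<^bsub>M\<^esub>"
      using hz[of y] hz[of z] yz c ac wc by (simp add: M.smult_r_distr M.smult_closed)
    then show ?thesis using swap[of a ?w x] a wc x by simp
  qed
  have "a \<odot>\<^bsub>M\<^esub> u = \<zero>\<^bsub>M\<^esub>" if "u \<in> ideal_smult M (odd_pow l)" for u
    by (rule M.even_kills_odd_filtration[OF _ kill that]) (use a in auto)
  then show ?thesis using that a by blast
qed

end

section \<open>Super-dimension of the associated graded module\<close>

declare ideal_pow.simps(2) [simp del]

section \<open>The associated graded super-ring\<close>

context noetherian_superring
begin

text \<open>Nilpotence of the odd ideal supplies the finiteness of the filtration.\<close>

sublocale self: filtered_action R odd_pow R odd_pow "(\<otimes>)"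
proof -
  have "\<exists>N. \<forall>n\<ge>N. odd_pow n = {\<zero>}"
    using odd_pow_nilpotent by metis
  then interpret filtered_group R odd_pow
    by (intro filtered_group.intro filtered_group_axioms.intro abelian_group_axioms
        odd_pow_additive_subgroup odd_pow_dec)
  show "filtered_action R odd_pow R odd_pow (\<otimes>)"
    by unfold_locales (simp_all add: odd_pow_mult l_distr r_distr m_assoc)
qed

abbreviation gr :: "(nat \<Rightarrow> 'a set) superring" where
  "gr \<equiv> gr_ring R (odd_ideal R)"

abbreviation cls :: "(nat \<Rightarrow> 'a) \<Rightarrow> nat \<Rightarrow> 'a set" where
  "cls \<equiv> gr_class R odd_pow"

abbreviation degree_class :: "nat \<Rightarrow> 'a \<Rightarrow> nat \<Rightarrow> 'a set" where
  "degree_class k a \<equiv> cls (delta R k a)"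

lemma gr_carrier: "carrier gr = cls ` {r. \<forall>n. r n \<in> odd_pow n}"
proof -
  have "{r. \<forall>n. r n \<in> odd_pow n \<inter> carrier R} = {r. \<forall>n. r n \<in> odd_pow n}"
    using odd_pow_closed by blast
  then show ?thesis
    using self.E.gr_part_eq[of "carrier R"] by (simp add: gr_ring_def Let_def)
qed

lemma gr_rpart: "rpart gr i = cls ` {r. \<forall>n. r n \<in> odd_pow n \<inter> rpart R i}"
  using self.E.gr_part_eq[of "rpart R i"] by (simp add: gr_ring_def Let_def)

lemma gr_carrierI: "\<forall>n. r n \<in> odd_pow n \<Longrightarrow> cls r \<in> carrier gr"
  unfolding gr_carrier by blast

lemma gr_rpartI: "\<forall>n. r n \<in> odd_pow n \<inter> rpart R i \<Longrightarrow> cls r \<in> rpart gr i"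
  unfolding gr_rpart by blast

lemma gr_carrierE:
  assumes "f \<in> carrier gr"
  obtains r where "\<forall>n. r n \<in> odd_pow n" "f = cls r"
  using assms unfolding gr_carrier by (elim imageE) simp

lemma gr_rpartE:
  assumes "f \<in> rpart gr i"
  obtains r where "\<forall>n. r n \<in> odd_pow n \<inter> rpart R i" "f = cls r"
  using assms unfolding gr_rpart by (elim imageE) simp

lemma gr_times:
  assumes "\<forall>n. r n \<in> odd_pow n" "\<forall>n. s n \<in> odd_pow n"
  shows "cls r \<otimes>\<^bsub>gr\<^esub> cls s = cls (conv R (\<otimes>) r s)"
  using self.gr_mult_class[OF assms] by (simp add: gr_ring_def Let_def)

lemma gr_plus:
  assumes "\<forall>n. r n \<in> odd_pow n" "\<forall>n. s n \<in> odd_pow n"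
  shows "cls r \<oplus>\<^bsub>gr\<^esub> cls s = cls (\<lambda>n. r n \<oplus> s n)"
  using self.E.gr_class_add[OF assms] by (simp add: gr_ring_def Let_def)

lemma gr_zero: "\<zero>\<^bsub>gr\<^esub> = cls (\<lambda>n. \<zero>)"
  by (simp add: gr_ring_def Let_def self.E.gr_class_zero)

lemma gr_one: "\<one>\<^bsub>gr\<^esub> = degree_class 0 \<one>"
proof -
  have "odd_pow (Suc n) +> \<zero> = odd_pow (Suc n)" for n
    using odd_pow_closed by (intro a_coset_add_zero subsetI)
  then show ?thesis
    by (intro ext) (simp add: gr_ring_def Let_def gr_class_def delta_def)
qed

lemma degree_zero_mem: "a \<in> carrier R \<Longrightarrow> \<forall>n. delta R 0 a n \<in> odd_pow n"
  by (rule self.E.delta_closed) simp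

lemma even_gr_simps [simp]:
  "carrier (even_ring gr) = rpart gr 0" "monoid.mult (even_ring gr) = monoid.mult gr"
  "add (even_ring gr) = add gr" "\<one>\<^bsub>even_ring gr\<^esub> = \<one>\<^bsub>gr\<^esub>" "\<zero>\<^bsub>even_ring gr\<^esub> = \<zero>\<^bsub>gr\<^esub>"
  by (simp_all add: even_ring_def)

lemma gr_rpart_subset: "rpart gr i \<subseteq> carrier gr"
  unfolding gr_carrier gr_rpart by (intro image_mono) auto

lemma conv_even:
  assumes "\<forall>n. r n \<in> odd_pow n \<inter> rpart R 0" "\<forall>n. s n \<in> odd_pow n \<inter> rpart R 0"
  shows "\<forall>n. conv R (\<otimes>) r s n \<in> odd_pow n \<inter> rpart R 0"
proof
  fix n
  have "conv R (\<otimes>) r s n \<in> odd_pow n"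
    using self.conv_closed[of r s] assms by simp
  moreover have "conv R (\<otimes>) r s n \<in> rpart R 0"
    unfolding conv_def
  proof (rule finsum_mem_additive_subgroup[OF part_additive_subgroup])
    fix i
    show "r i \<otimes> s (n - i) \<in> rpart R 0"
      using part_mult[of "r i" 0 "s (n - i)" 0] assms by simp
  qed
  ultimately show "conv R (\<otimes>) r s n \<in> odd_pow n \<inter> rpart R 0" by simp
qed

text \<open>Reverse the summation index from \<open>i\<close> to \<open>n - i\<close> and use that
  even elements are central.\<close>

lemma conv_even_commute:
  assumes "\<forall>n. r n \<in> rpart R 0" "\<forall>n. s n \<in> rpart R 0"
  shows "conv R (\<otimes>) r s = conv R (\<otimes>) s r"
proof
  fix n :: nat
  have c: "r i \<in> carrier R" "s i \<in> carrier R" for i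
    using assms part_closed by auto
  have inj: "inj_on (\<lambda>i. n - i) {..n}" by (rule inj_onI) simp
  have img: "(\<lambda>i. n - i) ` {..n} = {..n}"
  proof (intro equalityI subsetI)
    fix i assume "i \<in> {..n}"
    then show "i \<in> (\<lambda>i. n - i) ` {..n}" by (intro image_eqI[of _ _ "n - i"]) auto
  qed auto
  have "conv R (\<otimes>) r s n = (\<Oplus>i\<in>(\<lambda>i. n - i) ` {..n}. r i \<otimes> s (n - i))"
    by (simp add: conv_def img)
  also have "\<dots> = (\<Oplus>i\<in>{..n}. r (n - i) \<otimes> s (n - (n - i)))"
    using c inj by (intro finsum_reindex) auto
  also have "\<dots> = (\<Oplus>i\<in>{..n}. s i \<otimes> r (n - i))"
    using c even_central assms by (intro finsum_cong') auto
  also have "\<dots> = conv R (\<otimes>) s r n"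
    by (simp add: conv_def)
  finally show "conv R (\<otimes>) r s n = conv R (\<otimes>) s r n" .
qed

lemma gr_one_even: "\<one>\<^bsub>gr\<^esub> \<in> rpart gr 0"
  unfolding gr_one
proof (rule gr_rpartI, intro allI IntI)
  fix n
  show "delta R 0 \<one> n \<in> odd_pow n" using degree_zero_mem by simp
  show "delta R 0 \<one> n \<in> rpart R 0"
    using one_even additive_subgroup.zero_closed[OF part_additive_subgroup] by (simp add: delta_def)
qed

lemma degree_class_times_class:
  assumes "a \<in> odd_pow k" "\<forall>n. s n \<in> odd_pow n"
  shows "degree_class k a \<otimes>\<^bsub>gr\<^esub> cls s = cls (\<lambda>n. if k \<le> n then a \<otimes> s (n - k) else \<zero>)"
  using gr_times[OF self.E.delta_closed[OF assms(1)] assms(2)] self.conv_delta[OF assms] by simp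

lemma degree_class_times:
  assumes "a \<in> odd_pow k" "b \<in> odd_pow l"
  shows "degree_class k a \<otimes>\<^bsub>gr\<^esub> degree_class l b = degree_class (k + l) (a \<otimes> b)"
proof -
  have "(\<lambda>n. if k \<le> n then a \<otimes> delta R l b (n - k) else \<zero>) = delta R (k + l) (a \<otimes> b)"
    using assms odd_pow_closed by (auto simp: delta_def fun_eq_iff)
  then show ?thesis
    using degree_class_times_class[OF assms(1) self.E.delta_closed[OF assms(2)]] by simp
qed

lemma even_gr_cring: "cring (even_ring gr)"
proof (rule cringI)
  show "abelian_group (even_ring gr)"
    by (rule self.E.gr_abelian_group[OF part_subgroup[of 0]])
      (simp_all add: gr_ring_def Let_def even_ring_def)
  show "comm_monoid (even_ring gr)"
  proof (rule comm_monoidI)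
    show "\<one>\<^bsub>even_ring gr\<^esub> \<in> carrier (even_ring gr)"
      using gr_one_even by simp
  next
    fix f assume "f \<in> carrier (even_ring gr)"
    then have "f \<in> rpart gr 0" by simp
    then obtain r where r: "\<forall>n. r n \<in> odd_pow n \<inter> rpart R 0" "f = cls r"
      by (rule gr_rpartE)
    then have "\<one>\<^bsub>gr\<^esub> \<otimes>\<^bsub>gr\<^esub> f = cls (\<lambda>n. \<one> \<otimes> r n)"
      unfolding gr_one using degree_class_times_class[of \<one> 0 r] by simp
    also have "(\<lambda>n. \<one> \<otimes> r n) = r"
      using r part_closed by (intro ext l_one) blast
    finally show "\<one>\<^bsub>even_ring gr\<^esub> \<otimes>\<^bsub>even_ring gr\<^esub> f = f"
      using r(2) by simp
    fix g assume "g \<in> carrier (even_ring gr)"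
    then have "g \<in> rpart gr 0" by simp
    then obtain s where s: "\<forall>n. s n \<in> odd_pow n \<inter> rpart R 0" "g = cls s"
      by (rule gr_rpartE)
    have fg: "f \<otimes>\<^bsub>gr\<^esub> g = cls (conv R (\<otimes>) r s)"
      unfolding r(2) s(2) using r(1) s(1) by (intro gr_times) auto
    have gf: "g \<otimes>\<^bsub>gr\<^esub> f = cls (conv R (\<otimes>) s r)"
      unfolding r(2) s(2) using r(1) s(1) by (intro gr_times) auto
    show "f \<otimes>\<^bsub>even_ring gr\<^esub> g \<in> carrier (even_ring gr)"
      using fg gr_rpartI[OF conv_even[OF r(1) s(1)]] by simp
    show "f \<otimes>\<^bsub>even_ring gr\<^esub> g = g \<otimes>\<^bsub>even_ring gr\<^esub> f"
      using fg gf conv_even_commute[of r s] r(1) s(1) by simp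
    fix h assume "h \<in> carrier (even_ring gr)"
    then have "h \<in> rpart gr 0" by simp
    then obtain t where t: "\<forall>n. t n \<in> odd_pow n \<inter> rpart R 0" "h = cls t"
      by (rule gr_rpartE)
    have gh: "g \<otimes>\<^bsub>gr\<^esub> h = cls (conv R (\<otimes>) s t)"
      unfolding t(2) s(2) using t(1) s(1) by (intro gr_times) auto
    have "f \<otimes>\<^bsub>gr\<^esub> g \<otimes>\<^bsub>gr\<^esub> h = cls (conv R (\<otimes>) (conv R (\<otimes>) r s) t)"
      unfolding fg t(2) using conv_even[OF r(1) s(1)] t(1) by (intro gr_times) auto
    also have "conv R (\<otimes>) (conv R (\<otimes>) r s) t = conv R (\<otimes>) r (conv R (\<otimes>) s t)"
      using r(1) s(1) t(1) by (intro self.conv_assoc) auto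
    also have "cls \<dots> = f \<otimes>\<^bsub>gr\<^esub> (g \<otimes>\<^bsub>gr\<^esub> h)"
      unfolding gh r(2) using conv_even[OF s(1) t(1)] r(1) by (intro gr_times[symmetric]) auto
    finally show "f \<otimes>\<^bsub>even_ring gr\<^esub> g \<otimes>\<^bsub>even_ring gr\<^esub> h = f \<otimes>\<^bsub>even_ring gr\<^esub> (g \<otimes>\<^bsub>even_ring gr\<^esub> h)"
      by simp
  qed
next
  fix f g h assume "f \<in> carrier (even_ring gr)" "g \<in> carrier (even_ring gr)" "h \<in> carrier (even_ring gr)"
  then have "f \<in> carrier gr" "g \<in> carrier gr" "h \<in> carrier gr"
    using gr_rpart_subset by auto
  then obtain r s t where rst: "\<forall>n. r n \<in> odd_pow n" "f = cls r" "\<forall>n. s n \<in> odd_pow n" "g = cls s"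
    "\<forall>n. t n \<in> odd_pow n" "h = cls t"
    by (elim gr_carrierE)
  have rs: "\<forall>n. r n \<oplus> s n \<in> odd_pow n" using rst self.E.F_add by simp
  have "(f \<oplus>\<^bsub>gr\<^esub> g) \<otimes>\<^bsub>gr\<^esub> h = cls (conv R (\<otimes>) (\<lambda>n. r n \<oplus> s n) t)"
    unfolding rst gr_plus[OF rst(1,3)] by (rule gr_times[OF rs rst(5)])
  also have "\<dots> = cls (\<lambda>n. conv R (\<otimes>) r t n \<oplus> conv R (\<otimes>) s t n)"
    unfolding self.conv_l_distr[OF rst(1,3,5)] ..
  also have "\<dots> = f \<otimes>\<^bsub>gr\<^esub> h \<oplus>\<^bsub>gr\<^esub> g \<otimes>\<^bsub>gr\<^esub> h"
    unfolding rst gr_times[OF rst(1,5)] gr_times[OF rst(3,5)]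
    by (rule gr_plus[symmetric, OF self.conv_closed[OF rst(1,5)] self.conv_closed[OF rst(3,5)]])
  finally show "(f \<oplus>\<^bsub>even_ring gr\<^esub> g) \<otimes>\<^bsub>even_ring gr\<^esub> h =
      f \<otimes>\<^bsub>even_ring gr\<^esub> h \<oplus>\<^bsub>even_ring gr\<^esub> g \<otimes>\<^bsub>even_ring gr\<^esub> h"
    by simp
qed

lemma even_degree_class: "a \<in> rpart R 0 \<Longrightarrow> degree_class 0 a \<in> rpart gr 0"
  using degree_zero_mem[OF part_closed] additive_subgroup.zero_closed[OF part_additive_subgroup]
  by (intro gr_rpartI) (auto simp: delta_def)

text \<open>The map along which primes of the even part of \<open>gr R\<close> are contracted to
  \<open>R_0\<close>.\<close>

lemma degree_zero_hom: "ring_hom_cring (even_ring R) (even_ring gr) (degree_class 0)"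
proof -
  have "degree_class 0 \<in> ring_hom (even_ring R) (even_ring gr)"
  proof (rule ring_hom_memI)
    fix a b assume "a \<in> carrier (even_ring R)" "b \<in> carrier (even_ring R)"
    then have ab: "a \<in> rpart R 0" "b \<in> rpart R 0" "a \<in> carrier R" "b \<in> carrier R"
      using part_closed by auto
    show "degree_class 0 a \<in> carrier (even_ring gr)"
      using even_degree_class ab by simp
    show "degree_class 0 (a \<otimes>\<^bsub>even_ring R\<^esub> b) = degree_class 0 a \<otimes>\<^bsub>even_ring gr\<^esub> degree_class 0 b"
      using degree_class_times[of a 0 b 0] ab by simp
    have "delta R 0 (a \<oplus> b) = (\<lambda>n. delta R 0 a n \<oplus> delta R 0 b n)"
      by (simp add: delta_def fun_eq_iff)
    then show "degree_class 0 (a \<oplus>\<^bsub>even_ring R\<^esub> b) = degree_class 0 a \<oplus>\<^bsub>even_ring gr\<^esub> degree_class 0 b"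
      using gr_plus[OF degree_zero_mem[OF ab(3)] degree_zero_mem[OF ab(4)]] by simp
  next
    show "degree_class 0 \<one>\<^bsub>even_ring R\<^esub> = \<one>\<^bsub>even_ring gr\<^esub>"
      by (simp add: gr_one)
  qed
  then show ?thesis
    using even_ring_cring even_gr_cring
    by (intro ring_hom_cring.intro ring_hom_cring_axioms.intro)
qed

lemma cls_eq_zeroI:
  assumes "\<forall>n. r n \<in> odd_pow n" "\<forall>n. r n \<in> odd_pow (Suc n)"
  shows "cls r = \<zero>\<^bsub>gr\<^esub>"
  unfolding gr_zero self.E.gr_class_zero
  using self.E.gr_class_zero_iff[OF assms(1)] assms(2) by (intro ext) blast

text \<open>The even elements of positive degree: a nil ideal modulo which \<open>gr\<^sub>0\<close> is the image of \<open>R\<^sub>0\<close>.\<close>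

definition positive_part :: "(nat \<Rightarrow> 'a set) set" where
  "positive_part = {f \<in> rpart gr 0. f 0 = odd_pow (Suc 0)}"

lemma positive_partI:
  assumes "\<forall>n. r n \<in> odd_pow n \<inter> rpart R 0" "r 0 \<in> odd_pow (Suc 0)"
  shows "cls r \<in> positive_part"
  unfolding positive_part_def
  using self.E.gr_class_zero_iff[of r 0] gr_rpartI[OF assms(1)] assms by simp

lemma positive_partE:
  assumes "f \<in> positive_part"
  obtains r where "\<forall>n. r n \<in> odd_pow n \<inter> rpart R 0" "r 0 \<in> odd_pow (Suc 0)" "f = cls r"
proof -
  have "f \<in> rpart gr 0" using assms by (simp add: positive_part_def)
  then obtain r where r: "\<forall>n. r n \<in> odd_pow n \<inter> rpart R 0" "f = cls r"
    by (rule gr_rpartE)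
  moreover have "r 0 \<in> odd_pow (Suc 0)"
    using assms self.E.gr_class_zero_iff[of r 0] r by (simp add: positive_part_def)
  ultimately show ?thesis using that by blast
qed

lemma positive_part_ideal: "ideal positive_part (even_ring gr)"
proof -
  interpret B: cring "even_ring gr" by (rule even_gr_cring)
  interpret E1: additive_subgroup "odd_pow (Suc 0)" R by (rule odd_pow_additive_subgroup)
  interpret P0: additive_subgroup "rpart R 0" R by (rule part_additive_subgroup)
  have sub: "positive_part \<subseteq> carrier (even_ring gr)"
    by (auto simp: positive_part_def)
  show ?thesis
  proof (rule idealI)
    show "subgroup positive_part (add_monoid (even_ring gr))"
    proof (rule group.subgroupI[OF B.a_group])
      have "cls (\<lambda>n. \<zero>) \<in> positive_part"
        using E1.zero_closed P0.zero_closed self.E.F_zero by (intro positive_partI) auto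
      then show "positive_part \<noteq> {}" by blast
    next
      fix f assume f: "f \<in> positive_part"
      then obtain r where r: "\<forall>n. r n \<in> odd_pow n \<inter> rpart R 0" "r 0 \<in> odd_pow (Suc 0)" "f = cls r"
        by (rule positive_partE)
      have m: "cls (\<lambda>n. \<ominus> r n) \<in> positive_part"
        using r self.E.F_minus P0.a_inv_closed E1.a_inv_closed by (intro positive_partI) auto
      have "cls (\<lambda>n. \<ominus> r n) \<oplus>\<^bsub>gr\<^esub> f = cls (\<lambda>n. \<ominus> r n \<oplus> r n)"
        unfolding r(3) using r(1) self.E.F_minus by (intro gr_plus) auto
      also have "(\<lambda>n. \<ominus> r n \<oplus> r n) = (\<lambda>n. \<zero>)"
        using r(1) part_closed by (intro ext l_neg) blast
      finally have "cls (\<lambda>n. \<ominus> r n) \<oplus>\<^bsub>even_ring gr\<^esub> f = \<zero>\<^bsub>even_ring gr\<^esub>"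
        by (simp add: gr_zero)
      then have "\<ominus>\<^bsub>even_ring gr\<^esub> f = cls (\<lambda>n. \<ominus> r n)"
        using B.minus_equality f m sub by blast
      then show "inv\<^bsub>add_monoid (even_ring gr)\<^esub> f \<in> positive_part"
        using m by (simp add: a_inv_def)
      fix g assume "g \<in> positive_part"
      then obtain s where s: "\<forall>n. s n \<in> odd_pow n \<inter> rpart R 0" "s 0 \<in> odd_pow (Suc 0)" "g = cls s"
        by (rule positive_partE)
      have "f \<oplus>\<^bsub>gr\<^esub> g = cls (\<lambda>n. r n \<oplus> s n)"
        unfolding r(3) s(3) using r(1) s(1) by (intro gr_plus) auto
      moreover have "cls (\<lambda>n. r n \<oplus> s n) \<in> positive_part"
        using r s self.E.F_add P0.a_closed E1.a_closed by (intro positive_partI) auto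
      ultimately show "f \<otimes>\<^bsub>add_monoid (even_ring gr)\<^esub> g \<in> positive_part"
        by simp
    qed (use sub in simp)
  next
    fix f g assume f: "f \<in> positive_part" and g: "g \<in> carrier (even_ring gr)"
    obtain r where r: "\<forall>n. r n \<in> odd_pow n \<inter> rpart R 0" "r 0 \<in> odd_pow (Suc 0)" "f = cls r"
      using f by (rule positive_partE)
    have "g \<in> rpart gr 0" using g by simp
    then obtain s where s: "\<forall>n. s n \<in> odd_pow n \<inter> rpart R 0" "g = cls s"
      by (rule gr_rpartE)
    have "f \<otimes>\<^bsub>gr\<^esub> g = cls (conv R (\<otimes>) r s)"
      unfolding r(3) s(2) using r(1) s(1) by (intro gr_times) auto
    moreover have "cls (conv R (\<otimes>) r s) \<in> positive_part"
    proof (rule positive_partI[OF conv_even[OF r(1) s(1)]])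
      \<comment> \<open>Orders add: \<open>r\<close> has order at least 1 and \<open>s\<close> at
        least 0.\<close>
      show "conv R (\<otimes>) r s 0 \<in> odd_pow (Suc 0)"
        by (rule self.conv_order[of r s 1 0]) (use r s in auto)
    qed
    ultimately show *: "f \<otimes>\<^bsub>even_ring gr\<^esub> g \<in> positive_part"
      by simp
    then show "g \<otimes>\<^bsub>even_ring gr\<^esub> f \<in> positive_part"
      using B.m_comm[of f g] f g sub by auto
  qed (rule B.ring_axioms)
qed

text \<open>By additivity of orders the power \<open>f^k\<close> vanishes in all degrees below
  \<open>k\<close>, while \<open>gr R\<close> vanishes in degrees from some \<open>N\<close>
  on.\<close>

lemma positive_part_nil:
  assumes "f \<in> positive_part"
  shows "\<exists>k::nat. f [^]\<^bsub>even_ring gr\<^esub> k = \<zero>\<^bsub>even_ring gr\<^esub>"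
proof -
  obtain r where r: "\<forall>n. r n \<in> odd_pow n \<inter> rpart R 0" "r 0 \<in> odd_pow (Suc 0)" "f = cls r"
    using assms by (rule positive_partE)
  have pow: "\<exists>s. (\<forall>n. s n \<in> odd_pow n \<inter> rpart R 0) \<and> (\<forall>n<k. s n \<in> odd_pow (Suc n)) \<and>
      f [^]\<^bsub>even_ring gr\<^esub> k = cls s" for k :: nat
  proof (induction k)
    case 0
    have "\<one>\<^bsub>gr\<^esub> \<in> rpart gr 0" by (rule gr_one_even)
    then obtain s where "\<forall>n. s n \<in> odd_pow n \<inter> rpart R 0" "\<one>\<^bsub>gr\<^esub> = cls s"
      by (rule gr_rpartE)
    then show ?case by (intro exI[of _ s]) simp
  next
    case (Suc k)
    then obtain s where s: "\<forall>n. s n \<in> odd_pow n \<inter> rpart R 0" "\<forall>n<k. s n \<in> odd_pow (Suc n)"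
      "f [^]\<^bsub>even_ring gr\<^esub> k = cls s" by blast
    have "f [^]\<^bsub>even_ring gr\<^esub> Suc k = cls s \<otimes>\<^bsub>gr\<^esub> cls r"
      using s(3) r(3) by simp
    also have "\<dots> = cls (conv R (\<otimes>) s r)"
      using r(1) s(1) by (intro gr_times) auto
    finally have "f [^]\<^bsub>even_ring gr\<^esub> Suc k = cls (conv R (\<otimes>) s r)" .
    moreover have "conv R (\<otimes>) s r n \<in> odd_pow (Suc n)" if "n < Suc k" for n
      by (rule self.conv_order[of s r k 1]) (use r s that in auto)
    ultimately show ?case
      using conv_even[OF s(1) r(1)] by blast
  qed
  obtain N where N: "\<forall>n\<ge>N. odd_pow n = {\<zero>}" using self.E.F_nil by blast
  obtain s where s: "\<forall>n. s n \<in> odd_pow n \<inter> rpart R 0" "\<forall>n<N. s n \<in> odd_pow (Suc n)"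
      "f [^]\<^bsub>even_ring gr\<^esub> N = cls s" using pow[of N] by blast
  have "s n \<in> odd_pow (Suc n)" for n
  proof (cases "n < N")
    case False
    then have "odd_pow n = {\<zero>}" using N by simp
    then have "s n = \<zero>" using s(1) by blast
    then show ?thesis using self.E.F_zero by simp
  qed (use s in simp)
  then have "cls s = \<zero>\<^bsub>gr\<^esub>"
    using s(1) by (intro cls_eq_zeroI) auto
  then show ?thesis using s(3) by auto
qed

text \<open>An even element of \<open>gr R\<close> is the class of its degree 0 component plus an
  element of the nil ideal \<open>positive_part\<close>, so \<open>krull_dim_quot_nil\<close>
  applies.\<close>

lemma krull_dim_gr_quot:
  assumes "ideal K (even_ring gr)"
  shows "krull_dim (even_ring gr Quot K) = dim_above (even_ring R) {a \<in> rpart R 0. degree_class 0 a \<in> K}"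
proof -
  interpret h: ring_hom_cring "even_ring R" "even_ring gr" "degree_class 0"
    by (rule degree_zero_hom)
  have "\<exists>a\<in>rpart R 0. \<exists>g\<in>positive_part. f = g \<oplus>\<^bsub>gr\<^esub> degree_class 0 a" if "f \<in> rpart gr 0" for f
  proof -
    obtain r where r: "\<forall>n. r n \<in> odd_pow n \<inter> rpart R 0" "f = cls r"
      using \<open>f \<in> rpart gr 0\<close> by (rule gr_rpartE)
    \<comment> \<open>The part of positive degree; the removed entry \<open>r 0\<close> is the
      required preimage in \<open>R_0\<close>.\<close>
    define s where "s = r(0 := \<zero>)"
    have s: "\<forall>n. s n \<in> odd_pow n \<inter> rpart R 0" "s 0 \<in> odd_pow (Suc 0)"
      using r self.E.F_zero additive_subgroup.zero_closed[OF part_additive_subgroup]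
      by (auto simp: s_def)
    have a: "r 0 \<in> rpart R 0" "r 0 \<in> carrier R" using r part_closed by auto
    have "r n \<in> carrier R" for n using r part_closed by blast
    then have "r = (\<lambda>n. s n \<oplus> delta R 0 (r 0) n)"
      by (auto simp: s_def delta_def fun_eq_iff)
    moreover have "cls s \<oplus>\<^bsub>gr\<^esub> degree_class 0 (r 0) = cls (\<lambda>n. s n \<oplus> delta R 0 (r 0) n)"
      using s degree_zero_mem[OF a(2)] by (intro gr_plus) auto
    ultimately have "f = cls s \<oplus>\<^bsub>gr\<^esub> degree_class 0 (r 0)"
      using r(2) by metis
    then show ?thesis using a positive_partI[OF s] by blast
  qed
  then show ?thesis
    using h.krull_dim_quot_nil[OF positive_part_ideal positive_part_nil _ assms] by simp
qed

lemma odd_degree_class: "z \<in> rpart R 1 \<Longrightarrow> degree_class 1 z \<in> rpart gr 1"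
  using self.E.delta_closed[OF odd_in_odd_pow] additive_subgroup.zero_closed[OF part_additive_subgroup]
  by (intro gr_rpartI) (auto simp: delta_def)

lemma odd_product_degree_class:
  assumes "set ys \<subseteq> rpart R 1"
  shows "foldr (\<otimes>\<^bsub>gr\<^esub>) (map (degree_class 1) ys) \<one>\<^bsub>gr\<^esub> = degree_class (length ys) (odd_prod ys)"
  using assms
proof (induction ys)
  case Nil
  then show ?case by (simp add: gr_one)
next
  case (Cons y ys)
  then have "degree_class 1 y \<otimes>\<^bsub>gr\<^esub> degree_class (length ys) (odd_prod ys) =
      degree_class (1 + length ys) (y \<otimes> odd_prod ys)"
    using odd_in_odd_pow odd_prod_in_odd_pow by (intro degree_class_times) auto
  then show ?case using Cons by simp
qed

text \<open>Every odd element of \<open>gr R\<close> has order at least 1, so a product of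
  \<open>l\<close> of them vanishes in all degrees below \<open>l\<close>.\<close>

lemma odd_product_order:
  assumes "set Ys \<subseteq> rpart gr 1"
  obtains r where "\<forall>n. r n \<in> odd_pow n" "\<forall>n<length Ys. r n \<in> odd_pow (Suc n)"
    "foldr (\<otimes>\<^bsub>gr\<^esub>) Ys \<one>\<^bsub>gr\<^esub> = cls r"
proof -
  have "\<exists>r. (\<forall>n. r n \<in> odd_pow n) \<and> (\<forall>n<length Ys. r n \<in> odd_pow (Suc n)) \<and>
    foldr (\<otimes>\<^bsub>gr\<^esub>) Ys \<one>\<^bsub>gr\<^esub> = cls r"
    using assms
  proof (induction Ys)
    case Nil
    then show ?case
      using degree_zero_mem[OF one_closed] by (intro exI[of _ "delta R 0 \<one>"]) (simp add: gr_one)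
  next
    case (Cons Y Ys)
    then obtain r where r: "\<forall>n. r n \<in> odd_pow n" "\<forall>n<length Ys. r n \<in> odd_pow (Suc n)"
      "foldr (\<otimes>\<^bsub>gr\<^esub>) Ys \<one>\<^bsub>gr\<^esub> = cls r" by auto
    have "Y \<in> rpart gr 1" using Cons by simp
    then obtain u where u: "\<forall>n. u n \<in> odd_pow n \<inter> rpart R 1" "Y = cls u"
      by (rule gr_rpartE)
    have u': "\<forall>n. u n \<in> odd_pow n" using u by blast
    \<comment> \<open>The degree 0 representative is odd and thus lies in \<open>I\<close>, so its
      class modulo \<open>I\<close> is zero.\<close>
    have "u 0 \<in> odd_pow (Suc 0)" using u odd_in_odd_pow[of "u 0"] by simp
    then have "conv R (\<otimes>) u r n \<in> odd_pow (Suc n)" if "n < Suc (length Ys)" for n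
      by (intro self.conv_order[of u r 1 "length Ys"]) (use r u' that in auto)
    then show ?case
      using self.conv_closed[OF u' r(1)] gr_times[OF u' r(1)] r(3) u(2)
      by (intro exI[of _ "conv R (\<otimes>) u r"]) simp
  qed
  then show ?thesis using that by blast
qed

end

section \<open>The associated graded supermodule\<close>

locale noetherian_supermodule = supermodule R M + noetherian_superring R
  for R :: "('a, 'c) superring_scheme" and M :: "('a, 'b, 'd) supermodule_scheme" (structure)
begin

sublocale act: filtered_action R odd_pow M odd_filtration "(\<odot>)"
proof -
  obtain N where N: "\<forall>n\<ge>N. odd_pow n = {\<zero>\<^bsub>R\<^esub>}" using self.E.F_nil by blast
  have "odd_filtration n = {\<zero>}" if "n \<ge> N" for n
  proof -
    have "x = \<zero>" if "x \<in> odd_filtration n" for x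
      using that by (induction rule: ideal_smult.induct) (use N \<open>n \<ge> N\<close> smult_l_zero in auto)
    then show ?thesis
      using additive_subgroup.zero_closed[OF odd_filtration_additive_subgroup] by blast
  qed
  then have "\<exists>N. \<forall>n\<ge>N. odd_filtration n = {\<zero>}" by blast
  then interpret F: filtered_group M odd_filtration
    by (intro filtered_group.intro filtered_group_axioms.intro M.abelian_group_axioms
        odd_filtration_additive_subgroup odd_filtration_dec)
  show "filtered_action R odd_pow M odd_filtration (\<odot>)"
    by unfold_locales
      (simp_all add: odd_filtration_smult smult_closed smult_l_distr smult_r_distr smult_assoc smult_one R.odd_pow_mult)
qed

abbreviation grM :: "(nat \<Rightarrow> 'a set, nat \<Rightarrow> 'b set) supermodule" where
  "grM \<equiv> gr_module R (odd_ideal R) M"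

abbreviation mcls :: "(nat \<Rightarrow> 'b) \<Rightarrow> nat \<Rightarrow> 'b set" where
  "mcls \<equiv> gr_class M odd_filtration"

lemma grM_carrier: "carrier grM = mcls ` {s. \<forall>n. s n \<in> odd_filtration n}"
proof -
  have "{s. \<forall>n. s n \<in> odd_filtration n \<inter> carrier M} = {s. \<forall>n. s n \<in> odd_filtration n}"
    using odd_filtration_closed by blast
  then show ?thesis
    using act.G.gr_part_eq[of "carrier M"] by (simp add: gr_module_def Let_def)
qed

lemma grM_carrierI: "\<forall>n. s n \<in> odd_filtration n \<Longrightarrow> mcls s \<in> carrier grM"
  unfolding grM_carrier by blast

lemma grM_carrierE:
  assumes "x \<in> carrier grM"
  obtains s where "\<forall>n. s n \<in> odd_filtration n" "x = mcls s"
  using assms unfolding grM_carrier by (elim imageE) simp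

lemma grM_smult:
  assumes "\<forall>n. r n \<in> odd_pow n" "\<forall>n. s n \<in> odd_filtration n"
  shows "cls r \<odot>\<^bsub>grM\<^esub> mcls s = mcls (conv M (\<odot>) r s)"
  using act.gr_mult_class[OF assms] by (simp add: gr_module_def Let_def)

lemma grM_plus:
  assumes "\<forall>n. r n \<in> odd_filtration n" "\<forall>n. s n \<in> odd_filtration n"
  shows "mcls r \<oplus>\<^bsub>grM\<^esub> mcls s = mcls (\<lambda>n. r n \<oplus> s n)"
  using act.G.gr_class_add[OF assms] by (simp add: gr_module_def Let_def)

lemma grM_zero: "\<zero>\<^bsub>grM\<^esub> = (\<lambda>n. odd_filtration (Suc n))"
  by (simp add: gr_module_def Let_def)

lemma degree_class_smult:
  assumes "a \<in> odd_pow k" "\<forall>n. s n \<in> odd_filtration n"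
  shows "degree_class k a \<odot>\<^bsub>grM\<^esub> mcls s = mcls (\<lambda>n. if k \<le> n then a \<odot> s (n - k) else \<zero>)"
  using grM_smult[OF self.E.delta_closed[OF assms(1)] assms(2)] act.conv_delta[OF assms] by simp

lemma mcls_zero_iff:
  assumes "\<forall>n. s n \<in> odd_filtration n"
  shows "mcls s = \<zero>\<^bsub>grM\<^esub> \<longleftrightarrow> (\<forall>n. s n \<in> odd_filtration (Suc n))"
  unfolding grM_zero fun_eq_iff using act.G.gr_class_zero_iff[OF assms] by simp

text \<open>Acting in degree 0 multiplies each representative by \<open>a\<close>, and a class
  vanishes in degree \<open>n\<close> when its representative lies one step deeper. All statements
  on annihilators in \<open>gr M\<close> reduce to this.\<close>

lemma degree_zero_kills_iff:
  assumes "a \<in> carrier R" "\<forall>n. s n \<in> odd_filtration n"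
  shows "degree_class 0 a \<odot>\<^bsub>grM\<^esub> mcls s = \<zero>\<^bsub>grM\<^esub> \<longleftrightarrow> (\<forall>n. a \<odot> s n \<in> odd_filtration (Suc n))"
proof -
  have a: "a \<in> odd_pow 0" using assms by simp
  have "\<forall>n. a \<odot> s n \<in> odd_filtration n"
    using odd_filtration_smult[OF a] assms(2) by fastforce
  then show ?thesis
    using degree_class_smult[OF a assms(2)] mcls_zero_iff by simp
qed

lemma smult_grM_closed:
  assumes "f \<in> carrier gr" "x \<in> carrier grM"
  shows "f \<odot>\<^bsub>grM\<^esub> x \<in> carrier grM"
proof -
  obtain r where r: "\<forall>n. r n \<in> odd_pow n" "f = cls r"
    using assms(1) by (rule gr_carrierE)
  obtain s where s: "\<forall>n. s n \<in> odd_filtration n" "x = mcls s"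
    using assms(2) by (rule grM_carrierE)
  show ?thesis
    unfolding r(2) s(2) grM_smult[OF r(1) s(1)]
    by (rule grM_carrierI[OF act.conv_closed[OF r(1) s(1)]])
qed

lemma even_gr_module: "Module.module (even_ring gr) grM"
proof (rule moduleI)
  show "cring (even_ring gr)" by (rule even_gr_cring)
  have "subgroup (carrier M) (add_monoid M)"
    by (rule group.subgroup_self[OF M.a_group, simplified])
  then show "abelian_group grM"
    by (rule act.G.gr_abelian_group) (simp_all add: gr_module_def Let_def)
next
  fix f x assume "f \<in> carrier (even_ring gr)" "x \<in> carrier grM"
  then show "f \<odot>\<^bsub>grM\<^esub> x \<in> carrier grM"
    using gr_rpart_subset by (intro smult_grM_closed) auto
next
  fix f g x assume "f \<in> carrier (even_ring gr)" "g \<in> carrier (even_ring gr)" and x: "x \<in> carrier grM"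
  then have "f \<in> carrier gr" "g \<in> carrier gr"
    using gr_rpart_subset by auto
  then obtain r r' where r: "\<forall>n. r n \<in> odd_pow n" "f = cls r" "\<forall>n. r' n \<in> odd_pow n" "g = cls r'"
    by (elim gr_carrierE)
  obtain s where s: "\<forall>n. s n \<in> odd_filtration n" "x = mcls s"
    using x by (rule grM_carrierE)
  have rr: "\<forall>n. r n \<oplus>\<^bsub>R\<^esub> r' n \<in> odd_pow n" using r self.E.F_add by simp
  have "(f \<oplus>\<^bsub>gr\<^esub> g) \<odot>\<^bsub>grM\<^esub> x = mcls (conv M (\<odot>) (\<lambda>n. r n \<oplus>\<^bsub>R\<^esub> r' n) s)"
    unfolding r(2,4) s(2) gr_plus[OF r(1,3)] by (rule grM_smult[OF rr s(1)])
  also have "\<dots> = mcls (\<lambda>n. conv M (\<odot>) r s n \<oplus> conv M (\<odot>) r' s n)"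
    unfolding act.conv_l_distr[OF r(1,3) s(1)] ..
  also have "\<dots> = f \<odot>\<^bsub>grM\<^esub> x \<oplus>\<^bsub>grM\<^esub> g \<odot>\<^bsub>grM\<^esub> x"
    unfolding r(2,4) s(2) grM_smult[OF r(1) s(1)] grM_smult[OF r(3) s(1)]
    by (rule grM_plus[symmetric, OF act.conv_closed[OF r(1) s(1)] act.conv_closed[OF r(3) s(1)]])
  finally show "(f \<oplus>\<^bsub>even_ring gr\<^esub> g) \<odot>\<^bsub>grM\<^esub> x = f \<odot>\<^bsub>grM\<^esub> x \<oplus>\<^bsub>grM\<^esub> g \<odot>\<^bsub>grM\<^esub> x"
    by simp
  have "(f \<otimes>\<^bsub>gr\<^esub> g) \<odot>\<^bsub>grM\<^esub> x = mcls (conv M (\<odot>) (conv R (\<otimes>\<^bsub>R\<^esub>) r r') s)"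
    unfolding r(2,4) s(2) gr_times[OF r(1,3)]
    by (rule grM_smult[OF self.conv_closed[OF r(1,3)] s(1)])
  also have "\<dots> = mcls (conv M (\<odot>) r (conv M (\<odot>) r' s))"
    unfolding act.conv_assoc[OF r(1,3) s(1)] ..
  also have "\<dots> = f \<odot>\<^bsub>grM\<^esub> (g \<odot>\<^bsub>grM\<^esub> x)"
    unfolding r(2,4) s(2) grM_smult[OF r(3) s(1)]
    by (rule grM_smult[symmetric, OF r(1) act.conv_closed[OF r(3) s(1)]])
  finally show "(f \<otimes>\<^bsub>even_ring gr\<^esub> g) \<odot>\<^bsub>grM\<^esub> x = f \<odot>\<^bsub>grM\<^esub> (g \<odot>\<^bsub>grM\<^esub> x)"
    by simp
next
  fix f x y assume "f \<in> carrier (even_ring gr)" and x: "x \<in> carrier grM" and y: "y \<in> carrier grM"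
  then have "f \<in> carrier gr"
    using gr_rpart_subset by auto
  then obtain r where r: "\<forall>n. r n \<in> odd_pow n" "f = cls r" by (rule gr_carrierE)
  obtain s where s: "\<forall>n. s n \<in> odd_filtration n" "x = mcls s"
    using x by (rule grM_carrierE)
  obtain t where t: "\<forall>n. t n \<in> odd_filtration n" "y = mcls t"
    using y by (rule grM_carrierE)
  have st: "\<forall>n. s n \<oplus> t n \<in> odd_filtration n" using s t act.G.F_add by simp
  have "f \<odot>\<^bsub>grM\<^esub> (x \<oplus>\<^bsub>grM\<^esub> y) = mcls (conv M (\<odot>) r (\<lambda>n. s n \<oplus> t n))"
    unfolding r(2) s(2) t(2) grM_plus[OF s(1) t(1)] by (rule grM_smult[OF r(1) st])
  also have "\<dots> = mcls (\<lambda>n. conv M (\<odot>) r s n \<oplus> conv M (\<odot>) r t n)"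
    unfolding act.conv_r_distr[OF r(1) s(1) t(1)] ..
  also have "\<dots> = f \<odot>\<^bsub>grM\<^esub> x \<oplus>\<^bsub>grM\<^esub> f \<odot>\<^bsub>grM\<^esub> y"
    unfolding r(2) s(2) t(2) grM_smult[OF r(1) s(1)] grM_smult[OF r(1) t(1)]
    by (rule grM_plus[symmetric, OF act.conv_closed[OF r(1) s(1)] act.conv_closed[OF r(1) t(1)]])
  finally show "f \<odot>\<^bsub>grM\<^esub> (x \<oplus>\<^bsub>grM\<^esub> y) = f \<odot>\<^bsub>grM\<^esub> x \<oplus>\<^bsub>grM\<^esub> f \<odot>\<^bsub>grM\<^esub> y" .
next
  fix x assume x: "x \<in> carrier grM"
  obtain s where s: "\<forall>n. s n \<in> odd_filtration n" "x = mcls s"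
    using x by (rule grM_carrierE)
  have "degree_class 0 \<one>\<^bsub>R\<^esub> \<odot>\<^bsub>grM\<^esub> mcls s = mcls (\<lambda>n. \<one>\<^bsub>R\<^esub> \<odot> s n)"
    using degree_class_smult[of "\<one>\<^bsub>R\<^esub>" 0 s] s(1) by simp
  also have "(\<lambda>n. \<one>\<^bsub>R\<^esub> \<odot> s n) = s"
    using s(1) by (intro ext smult_one) (blast intro: odd_filtration_closed)
  finally show "\<one>\<^bsub>even_ring gr\<^esub> \<odot>\<^bsub>grM\<^esub> x = x"
    unfolding s(2) even_gr_simps gr_one .
qed

section \<open>Dimensions through chains of primes of \<open>R_0\<close>\<close>

definition ann :: "'b set \<Rightarrow> 'a set" where
  "ann X = {a \<in> rpart R 0. \<forall>x\<in>X. a \<odot> x = \<zero>}"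

text \<open>The preimage in \<open>R\<^sub>0\<close> of the annihilator in \<open>gr\<^sub>0\<close>.\<close>

definition gr_ann :: "(nat \<Rightarrow> 'b set) set \<Rightarrow> 'a set" where
  "gr_ann X = {a \<in> rpart R 0. \<forall>x\<in>X. degree_class 0 a \<odot>\<^bsub>grM\<^esub> x = \<zero>\<^bsub>grM\<^esub>}"

lemma ann_ideal: "X \<subseteq> carrier M \<Longrightarrow> ideal (ann X) (even_ring R)"
  using module.annihilator_is_ideal[OF even_module, of X] by (simp add: ann_def)

lemma mdim_eq:
  assumes "X \<subseteq> carrier M"
  shows "mdim R (subsupermodule M X) = dim_above (even_ring R) (ann X)"
proof -
  have "even_annihilator R (subsupermodule M X) = ann X"
    by (simp add: even_annihilator_def ann_def subsupermodule_def)
  then show ?thesis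
    using cring.krull_dim_quot[OF R.even_ring_cring ann_ideal[OF assms]] by (simp add: mdim_def)
qed

text \<open>\<open>krull_dim_gr_quot\<close> applied to the annihilator of \<open>X\<close> replaces
  it by its preimage \<open>gr_ann X\<close> in \<open>R_0\<close>.\<close>

lemma mdim_gr_eq:
  assumes "X \<subseteq> carrier grM"
  shows "mdim gr (subsupermodule grM X) = dim_above (even_ring R) (gr_ann X)"
proof -
  let ?K = "{f \<in> rpart gr 0. \<forall>x\<in>X. f \<odot>\<^bsub>grM\<^esub> x = \<zero>\<^bsub>grM\<^esub>}"
  have "ideal ?K (even_ring gr)"
    using module.annihilator_is_ideal[OF even_gr_module assms] by simp
  then have "krull_dim (even_ring gr Quot ?K) = dim_above (even_ring R) {a \<in> rpart R 0. degree_class 0 a \<in> ?K}"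
    by (rule krull_dim_gr_quot)
  moreover have "{a \<in> rpart R 0. degree_class 0 a \<in> ?K} = gr_ann X"
    using even_degree_class by (auto simp: gr_ann_def)
  moreover have "even_annihilator gr (subsupermodule grM X) = ?K"
    by (simp add: even_annihilator_def subsupermodule_def)
  ultimately show ?thesis by (simp add: mdim_def)
qed

lemma mdim_subsupermodule_carrier: "mdim S (subsupermodule N (carrier N)) = mdim S N"
  by (simp add: mdim_def even_annihilator_def subsupermodule_def)

text \<open>The two ideals have the same radical: an element of the larger one raises the filtration
  of \<open>M\<close> by one step, and the filtration is finite.\<close>

lemma dim_gr_ann_carrier: "dim_above (even_ring R) (gr_ann (carrier grM)) = dim_above (even_ring R) (ann (carrier M))"
proof (rule dim_above_radical[symmetric])
  show "ann (carrier M) \<subseteq> gr_ann (carrier grM)"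
  proof
    fix a assume a: "a \<in> ann (carrier M)"
    have "degree_class 0 a \<odot>\<^bsub>grM\<^esub> x = \<zero>\<^bsub>grM\<^esub>" if "x \<in> carrier grM" for x
    proof -
      obtain s where s: "\<forall>n. s n \<in> odd_filtration n" "x = mcls s"
        using \<open>x \<in> carrier grM\<close> by (rule grM_carrierE)
      have "a \<odot> s n = \<zero>" for n
        using a s(1) odd_filtration_closed[of "s n" n] by (simp add: ann_def)
      then show ?thesis
        unfolding s(2) using a s(1) R.part_closed act.G.F_zero
        by (subst degree_zero_kills_iff) (auto simp: ann_def)
    qed
    then show "a \<in> gr_ann (carrier grM)"
      using a by (simp add: ann_def gr_ann_def)
  qed
  show "gr_ann (carrier grM) \<subseteq> carrier (even_ring R)"
    by (auto simp: gr_ann_def)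
  fix a assume a: "a \<in> gr_ann (carrier grM)"
  then have ac: "a \<in> rpart R 0" "a \<in> carrier R"
    using R.part_closed by (auto simp: gr_ann_def)
  interpret A: cring "even_ring R" by (rule R.even_ring_cring)
  \<comment> \<open>The annihilation is tested on the homogeneous class of \<open>x\<close> in
    degree \<open>j\<close>.\<close>
  have step: "a \<odot> x \<in> odd_filtration (Suc j)" if x: "x \<in> odd_filtration j" for x j
  proof -
    have d: "\<forall>n. delta M j x n \<in> odd_filtration n"
      by (rule act.G.delta_closed[OF x])
    then have "degree_class 0 a \<odot>\<^bsub>grM\<^esub> mcls (delta M j x) = \<zero>\<^bsub>grM\<^esub>"
      using a grM_carrierI[OF d] by (simp add: gr_ann_def)
    then have "\<forall>n. a \<odot> delta M j x n \<in> odd_filtration (Suc n)"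
      using degree_zero_kills_iff[OF ac(2) d] by simp
    from spec[OF this, of j] show ?thesis by (simp add: delta_def)
  qed
  have pc: "a [^]\<^bsub>even_ring R\<^esub> k \<in> rpart R 0" for k :: nat
    using A.nat_pow_closed[of a k] ac by simp
  have pow: "a [^]\<^bsub>even_ring R\<^esub> k \<odot> x \<in> odd_filtration (j + k)" if "x \<in> odd_filtration j" for k x j
    using that
  proof (induction k arbitrary: x j)
    case 0
    then show ?case using smult_one odd_filtration_closed by simp
  next
    case (Suc k)
    have "a [^]\<^bsub>even_ring R\<^esub> Suc k \<odot> x = a [^]\<^bsub>even_ring R\<^esub> k \<odot> (a \<odot> x)"
      using ac R.part_closed[OF pc] odd_filtration_closed[OF Suc.prems] by (simp add: smult_assoc)
    then show ?case using Suc.IH[OF step[OF Suc.prems]] by simp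
  qed
  obtain N where N: "\<forall>n\<ge>N. odd_filtration n = {\<zero>}" using act.G.F_nil by blast
  have "a [^]\<^bsub>even_ring R\<^esub> N \<odot> x = \<zero>" if "x \<in> carrier M" for x
    using pow[of x 0 N] N that odd_filtration_zero by auto
  then show "\<exists>k::nat. a [^]\<^bsub>even_ring R\<^esub> k \<in> ann (carrier M)"
    using pc by (intro exI[of _ N]) (simp add: ann_def)
qed

lemma mdim_gr: "mdim gr grM = mdim R M"
  using mdim_eq[of "carrier M"] mdim_gr_eq[of "carrier grM"] dim_gr_ann_carrier
  by (simp add: mdim_subsupermodule_carrier)

section \<open>Systems of odd parameters\<close>

definition prod_image :: "'a list \<Rightarrow> 'b set" where
  "prod_image ys = (\<lambda>x. R.odd_prod ys \<odot> x) ` carrier M"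

definition gr_prod_image :: "(nat \<Rightarrow> 'a set) list \<Rightarrow> (nat \<Rightarrow> 'b set) set" where
  "gr_prod_image Ys = (\<lambda>x. foldr (\<otimes>\<^bsub>gr\<^esub>) Ys \<one>\<^bsub>gr\<^esub> \<odot>\<^bsub>grM\<^esub> x) ` carrier grM"

lemma prod_image_subset: "set ys \<subseteq> rpart R 1 \<Longrightarrow> prod_image ys \<subseteq> carrier M"
  using R.odd_prod_closed smult_closed by (auto simp: prod_image_def)

lemma gr_prod_image_subset:
  assumes "set Ys \<subseteq> rpart gr 1"
  shows "gr_prod_image Ys \<subseteq> carrier grM"
proof -
  obtain r where "\<forall>n. r n \<in> odd_pow n" "foldr (\<otimes>\<^bsub>gr\<^esub>) Ys \<one>\<^bsub>gr\<^esub> = cls r"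
    using odd_product_order[OF assms] by metis
  then show ?thesis
    using smult_grM_closed[OF gr_carrierI] by (auto simp: gr_prod_image_def)
qed

abbreviation mod_dim :: ereal where
  "mod_dim \<equiv> dim_above (even_ring R) (ann (carrier M))"

text \<open>In this form, with all chains in \<open>R_0\<close> and the common value
  \<open>mod_dim\<close>, parameters of \<open>M\<close> and of \<open>gr M\<close> become
  comparable.\<close>

lemma odd_parameters_iff:
  "odd_parameters R M ys \<longleftrightarrow> ys \<noteq> [] \<and> set ys \<subseteq> rpart R 1 \<and>
     dim_above (even_ring R) (ann (prod_image ys)) = mod_dim"
proof (cases "set ys \<subseteq> rpart R 1")
  case True
  have "mdim R M = mod_dim"
    using mdim_eq[of "carrier M"] by (simp add: mdim_subsupermodule_carrier)
  moreover have "mdim R (subsupermodule M (prod_image ys)) = dim_above (even_ring R) (ann (prod_image ys))"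
    by (rule mdim_eq[OF prod_image_subset[OF True]])
  ultimately show ?thesis
    by (simp add: odd_parameters_def prod_image_def R.odd_prod_def)
qed (simp add: odd_parameters_def)

lemma gr_odd_parameters_iff:
  "odd_parameters gr grM Ys \<longleftrightarrow> Ys \<noteq> [] \<and> set Ys \<subseteq> rpart gr 1 \<and>
     dim_above (even_ring R) (gr_ann (gr_prod_image Ys)) = mod_dim"
proof (cases "set Ys \<subseteq> rpart gr 1")
  case True
  have "mdim gr grM = mod_dim"
    using mdim_gr mdim_eq[of "carrier M"] by (simp add: mdim_subsupermodule_carrier)
  moreover have "mdim gr (subsupermodule grM (gr_prod_image Ys)) = dim_above (even_ring R) (gr_ann (gr_prod_image Ys))"
    by (rule mdim_gr_eq[OF gr_prod_image_subset[OF True]])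
  ultimately show ?thesis
    by (simp add: odd_parameters_def gr_prod_image_def)
qed (simp add: odd_parameters_def)

lemma ann_antimono: "X \<subseteq> Y \<Longrightarrow> ann Y \<subseteq> ann X"
  by (auto simp: ann_def)

lemma gr_ann_antimono: "X \<subseteq> Y \<Longrightarrow> gr_ann Y \<subseteq> gr_ann X"
  by (auto simp: gr_ann_def)

text \<open>If the annihilator of \<open>z M\<close> were contained in \<open>P 0\<close>, the chain
  \<open>P\<close> would give \<open>z M\<close> the full dimension of \<open>M\<close>, and
  \<open>zs\<close> would be a system of odd parameters.\<close>

lemma not_parameters_annihilator:
  assumes P: "prime_chain (even_ring R) n P" and n: "mod_dim = ereal (real n)"
    and zs: "set zs \<subseteq> rpart R 1" "zs \<noteq> []" "\<not> odd_parameters R M zs"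
  shows "\<exists>a\<in>rpart R 0 - P 0. \<forall>x\<in>carrier M. a \<odot> (R.odd_prod zs \<odot> x) = \<zero>"
proof -
  have "\<not> ann (prod_image zs) \<subseteq> P 0"
  proof
    assume "ann (prod_image zs) \<subseteq> P 0"
    then have "mod_dim \<le> dim_above (even_ring R) (ann (prod_image zs))"
      using dim_above_ge[OF P] n by simp
    moreover have "dim_above (even_ring R) (ann (prod_image zs)) \<le> mod_dim"
      by (intro dim_above_antimono ann_antimono prod_image_subset zs)
    ultimately show False
      using zs by (simp add: odd_parameters_iff)
  qed
  then show ?thesis by (auto simp: ann_def prod_image_def)
qed

lemma gr_parameters_imp_parameters:
  assumes fin: "krull_dim (even_ring R) < \<infinity>" and pos: "mod_dim \<noteq> -\<infinity>"
    and Ys: "odd_parameters gr grM Ys"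
  shows "\<exists>zs. odd_parameters R M zs \<and> length zs = length Ys"
proof (rule ccontr)
  assume none: "\<not> ?thesis"
  have Y: "Ys \<noteq> []" "set Ys \<subseteq> rpart gr 1"
    and d: "dim_above (even_ring R) (gr_ann (gr_prod_image Ys)) = mod_dim"
    using Ys by (auto simp: gr_odd_parameters_iff)
  have "mod_dim < \<infinity>" using dim_above_le_krull_dim fin by (rule le_less_trans)
  \<comment> \<open>The chain starts above the annihilator of the image of the product, and
    \<open>d\<close> gives it length \<open>mod_dim\<close>. The contradiction will be an element of
    this annihilator outside \<open>P 0\<close>.\<close>
  then obtain n P where nP: "mod_dim = ereal (real n)" "prime_chain (even_ring R) n P"
    "gr_ann (gr_prod_image Ys) \<subseteq> P 0"
    using dim_above_attained[of "even_ring R" "gr_ann (gr_prod_image Ys)"] pos d by metis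
  have "\<exists>a\<in>rpart R 0 - P 0. \<forall>x\<in>carrier M. a \<odot> (R.odd_prod zs \<odot> x) = \<zero>"
    if zs: "set zs \<subseteq> rpart R 1" "length zs = length Ys" for zs
  proof (rule not_parameters_annihilator[OF nP(2,1) zs(1)])
    show "zs \<noteq> []" using zs Y by auto
    show "\<not> odd_parameters R M zs" using none zs by blast
  qed
  then obtain a where a: "a \<in> rpart R 0 - P 0" and kill: "\<And>u. u \<in> odd_filtration (length Ys) \<Longrightarrow> a \<odot> u = \<zero>"
    using uniform_annihilator[OF supermodule_axioms prime_chain_primeideal[OF nP(2) le0], of "length Ys"] by metis
  have ac: "a \<in> carrier R" using a R.part_closed by auto
  obtain r where r: "\<forall>n. r n \<in> odd_pow n" "\<forall>n<length Ys. r n \<in> odd_pow (Suc n)"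
    "foldr (\<otimes>\<^bsub>gr\<^esub>) Ys \<one>\<^bsub>gr\<^esub> = cls r"
    using Y(2) by (rule odd_product_order)
  have "degree_class 0 a \<odot>\<^bsub>grM\<^esub> x = \<zero>\<^bsub>grM\<^esub>" if x: "x \<in> gr_prod_image Ys" for x
  proof -
    obtain y where y: "y \<in> carrier grM" "x = cls r \<odot>\<^bsub>grM\<^esub> y"
      using x r(3) by (auto simp: gr_prod_image_def)
    obtain s where s: "\<forall>n. s n \<in> odd_filtration n" "y = mcls s"
      using y(1) by (rule grM_carrierE)
    define t where "t = conv M (\<odot>) r s"
    have t: "\<forall>n. t n \<in> odd_filtration n"
      unfolding t_def by (rule act.conv_closed[OF r(1) s(1)])
    have xt: "x = mcls t"
      unfolding y(2) s(2) t_def by (rule grM_smult[OF r(1) s(1)])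
    \<comment> \<open>Below degree \<open>length Ys\<close> the class of \<open>t\<close> vanishes
      because the product has that order; from there on \<open>t n\<close> lies in the part of
      \<open>M\<close> killed by \<open>a\<close>.\<close>
    have "a \<odot> t n \<in> odd_filtration (Suc n)" for n
    proof (cases "n < length Ys")
      case True
      have "t n \<in> odd_filtration (Suc n)"
        unfolding t_def by (rule act.conv_order[of r s "length Ys" 0]) (use r s True in auto)
      then show ?thesis
        using odd_filtration_smult[of a 0 "t n" "Suc n"] ac by simp
    next
      case False
      then have "t n \<in> odd_filtration (length Ys)"
        using t act.G.F_antimono[of "length Ys" n] by auto
      then show ?thesis using kill act.G.F_zero by simp
    qed
    then show ?thesis
      unfolding xt using degree_zero_kills_iff[OF ac t] by simp
  qed
  then have "a \<in> gr_ann (gr_prod_image Ys)"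
    using a by (simp add: gr_ann_def)
  then show False using nP(3) a by blast
qed

text \<open>A longer product of odd elements is zero by nilpotence, so its image has dimension
  \<open>-\<infinity>\<close>. The bound ensures that a system of maximal length exists.\<close>

lemma parameters_length_bounded:
  assumes pos: "mod_dim \<noteq> -\<infinity>"
  shows "\<exists>N. \<forall>ys. odd_parameters R M ys \<longrightarrow> length ys \<le> N"
proof -
  obtain N where N: "\<forall>n\<ge>N. odd_pow n = {\<zero>\<^bsub>R\<^esub>}" using self.E.F_nil by blast
  have "length ys \<le> N" if ys: "odd_parameters R M ys" for ys
  proof (rule ccontr)
    assume "\<not> length ys \<le> N"
    then have "odd_pow (length ys) = {\<zero>\<^bsub>R\<^esub>}" using N by simp
    moreover have "set ys \<subseteq> rpart R 1" using ys by (simp add: odd_parameters_def)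
    ultimately have "R.odd_prod ys = \<zero>\<^bsub>R\<^esub>" using R.odd_prod_in_odd_pow by blast
    then have "ann (prod_image ys) = carrier (even_ring R)"
      using smult_l_zero smult_r_zero R.part_closed by (auto simp: ann_def prod_image_def)
    then show False
      using ys pos dim_above_carrier[of "even_ring R"] by (simp add: odd_parameters_iff)
  qed
  then show ?thesis by blast
qed

text \<open>Without maximality of the length this fails: the product of \<open>ys\<close> may lie in \<open>I\<^bsup>l+1\<^esup>\<close>, where \<open>l\<close> is
  the length of \<open>ys\<close>, and then its class in degree \<open>l\<close> vanishes.\<close>

lemma parameters_imp_gr_parameters:
  assumes fin: "krull_dim (even_ring R) < \<infinity>" and pos: "mod_dim \<noteq> -\<infinity>"
    and ys: "odd_parameters R M ys"
    and max: "\<And>zs. odd_parameters R M zs \<Longrightarrow> length zs \<le> length ys"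
  shows "odd_parameters gr grM (map (degree_class 1) ys)"
proof -
  let ?l = "length ys" and ?y = "R.odd_prod ys" and ?Ys = "map (degree_class 1) ys"
  have Y: "ys \<noteq> []" "set ys \<subseteq> rpart R 1"
    and d: "dim_above (even_ring R) (ann (prod_image ys)) = mod_dim"
    using ys by (auto simp: odd_parameters_iff)
  have YS: "set ?Ys \<subseteq> rpart gr 1"
    using Y(2) odd_degree_class by auto
  have "mod_dim < \<infinity>" using dim_above_le_krull_dim fin by (rule le_less_trans)
  \<comment> \<open>Here the chain starts above the annihilator of \<open>y M\<close>; the aim is to
    show that it also starts above the one coming from \<open>gr M\<close>.\<close>
  then obtain n P where nP: "mod_dim = ereal (real n)" "prime_chain (even_ring R) n P"
    "ann (prod_image ys) \<subseteq> P 0"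
    using dim_above_attained[of "even_ring R" "ann (prod_image ys)"] pos d by metis
  interpret p: primeideal "P 0" "even_ring R"
    using nP(2) by (rule prime_chain_primeideal) simp
  \<comment> \<open>By maximality no list of length \<open>Suc ?l\<close> is a system of
    parameters.\<close>
  have "\<exists>a\<in>rpart R 0 - P 0. \<forall>x\<in>carrier M. a \<odot> (R.odd_prod zs \<odot> x) = \<zero>"
    if zs: "set zs \<subseteq> rpart R 1" "length zs = Suc ?l" for zs
  proof (rule not_parameters_annihilator[OF nP(2,1) zs(1)])
    show "zs \<noteq> []" using zs by auto
    show "\<not> odd_parameters R M zs" using max[of zs] zs by auto
  qed
  then obtain a where a: "a \<in> rpart R 0 - P 0" and kill: "\<And>u. u \<in> odd_filtration (Suc ?l) \<Longrightarrow> a \<odot> u = \<zero>"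
    using uniform_annihilator[OF supermodule_axioms p.primeideal, of "Suc ?l"] by metis
  have yE: "?y \<in> odd_pow ?l" using Y(2) by (rule R.odd_prod_in_odd_pow)
  have yc: "?y \<in> carrier R" using Y(2) by (rule R.odd_prod_closed)
  have ac: "a \<in> carrier R" using a R.part_closed by auto
  have "gr_ann (gr_prod_image ?Ys) \<subseteq> P 0"
  proof
    fix b assume b: "b \<in> gr_ann (gr_prod_image ?Ys)"
    then have bc: "b \<in> rpart R 0" "b \<in> carrier R"
      using R.part_closed by (auto simp: gr_ann_def)
    \<comment> \<open>Put \<open>x\<close> in degree 0, so that the product of the classes of
      \<open>ys\<close> sends it to the class of \<open>y x\<close> in degree \<open>?l\<close>.
      Once \<open>a b\<close> is known to annihilate \<open>y M\<close>, it lies in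
      \<open>P 0\<close>; as \<open>a\<close> does not, \<open>b\<close> does.\<close>
    have "(a \<otimes>\<^bsub>R\<^esub> b) \<odot> (?y \<odot> x) = \<zero>" if x: "x \<in> carrier M" for x
    proof -
      have "x \<in> odd_filtration 0" using x odd_filtration_zero by simp
      then have dx: "\<forall>n. delta M 0 x n \<in> odd_filtration n"
        by (rule act.G.delta_closed)
      define t where "t = (\<lambda>n. if ?l \<le> n then ?y \<odot> delta M 0 x (n - ?l) else \<zero>)"
      have eq: "degree_class ?l ?y \<odot>\<^bsub>grM\<^esub> mcls (delta M 0 x) = mcls t"
        unfolding t_def by (rule degree_class_smult[OF yE dx])
      have "mcls t \<in> gr_prod_image ?Ys"
        unfolding gr_prod_image_def odd_product_degree_class[OF Y(2)] eq[symmetric]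
        using grM_carrierI[OF dx] by (rule imageI)
      then have "degree_class 0 b \<odot>\<^bsub>grM\<^esub> mcls t = \<zero>\<^bsub>grM\<^esub>"
        using b unfolding gr_ann_def by blast
      moreover have "\<forall>n. t n \<in> odd_filtration n"
      proof
        fix n
        show "t n \<in> odd_filtration n"
          using odd_filtration_smult[OF yE spec[OF dx, of "n - ?l"]] act.G.F_zero
          by (cases "?l \<le> n") (simp_all add: t_def)
      qed
      \<comment> \<open>Read off in degree \<open>?l\<close>, where \<open>t\<close> is
        \<open>y x\<close>; the gain of one degree lands in the piece that \<open>a\<close>
        kills.\<close>
      ultimately have "b \<odot> t ?l \<in> odd_filtration (Suc ?l)"
        using degree_zero_kills_iff[OF bc(2)] by blast
      then have "a \<odot> (b \<odot> (?y \<odot> x)) = \<zero>"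
        using kill by (simp add: t_def delta_def)
      then show ?thesis
        using ac bc yc x by (simp add: smult_assoc smult_closed)
    qed
    moreover have ab: "a \<otimes>\<^bsub>R\<^esub> b \<in> rpart R 0"
      using R.part_mult[of a 0 b 0] a bc by simp
    ultimately have "a \<otimes>\<^bsub>R\<^esub> b \<in> ann (prod_image ys)"
      by (auto simp: ann_def prod_image_def)
    then have "a \<otimes>\<^bsub>R\<^esub> b \<in> P 0" using nP(3) by blast
    then show "b \<in> P 0"
      using p.I_prime[of a b] a bc by auto
  qed
  then have "mod_dim \<le> dim_above (even_ring R) (gr_ann (gr_prod_image ?Ys))"
    using dim_above_ge[OF nP(2)] nP(1) by simp
  moreover have "dim_above (even_ring R) (gr_ann (gr_prod_image ?Ys)) \<le> mod_dim"
    unfolding dim_gr_ann_carrier[symmetric]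
    by (intro dim_above_antimono gr_ann_antimono gr_prod_image_subset YS)
  ultimately show ?thesis
    using Y(1) YS by (simp add: gr_odd_parameters_iff)
qed

text \<open>For nonzero \<open>M\<close> the annihilator omits 1, so a prime lies above it and forms
  a chain of length 0.\<close>

lemma mod_dim_nonneg:
  assumes "carrier M \<noteq> {\<zero>}"
  shows "mod_dim \<noteq> -\<infinity>"
proof -
  interpret A: cring "even_ring R" by (rule R.even_ring_cring)
  have "\<one>\<^bsub>even_ring R\<^esub> \<notin> ann (carrier M)"
  proof
    assume "\<one>\<^bsub>even_ring R\<^esub> \<in> ann (carrier M)"
    then have "\<forall>x\<in>carrier M. x = \<zero>" using smult_one by (simp add: ann_def)
    then show False using assms M.zero_closed by blast
  qed
  then obtain p where p: "primeideal p (even_ring R)" "ann (carrier M) \<subseteq> p"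
    using A.primeideal_above[OF ann_ideal[of "carrier M"]] by blast
  have "prime_chain (even_ring R) 0 (\<lambda>_. p)" using p by (simp add: prime_chain_def)
  from dim_above_ge[OF this p(2)] show ?thesis by auto
qed

lemma sdim_gr:
  assumes fin: "krull_dim (even_ring R) < \<infinity>" and "carrier M \<noteq> {\<zero>}"
  shows "sdim R M = sdim gr grM"
proof -
  have pos: "mod_dim \<noteq> -\<infinity>" using assms(2) by (rule mod_dim_nonneg)
  have "sdim1 R M \<le> sdim1 gr grM"
    unfolding sdim1_def
  proof (rule SUP_least)
    fix ys assume "ys \<in> {ys. odd_parameters R M ys}"
    then have ys: "odd_parameters R M ys" by simp
    obtain N where N: "\<forall>ys. odd_parameters R M ys \<longrightarrow> length ys \<le> N"
      using parameters_length_bounded[OF pos] ..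
    \<comment> \<open>Only systems of maximal length are known to pass to \<open>gr M\<close>, so
      \<open>ys\<close> is first replaced by a longest system.\<close>
    obtain zs where zs: "odd_parameters R M zs" "\<And>xs. odd_parameters R M xs \<Longrightarrow> length xs \<le> length zs"
      using ex_has_greatest_nat[of "odd_parameters R M" ys length "Suc N"] ys N
      by (metis le_imp_less_Suc)
    have "enat (length ys) \<le> enat (length (map (degree_class 1) zs))"
      using zs(2)[OF ys] by simp
    also have "\<dots> \<le> (SUP Ys\<in>{Ys. odd_parameters gr grM Ys}. enat (length Ys))"
      using parameters_imp_gr_parameters[OF fin pos zs] by (intro SUP_upper) simp
    finally show "enat (length ys) \<le> (SUP Ys\<in>{Ys. odd_parameters gr grM Ys}. enat (length Ys))" .
  qed
  moreover have "sdim1 gr grM \<le> sdim1 R M"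
    unfolding sdim1_def
  proof (rule SUP_mono)
    fix Ys assume "Ys \<in> {Ys. odd_parameters gr grM Ys}"
    then obtain zs where "odd_parameters R M zs" "length zs = length Ys"
      using gr_parameters_imp_parameters[OF fin pos, of Ys] by auto
    then show "\<exists>zs\<in>{zs. odd_parameters R M zs}. enat (length Ys) \<le> enat (length zs)"
      by (intro bexI[of _ zs]) auto
  qed
  ultimately show ?thesis
    by (simp add: sdim_def sdim0_def mdim_gr)
qed

end

theorem theorem5p4:
  fixes R :: "'a superring" and M :: "('a, 'b) supermodule"
  assumes "noetherian_superring R"
    and "krull_dim (even_ring R) < \<infinity>"
    and "supermodule R M"
    and "fin_generated R M"
    and "carrier M \<noteq> {\<zero>\<^bsub>M\<^esub>}"
  shows "sdim R M = sdim (gr_ring R (odd_ideal R)) (gr_module R (odd_ideal R) M)"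
proof -
  interpret R: noetherian_superring R by fact
  interpret M: supermodule R M by fact
  interpret noetherian_supermodule R M by unfold_locales
  show ?thesis using assms(2,5) by (rule sdim_gr)
qed

end
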